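(* Let $\mathbb{G}$ be a homogeneous group of homogeneous dimension $Q\ge3$, let $|\cdot|$ be a homogeneous quasi-norm on $\mathbb{G}$, and let $\mathcal{R}$ be the associated radial derivative operator. Let $\alpha\in\mathbb{R}$ with $Q-2\alpha-2\ne0$. Then for all complex-valued functions $f\in C_0^\infty(\mathbb{G}\setminus\{0\})$, $$\left\|\frac{f}{|x|^{\alpha+1}}\right\|_{L^2(\mathbb{G})}\le\frac{2}{|Q-2-2\alpha|}\left\|\frac{1}{|x|^\alpha}\mathcal{R}f\right\|_{L^2(\mathbb{G})}.$$ The constant $\frac{2}{|Q-2-2\alpha|}$ is sharp (it is the smallest constant for which the inequality holds for all such $f$), and it is attained (i.e. equality holds) if and only if $f=0$.
   Context: A homogeneous group $\mathbb{G}$ is a connected, simply connected Lie group whose Lie algebra $\mathfrak{g}$ is equipped with a family of dilations $D_\lambda=\mathrm{Exp}(A\ln\lambda)=\sum_{k\ge0}\frac{1}{k!}(\ln(\lambda)A)^k$, $\lambda>0$, where $A$ is a diagonalisable linear operator on $\mathfrak{g}$ with positive eigenvalues and each $D_\lambda$ is a Lie algebra morphism. Such a group is nilpotent and the exponential map $\exp_{\mathbb{G}}:\mathfrak{g}\to\mathbb{G}$ is a global diffeomorphism; it transports the dilations to $\mathbb{G}$, where they are written $D_\lambda x$ or $\lambda x$, i.e. $D_\lambda(\exp_{\mathbb{G}}X)=\exp_{\mathbb{G}}(D_\lambda X)$. The homogeneous dimension is $Q=\mathrm{Tr}\,A$. The identity element of $\mathbb{G}$ is denoted $0$, $dx$ denotes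 Haar measure on $\mathbb{G}$, and $L^2(\mathbb{G})$ is taken with respect to $dx$. A homogeneous quasi-norm is a continuous function $|\cdot|:\mathbb{G}\to[0,\infty)$ with $|x^{-1}|=|x|$ for all $x\in\mathbb{G}$, $|\lambda x|=\lambda|x|$ for all $x\in\mathbb{G}$, $\lambda>0$, and $|x|=0$ if and only if $x=0$. The operator $\mathcal{R}=\frac{d}{d|x|}$ is the radial derivative: for $x\neq 0$, writing $x=D_{\rho}y$ with $\rho=|x|$ and $|y|=1$, $\mathcal{R}f(x)=\frac{d}{dr}f(D_r y)\big|_{r=\rho}$. $C_0^\infty(\mathbb{G}\setminus\{0\})$ is the space of smooth functions with compact support in $\mathbb{G}\setminus\{0\}$. *)

theory Defs
  imports "HOL-Analysis.Analysis"
begin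

section \<open>Smooth maps between Euclidean spaces\<close>

text \<open>Only meant for open \<open>S\<close> in a finite-dimensional space.\<close>

primrec Ck_on :: "nat \<Rightarrow> 'a::real_normed_vector set \<Rightarrow> ('a \<Rightarrow> 'b::real_normed_vector) \<Rightarrow> bool" where
  "Ck_on 0 S f \<longleftrightarrow> continuous_on S f"
| "Ck_on (Suc k) S f \<longleftrightarrow>
     (\<forall>x\<in>S. f differentiable (at x)) \<and>
     (\<forall>v. Ck_on k S (\<lambda>x. frechet_derivative f (at x) v))"

definition smooth_on :: "'a::real_normed_vector set \<Rightarrow> ('a \<Rightarrow> 'b::real_normed_vector) \<Rightarrow> bool" where
  "smooth_on S f \<longleftrightarrow> (\<forall>k. Ck_on k S f)"

section \<open>Smooth manifolds\<close>

text \<open>A chart is a pair \<open>(U, \<phi>)\<close>; the values of \<open>\<phi>\<close> outside its domain \<open>U\<close> are irrelevant.\<close>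

type_synonym ('g, 'a) chart = "'g set \<times> ('g \<Rightarrow> 'a)"

definition smooth_atlas ::
  "('g::topological_space, 'a::euclidean_space) chart set \<Rightarrow> bool" where
  "smooth_atlas \<A> \<longleftrightarrow>
     (\<Union>(U, \<phi>)\<in>\<A>. U) = UNIV \<and>
     (\<forall>(U, \<phi>)\<in>\<A>. open U \<and> open (\<phi> ` U) \<and> homeomorphism U (\<phi> ` U) \<phi> (inv_into U \<phi>)) \<and>
     (\<forall>(U, \<phi>)\<in>\<A>. \<forall>(V, \<psi>)\<in>\<A>. smooth_on (\<phi> ` (U \<inter> V)) (\<psi> \<circ> inv_into U \<phi>))"

definition smooth_from ::
  "('g::topological_space, 'a::euclidean_space) chart set \<Rightarrow> ('g \<Rightarrow> 'b::real_normed_vector) \<Rightarrow> bool" where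
  "smooth_from \<A> f \<longleftrightarrow> (\<forall>(U, \<phi>)\<in>\<A>. smooth_on (\<phi> ` U) (f \<circ> inv_into U \<phi>))"

definition smooth_into ::
  "('g::topological_space, 'a::euclidean_space) chart set \<Rightarrow> ('b::real_normed_vector \<Rightarrow> 'g) \<Rightarrow> bool" where
  "smooth_into \<A> c \<longleftrightarrow>
     continuous_on UNIV c \<and> (\<forall>(U, \<phi>)\<in>\<A>. smooth_on (c -` U) (\<phi> \<circ> c))"

section \<open>Lie groups\<close>

text \<open>
  The groups are not assumed commutative, but they are written additively, since this is the
  notation of the type classes \<open>group_add\<close> and \<open>topological_group_add\<close>: the product of
  \<open>x\<close> and \<open>y\<close> is \<open>x + y\<close>, the inverse of \<open>x\<close> is \<open>- x\<close> and the identity is \<open>0\<close>.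
\<close>

locale lie_group =
  fixes \<A> :: "('g::{topological_group_add, t2_space, second_countable_topology},
               'a::euclidean_space) chart set"
  assumes atlas: "smooth_atlas \<A>"
    and smooth_mult:
      "\<And>U \<phi> V \<psi> W \<theta>. (U, \<phi>) \<in> \<A> \<Longrightarrow> (V, \<psi>) \<in> \<A> \<Longrightarrow> (W, \<theta>) \<in> \<A> \<Longrightarrow>
         smooth_on {(\<phi> x, \<psi> y) | x y. x \<in> U \<and> y \<in> V \<and> x + y \<in> W}
           (\<lambda>(a, b). \<theta> (inv_into U \<phi> a + inv_into V \<psi> b))"
    and smooth_inverse:
      "\<And>U \<phi> V \<psi>. (U, \<phi>) \<in> \<A> \<Longrightarrow> (V, \<psi>) \<in> \<A> \<Longrightarrow>
         smooth_on (\<phi> ` {x \<in> U. - x \<in> V}) (\<lambda>a. \<psi> (- inv_into U \<phi> a))"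

text \<open>
  The derivative of \<open>f\<close> along the left-invariant vector field generated by \<open>X\<close>, where \<open>E\<close> is
  the exponential map.
\<close>

definition left_invariant_field ::
  "('a::real_vector \<Rightarrow> 'g::plus) \<Rightarrow> 'a \<Rightarrow> ('g \<Rightarrow> real) \<Rightarrow> 'g \<Rightarrow> real" where
  "left_invariant_field E X f x = deriv (\<lambda>t. f (x + E (t *\<^sub>R X))) 0"

text \<open>
  The Lie algebra of the group is presented on a Euclidean space \<open>'a\<close> of the same dimension (its
  inner product plays no role). \<open>E\<close> is the exponential map: it is smooth, \<open>t \<mapsto> E (t X)\<close> is a
  one-parameter subgroup for every \<open>X\<close>, and the differential of \<open>E\<close> at \<open>0\<close> is a linear isomorphism,
  which identifies \<open>'a\<close> with the tangent space at the identity. Every Lie group has such a map, and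
  it is unique up to the identification. The bracket is the commutator of left-invariant vector
  fields. No global injectivity or surjectivity of \<open>E\<close> and no nilpotency is required.
\<close>

locale lie_group_with_algebra = lie_group \<A>
  for \<A> :: "('g::{topological_group_add, t2_space, second_countable_topology},
              'a::euclidean_space) chart set" +
  fixes E :: "'a \<Rightarrow> 'g"
    and bracket :: "'a \<Rightarrow> 'a \<Rightarrow> 'a"
  assumes exp_smooth: "smooth_into \<A> E"
    and exp_one_parameter: "\<And>s t X. E ((s + t) *\<^sub>R X) = E (s *\<^sub>R X) + E (t *\<^sub>R X)"
    and exp_derivative:
      "\<And>U \<phi>. (U, \<phi>) \<in> \<A> \<Longrightarrow> 0 \<in> U \<Longrightarrow> bij (frechet_derivative (\<phi> \<circ> E) (at 0))"
    and bracket_commutator: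
      "\<And>X Y f x. smooth_from \<A> f \<Longrightarrow>
         left_invariant_field E (bracket X Y) f x =
           left_invariant_field E X (left_invariant_field E Y f) x -
           left_invariant_field E Y (left_invariant_field E X f) x"

section \<open>Homogeneous groups\<close>

definition diagonalisable :: "('a::real_vector \<Rightarrow> 'a) \<Rightarrow> bool" where
  "diagonalisable A \<longleftrightarrow>
     linear A \<and> (\<exists>B. independent B \<and> span B = UNIV \<and> (\<forall>b\<in>B. \<exists>c. A b = c *\<^sub>R b))"

definition operator_trace :: "('a::euclidean_space \<Rightarrow> 'a) \<Rightarrow> real" where
  "operator_trace A = (\<Sum>b\<in>Basis. A b \<bullet> b)"

text \<open>\<open>Exp (A ln r)\<close> for an operator \<open>A\<close> on the Lie algebra, as a power series.\<close>

definition algebra_dilation ::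
  "('a::real_normed_vector \<Rightarrow> 'a) \<Rightarrow> real \<Rightarrow> 'a \<Rightarrow> 'a" where
  "algebra_dilation A r X = (\<Sum>k. (1 / fact k) *\<^sub>R ((\<lambda>Y. ln r *\<^sub>R A Y) ^^ k) X)"

locale homogeneous_group = lie_group_with_algebra \<A> E bracket
  for \<A> :: "('g::{topological_group_add, t2_space, second_countable_topology},
              'a::euclidean_space) chart set"
    and E :: "'a \<Rightarrow> 'g"
    and bracket :: "'a \<Rightarrow> 'a \<Rightarrow> 'a" +
  fixes A :: "'a \<Rightarrow> 'a"
  assumes connected_group: "connected (UNIV :: 'g set)"
    and simply_connected_group: "simply_connected (UNIV :: 'g set)"
    and A_diagonalisable: "diagonalisable A"
    and A_positive: "\<And>X c. X \<noteq> 0 \<Longrightarrow> A X = c *\<^sub>R X \<Longrightarrow> c > 0"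
    and dilation_linear: "\<And>r. r > 0 \<Longrightarrow> linear (algebra_dilation A r)"
    and dilation_bracket:
      "\<And>r X Y. r > 0 \<Longrightarrow>
         algebra_dilation A r (bracket X Y) =
           bracket (algebra_dilation A r X) (algebra_dilation A r Y)"

text \<open>
  The dilations transported to the group. In a homogeneous group \<open>E\<close> is a bijection (a theorem,
  not a hypothesis), so \<open>inv E\<close> is its true inverse.
\<close>

definition group_dilation :: "('a::real_normed_vector \<Rightarrow> 'g) \<Rightarrow> ('a \<Rightarrow> 'a) \<Rightarrow> real \<Rightarrow> 'g \<Rightarrow> 'g" where
  "group_dilation E A r x = E (algebra_dilation A r (inv E x))"

definition homogeneous_quasi_norm ::
  "('a::real_normed_vector \<Rightarrow> 'g::{topological_space, group_add}) \<Rightarrow> ('a \<Rightarrow> 'a) \<Rightarrow> ('g \<Rightarrow> real) \<Rightarrow> bool" where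
  "homogeneous_quasi_norm E A N \<longleftrightarrow>
     continuous_on UNIV N \<and>
     (\<forall>x. N x \<ge> 0) \<and>
     (\<forall>x. N (- x) = N x) \<and>
     (\<forall>x. \<forall>r>0. N (group_dilation E A r x) = r * N x) \<and>
     (\<forall>x. N x = 0 \<longleftrightarrow> x = 0)"

text \<open>
  For \<open>x \<noteq> 0\<close> the point \<open>y = D(1/|x|) x\<close> is the one with \<open>|y| = 1\<close> and \<open>x = D(|x|) y\<close>. The value at
  \<open>x = 0\<close> is irrelevant.
\<close>

definition radial_derivative ::
  "('a::real_normed_vector \<Rightarrow> 'g) \<Rightarrow> ('a \<Rightarrow> 'a) \<Rightarrow> ('g \<Rightarrow> real) \<Rightarrow> ('g \<Rightarrow> complex) \<Rightarrow> 'g \<Rightarrow> complex" where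
  "radial_derivative E A N f x =
     (let y = group_dilation E A (1 / N x) x
      in vector_derivative (\<lambda>r. f (group_dilation E A r y)) (at (N x)))"

text \<open>
  Smooth functions with compact support in the group minus the identity, extended by zero to the
  whole group.
\<close>

definition test_functions ::
  "('g::{topological_space, zero}, 'a::euclidean_space) chart set \<Rightarrow> ('g \<Rightarrow> complex) set" where
  "test_functions \<A> =
     {f. smooth_from \<A> f \<and> compact (closure {x. f x \<noteq> 0}) \<and> 0 \<notin> closure {x. f x \<noteq> 0}}"

section \<open>Haar measure and the space \<open>L\<^sup>2\<close>\<close>

text \<open>
  On a second countable locally compact Hausdorff space a Borel measure that is finite on compact
  sets is regular, so regularity is not listed. Homogeneous groups are unimodular, so left
  invariance is no restriction.
\<close>

definition haar_measure :: "'g::{topological_space, plus} measure \<Rightarrow> bool" where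
  "haar_measure \<mu> \<longleftrightarrow>
     sets \<mu> = sets borel \<and>
     (\<forall>a. distr \<mu> borel (\<lambda>x. a + x) = \<mu>) \<and>
     (\<forall>K. compact K \<longrightarrow> emeasure \<mu> K < \<infinity>) \<and>
     emeasure \<mu> UNIV \<noteq> 0"

definition square_integrable :: "'g measure \<Rightarrow> ('g \<Rightarrow> complex) \<Rightarrow> bool" where
  "square_integrable \<mu> g \<longleftrightarrow>
     g \<in> borel_measurable \<mu> \<and> integrable \<mu> (\<lambda>x. (cmod (g x))\<^sup>2)"

text \<open>Meaningful only for square-integrable \<open>g\<close>: the Bochner integral of a non-integrable function
  is \<open>0\<close>.\<close>

definition L2_norm :: "'g measure \<Rightarrow> ('g \<Rightarrow> complex) \<Rightarrow> real" where
  "L2_norm \<mu> g = sqrt (\<integral>x. (cmod (g x))\<^sup>2 \<partial>\<mu>)"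

end

theory Submission
  imports Defs
begin

text \<open>
  A dilation commutes with the left-trivialised differential of the exponential map \<open>E\<close>, because
  along every ray this differential solves a linear differential equation that involves only the
  bracket. Hence \<open>E (Z t) = x + E (t Y)\<close> is preserved by the dilations along every curve \<open>Z\<close>, and the
  product that \<open>E\<close> induces near \<open>0\<close> in the Lie algebra extends by scaling to a global one, for which
  \<open>E\<close> is a homomorphism with discrete kernel; simple connectedness makes it bijective. In exponential
  coordinates translations have a Jacobian determinant that is invariant under the contracting
  dilations, hence equal to \<open>1\<close>: Haar measure is a multiple of Lebesgue measure and scales by \<open>r\<^sup>Q\<close>.

  Differentiating a scaling identity for \<open>\<integral> |f|\<^sup>2 |x|\<^bsup>- 2 \<alpha> - 2\<^esup>\<close> gives, with \<open>\<kappa> = (Q - 2 - 2 \<alpha>) / 2\<close>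
  and \<open>X = |x| \<R>\<close>,
  \<open>\<integral> |X f|\<^sup>2 |x|\<^bsup>- 2 \<alpha> - 2\<^esup> = \<kappa>\<^sup>2 \<integral> |f|\<^sup>2 |x|\<^bsup>- 2 \<alpha> - 2\<^esup> + \<integral> |X f + \<kappa> f|\<^sup>2 |x|\<^bsup>- 2 \<alpha> - 2\<^esup>\<close>.
  Equality forces \<open>f\<close> to be homogeneous of degree \<open>- \<kappa>\<close>, which is incompatible with compact
  support, and truncations of homogeneous functions show that the constant is sharp.
\<close>

section \<open>Calculus of smooth maps\<close>

text \<open>Two obstacles shape the proof. The group is given only by an atlas, and \<open>E\<close>
  is at first understood only near \<open>0\<close>, so it is not clear that a dilation of the Lie
  algebra induces any map of the group. Group-valued maps are therefore differentiated after a left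
  translation to the identity, where a local logarithm is available, and automorphisms are compared
  along curves instead of through a global inverse of \<open>E\<close>.

  The quasi-norm is merely continuous. Along a dilation orbit, however, it is exactly exponential,
  and derivatives along orbits are the only ones that the Hardy identity involves; this replaces
  polar coordinates and a surface measure on the unit sphere. For the same reason truncations by
  functions of \<open>|x|\<close> need not be smooth, and the almost extremal functions are built
  from a power of a linear coordinate, which is smooth where that coordinate is positive and scales
  like the quasi-norm.\<close>

lemma frechet_derivative_cong_open:
  assumes "open S" "x \<in> S" "\<And>x. x \<in> S \<Longrightarrow> f x = g x"
  shows "frechet_derivative f (at x) = frechet_derivative g (at x)"
    and "f differentiable (at x) \<longleftrightarrow> g differentiable (at x)"
proof -
  have "(f has_derivative D) (at x) \<longleftrightarrow> (g has_derivative D) (at x)" for D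
    by (rule iffI; erule has_derivative_transform_within_open[OF _ assms(1,2)]) (simp_all add: assms(3))
  then show "frechet_derivative f (at x) = frechet_derivative g (at x)"
    "f differentiable (at x) \<longleftrightarrow> g differentiable (at x)"
    by (auto simp: frechet_derivative_def differentiable_def)
qed

lemma Ck_on_cong:
  assumes "open S" "\<And>x. x \<in> S \<Longrightarrow> f x = g x"
  shows "Ck_on k S f \<longleftrightarrow> Ck_on k S g"
  using assms(2)
proof (induction k arbitrary: f g)
  case 0
  then show ?case using continuous_on_cong[OF refl, of S f g] by simp
next
  case (Suc k)
  have "Ck_on k S (\<lambda>x. frechet_derivative f (at x) v) \<longleftrightarrow> Ck_on k S (\<lambda>x. frechet_derivative g (at x) v)" for v
    by (rule Suc.IH) (simp add: frechet_derivative_cong_open(1)[OF assms(1) _ Suc.prems])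
  then show ?case
    using frechet_derivative_cong_open(2)[OF assms(1) _ Suc.prems] by auto
qed

text \<open>\<open>Ck_on\<close> refers to \<open>frechet_derivative\<close>, which is defined by
  choice; on an open set any explicit derivative may stand in for it.\<close>

lemma Ck_on_SucI:
  assumes "open S" "\<And>x. x \<in> S \<Longrightarrow> (f has_derivative f' x) (at x)" "\<And>v. Ck_on k S (\<lambda>x. f' x v)"
  shows "Ck_on (Suc k) S f"
proof -
  have "frechet_derivative f (at x) = f' x" if "x \<in> S" for x
    using frechet_derivative_at[OF assms(2)[OF that]] by simp
  then have "Ck_on k S (\<lambda>x. frechet_derivative f (at x) v)" for v
    using assms(3)[of v] Ck_on_cong[OF assms(1), of "\<lambda>x. frechet_derivative f (at x) v" "\<lambda>x. f' x v"] by simp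
  then show ?thesis
    using assms(2) by (auto simp: differentiable_def)
qed

lemma Ck_on_SucD:
  assumes "Ck_on (Suc k) S f"
  shows "x \<in> S \<Longrightarrow> (f has_derivative frechet_derivative f (at x)) (at x)"
    and "Ck_on k S (\<lambda>x. frechet_derivative f (at x) v)"
  using assms by (auto simp: frechet_derivative_works)

lemma Ck_on_imp_continuous_on: "Ck_on k S f \<Longrightarrow> continuous_on S f"
  by (cases k) (auto intro!: continuous_at_imp_continuous_on differentiable_imp_continuous_within)

lemma Ck_on_Suc_imp: "Ck_on (Suc k) S f \<Longrightarrow> Ck_on k S f"
proof (induction k arbitrary: f)
  case 0
  then show ?case using Ck_on_imp_continuous_on[OF 0] by simp
next
  case (Suc k)
  then show ?case by (metis Ck_on.simps(2))
qed

lemma Ck_on_subset: "Ck_on k S f \<Longrightarrow> T \<subseteq> S \<Longrightarrow> Ck_on k T f"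
  by (induction k arbitrary: f) (auto intro: continuous_on_subset)

lemma Ck_on_local:
  assumes "\<And>x. x \<in> S \<Longrightarrow> \<exists>T. open T \<and> x \<in> T \<and> Ck_on k T f"
  shows "Ck_on k S f"
  using assms
proof (induction k arbitrary: f)
  case 0
  have "isCont f x" if "x \<in> S" for x
    using 0[OF that] continuous_on_eq_continuous_at[of _ f] by auto
  then show ?case by (simp add: continuous_at_imp_continuous_on)
next
  case (Suc k)
  have "Ck_on k S (\<lambda>x. frechet_derivative f (at x) v)" for v
  proof (rule Suc.IH)
    fix x assume "x \<in> S"
    from Suc.prems[OF this] obtain T where "open T" "x \<in> T" "Ck_on (Suc k) T f" by auto
    then show "\<exists>T. open T \<and> x \<in> T \<and> Ck_on k T (\<lambda>x. frechet_derivative f (at x) v)"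
      by auto
  qed
  moreover have "f differentiable (at x)" if "x \<in> S" for x
    using Suc.prems[OF that] by auto
  ultimately show ?case by simp
qed

lemma Ck_on_const: "open S \<Longrightarrow> Ck_on k S (\<lambda>x. c)"
proof (induction k arbitrary: c)
  case (Suc k)
  show ?case
    by (rule Ck_on_SucI[OF Suc.prems, where f' = "\<lambda>_ _. 0"]) (use Suc in auto)
qed simp

lemma Ck_on_bounded_linear:
  assumes "open S" "bounded_linear l" "Ck_on k S f"
  shows "Ck_on k S (\<lambda>x. l (f x))"
  using assms(3)
proof (induction k arbitrary: f)
  case 0
  then show ?case using assms(2) by (auto intro: bounded_linear.continuous_on)
next
  case (Suc k)
  show ?case
    by (rule Ck_on_SucI[OF assms(1) bounded_linear.has_derivative[OF assms(2) Ck_on_SucD(1)[OF Suc.prems]]])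
      (auto intro: Suc.IH Ck_on_SucD(2)[OF Suc.prems])
qed

lemma Ck_on_ident: "open S \<Longrightarrow> Ck_on k S (\<lambda>x. x)"
  by (cases k) (auto intro!: Ck_on_SucI[where f' = "\<lambda>x v. v"] Ck_on_const has_derivative_ident simp del: Ck_on.simps(2))

lemma Ck_on_linear: "open S \<Longrightarrow> bounded_linear l \<Longrightarrow> Ck_on k S l"
  using Ck_on_bounded_linear[OF _ _ Ck_on_ident] by blast

lemma Ck_on_add:
  assumes "open S" "Ck_on k S f" "Ck_on k S g"
  shows "Ck_on k S (\<lambda>x. f x + g x)"
  using assms(2,3)
proof (induction k arbitrary: f g)
  case (Suc k)
  show ?case
    by (rule Ck_on_SucI[OF assms(1) has_derivative_add[OF Ck_on_SucD(1)[OF Suc.prems(1)] Ck_on_SucD(1)[OF Suc.prems(2)]]])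
      (auto intro: Suc.IH Ck_on_SucD(2)[OF Suc.prems(1)] Ck_on_SucD(2)[OF Suc.prems(2)])
qed (auto intro: continuous_on_add)

lemma Ck_on_sum:
  assumes "open S" "finite I" "\<And>i. i \<in> I \<Longrightarrow> Ck_on k S (f i)"
  shows "Ck_on k S (\<lambda>x. \<Sum>i\<in>I. f i x)"
  using assms(2,3) by (induction I rule: finite_induct) (auto intro: Ck_on_const Ck_on_add assms(1))

lemma Ck_on_minus: "open S \<Longrightarrow> Ck_on k S f \<Longrightarrow> Ck_on k S (\<lambda>x. - f x)"
  by (rule Ck_on_bounded_linear[OF _ bounded_linear_minus[OF bounded_linear_ident]])

lemma Ck_on_diff: "open S \<Longrightarrow> Ck_on k S f \<Longrightarrow> Ck_on k S g \<Longrightarrow> Ck_on k S (\<lambda>x. f x - g x)"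
  using Ck_on_add[of S k f "\<lambda>x. - g x"] Ck_on_minus[of S k g] by simp

lemma Ck_on_Pair:
  assumes "open S" "Ck_on k S f" "Ck_on k S g"
  shows "Ck_on k S (\<lambda>x. (f x, g x))"
  using assms(2,3)
proof (induction k arbitrary: f g)
  case (Suc k)
  show ?case
    by (rule Ck_on_SucI[OF assms(1) has_derivative_Pair[OF Ck_on_SucD(1)[OF Suc.prems(1)] Ck_on_SucD(1)[OF Suc.prems(2)]]])
      (auto intro: Suc.IH Ck_on_SucD(2)[OF Suc.prems(1)] Ck_on_SucD(2)[OF Suc.prems(2)])
qed (auto intro: continuous_on_Pair)

lemma Ck_on_scaleR:
  assumes "open S" "Ck_on k S f" "Ck_on k S g"
  shows "Ck_on k S (\<lambda>x. f x *\<^sub>R g x)"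
  using assms(2,3)
proof (induction k arbitrary: f g)
  case (Suc k)
  show ?case
    by (rule Ck_on_SucI[OF assms(1) has_derivative_scaleR[OF Ck_on_SucD(1)[OF Suc.prems(1)] Ck_on_SucD(1)[OF Suc.prems(2)]]])
      (auto intro!: Ck_on_add[OF assms(1)] Suc.IH Ck_on_SucD(2)[OF Suc.prems(1)] Ck_on_SucD(2)[OF Suc.prems(2)]
        Ck_on_Suc_imp[OF Suc.prems(1)] Ck_on_Suc_imp[OF Suc.prems(2)])
qed (auto intro: continuous_on_scaleR)

lemma bounded_linear_euclidean_expand:
  fixes D :: "'a::euclidean_space \<Rightarrow> 'b::real_normed_vector"
  assumes "bounded_linear D"
  shows "D w = (\<Sum>b\<in>Basis. (w \<bullet> b) *\<^sub>R D b)"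
proof -
  interpret bounded_linear D by fact
  have "D w = D (\<Sum>b\<in>Basis. (w \<bullet> b) *\<^sub>R b)" by (simp add: euclidean_representation)
  then show ?thesis by (simp add: sum scaleR)
qed

text \<open>In the chain rule the direction in which \<open>g\<close> is differentiated varies with
  \<open>x\<close>. Expanding it in \<open>Basis\<close> leaves partial derivatives of
  \<open>g\<close> in fixed directions, composed with \<open>f\<close>, and the induction hypothesis
  applies to these.\<close>

lemma Ck_on_compose:
  fixes f :: "'a::real_normed_vector \<Rightarrow> 'b::euclidean_space" and g :: "'b \<Rightarrow> 'c::real_normed_vector"
  assumes "open S" "Ck_on k S f" "Ck_on k T g" "f ` S \<subseteq> T"
  shows "Ck_on k S (\<lambda>x. g (f x))"
  using assms(2,3)
proof (induction k arbitrary: g)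
  case 0
  then show ?case using assms(4) by (auto intro: continuous_on_compose2)
next
  case (Suc k)
  have *: "Ck_on k S (\<lambda>x. \<Sum>b\<in>Basis. (frechet_derivative f (at x) v \<bullet> b) *\<^sub>R frechet_derivative g (at (f x)) b)" for v
    by (intro Ck_on_sum Ck_on_scaleR assms finite_Basis Suc.IH Ck_on_SucD(2)[OF Suc.prems(2)]
        Ck_on_Suc_imp[OF Suc.prems(1)] Ck_on_SucD(2)[OF Suc.prems(1)]
        Ck_on_bounded_linear[OF assms(1) bounded_linear_inner_left])
  have g: "(g has_derivative frechet_derivative g (at (f x))) (at (f x))" if "x \<in> S" for x
    using Ck_on_SucD(1)[OF Suc.prems(2)] assms(4) that by auto
  show ?case
  proof (rule Ck_on_SucI[OF assms(1)])
    fix x assume "x \<in> S"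
    note d = has_derivative_compose[OF Ck_on_SucD(1)[OF Suc.prems(1) this] g[OF this]]
    show "((\<lambda>x. g (f x)) has_derivative
        (\<lambda>v. \<Sum>b\<in>Basis. (frechet_derivative f (at x) v \<bullet> b) *\<^sub>R frechet_derivative g (at (f x)) b)) (at x)"
      using d by (subst (asm) bounded_linear_euclidean_expand[OF has_derivative_bounded_linear[OF g[OF \<open>x \<in> S\<close>]]])
  qed (rule *)
qed

lemma Ck_on_vector_SucI:
  fixes f :: "real \<Rightarrow> 'b::real_normed_vector"
  assumes "open S" "\<And>x. x \<in> S \<Longrightarrow> (f has_vector_derivative f' x) (at x)" "Ck_on k S f'"
  shows "Ck_on (Suc k) S f"
  by (rule Ck_on_SucI[OF assms(1), where f' = "\<lambda>x v. v *\<^sub>R f' x"])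
    (use assms in \<open>auto simp: has_vector_derivative_def intro: Ck_on_bounded_linear bounded_linear_scaleR_right\<close>)

lemma smooth_onI: "(\<And>k. Ck_on k S f) \<Longrightarrow> smooth_on S f"
  by (simp add: smooth_on_def)

lemma smooth_on_Ck_on: "smooth_on S f \<Longrightarrow> Ck_on k S f"
  by (simp add: smooth_on_def)

lemma smooth_on_continuous_on: "smooth_on S f \<Longrightarrow> continuous_on S f"
  by (meson Ck_on_imp_continuous_on smooth_on_def)

lemma smooth_on_has_derivative:
  "smooth_on S f \<Longrightarrow> x \<in> S \<Longrightarrow> (f has_derivative frechet_derivative f (at x)) (at x)"
  by (meson Ck_on_SucD(1) smooth_on_def)

lemma smooth_on_frechet_derivative: "smooth_on S f \<Longrightarrow> smooth_on S (\<lambda>x. frechet_derivative f (at x) v)"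
  by (rule smooth_onI, rule Ck_on_SucD(2), rule smooth_on_Ck_on)

lemma smooth_on_cong: "open S \<Longrightarrow> (\<And>x. x \<in> S \<Longrightarrow> f x = g x) \<Longrightarrow> smooth_on S f \<longleftrightarrow> smooth_on S g"
  using Ck_on_cong[of S f g] by (simp add: smooth_on_def)

lemma smooth_on_subset: "smooth_on S f \<Longrightarrow> T \<subseteq> S \<Longrightarrow> smooth_on T f"
  by (rule smooth_onI, rule Ck_on_subset, rule smooth_on_Ck_on)

lemma smooth_on_local: "(\<And>x. x \<in> S \<Longrightarrow> \<exists>T. open T \<and> x \<in> T \<and> smooth_on T f) \<Longrightarrow> smooth_on S f"
  by (rule smooth_onI, rule Ck_on_local) (meson smooth_on_Ck_on)

lemma smooth_on_const: "open S \<Longrightarrow> smooth_on S (\<lambda>x. c)"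
  by (intro smooth_onI Ck_on_const)

lemma smooth_on_linear: "open S \<Longrightarrow> bounded_linear l \<Longrightarrow> smooth_on S l"
  by (intro smooth_onI Ck_on_linear)

lemma smooth_on_bounded_linear: "open S \<Longrightarrow> bounded_linear l \<Longrightarrow> smooth_on S f \<Longrightarrow> smooth_on S (\<lambda>x. l (f x))"
  using Ck_on_bounded_linear[of S l _ f] by (simp add: smooth_on_def)

lemma smooth_on_diff: "open S \<Longrightarrow> smooth_on S f \<Longrightarrow> smooth_on S g \<Longrightarrow> smooth_on S (\<lambda>x. f x - g x)"
  using Ck_on_diff[of S _ f g] by (simp add: smooth_on_def)

lemma smooth_on_sum:
  "open S \<Longrightarrow> finite I \<Longrightarrow> (\<And>i. i \<in> I \<Longrightarrow> smooth_on S (f i)) \<Longrightarrow> smooth_on S (\<lambda>x. \<Sum>i\<in>I. f i x)"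
  using Ck_on_sum[of S I _ f] by (simp add: smooth_on_def)

lemma smooth_on_Pair: "open S \<Longrightarrow> smooth_on S f \<Longrightarrow> smooth_on S g \<Longrightarrow> smooth_on S (\<lambda>x. (f x, g x))"
  using Ck_on_Pair[of S _ f g] by (simp add: smooth_on_def)

lemma smooth_on_scaleR: "open S \<Longrightarrow> smooth_on S f \<Longrightarrow> smooth_on S g \<Longrightarrow> smooth_on S (\<lambda>x. f x *\<^sub>R g x)"
  using Ck_on_scaleR[of S _ f g] by (simp add: smooth_on_def)

lemma smooth_on_mult:
  "open S \<Longrightarrow> smooth_on S f \<Longrightarrow> smooth_on S g \<Longrightarrow> smooth_on S (\<lambda>x. f x * g x)" for f g :: "_ \<Rightarrow> real"
  using smooth_on_scaleR[of S f g] by simp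

lemma smooth_on_compose:
  fixes f :: "'a::real_normed_vector \<Rightarrow> 'b::euclidean_space"
  shows "open S \<Longrightarrow> smooth_on S f \<Longrightarrow> smooth_on T g \<Longrightarrow> f ` S \<subseteq> T \<Longrightarrow> smooth_on S (\<lambda>x. g (f x))"
  using Ck_on_compose[of S _ f T g] by (simp add: smooth_on_def)

lemma smooth_on_inner:
  fixes f g :: "'a::real_normed_vector \<Rightarrow> 'b::euclidean_space"
  assumes "open S" "smooth_on S f" "smooth_on S g"
  shows "smooth_on S (\<lambda>x. f x \<bullet> g x)"
proof -
  have "smooth_on S (\<lambda>x. \<Sum>b\<in>Basis. (f x \<bullet> b) * (g x \<bullet> b))"
    by (intro smooth_on_sum smooth_on_mult assms finite_Basis
        smooth_on_bounded_linear[OF assms(1) bounded_linear_inner_left])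
  then show ?thesis by (simp add: euclidean_inner[symmetric])
qed

section \<open>Powers and the logarithm on the positive half-line\<close>

lemma Ck_on_powr: "Ck_on k {0<..} (\<lambda>x::real. x powr a)"
proof (induction k arbitrary: a)
  case 0
  show ?case by (auto intro!: continuous_intros)
next
  case (Suc k)
  have "Ck_on k {0<..} (\<lambda>x. a *\<^sub>R x powr (a - 1))"
    by (rule Ck_on_bounded_linear[OF _ bounded_linear_scaleR_right Suc]) auto
  then show ?case
    by (intro Ck_on_vector_SucI[where f' = "\<lambda>x. a *\<^sub>R x powr (a - 1)"])
      (auto simp: has_real_derivative_iff_has_vector_derivative[symmetric] intro!: derivative_eq_intros)
qed

lemma smooth_on_powr: "smooth_on {0<..} (\<lambda>x::real. x powr a)"
  by (intro smooth_onI Ck_on_powr)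

lemma smooth_on_ln: "smooth_on {0<..} (ln :: real \<Rightarrow> real)"
proof (rule smooth_onI)
  fix k
  have "Ck_on (Suc k) {0<..} (ln :: real \<Rightarrow> real)"
  proof (rule Ck_on_vector_SucI)
    show "(ln has_vector_derivative x powr (-1)) (at x)" if "x \<in> {0<..}" for x :: real
      using that by (auto simp: has_real_derivative_iff_has_vector_derivative[symmetric] powr_minus_divide
          intro!: derivative_eq_intros)
  qed (simp, rule Ck_on_powr)
  then show "Ck_on k {0<..} (ln :: real \<Rightarrow> real)" by (rule Ck_on_Suc_imp)
qed

subsection \<open>A flat function\<close>

text \<open>The classical \<open>exp (- 1 / x)\<close> together with the quotients by powers of
  \<open>x\<close> that its derivatives produce. The family is closed under differentiation up to
  linear combinations, so one induction, with \<open>n\<close> arbitrary, gives smoothness.\<close>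

definition flat_exp :: "nat \<Rightarrow> real \<Rightarrow> real" where
  "flat_exp n x = (if x > 0 then exp (- 1 / x) / x ^ n else 0)"

lemma flat_exp_tendsto_0: "(flat_exp n \<longlongrightarrow> 0) (at 0)"
proof -
  have "((\<lambda>y::real. y ^ n / exp y) \<longlongrightarrow> 0) at_top"
    by (rule tendsto_power_div_exp_0)
  then have "((\<lambda>x::real. inverse x ^ n / exp (inverse x)) \<longlongrightarrow> 0) (at_right 0)"
    by (rule filterlim_compose[OF _ filterlim_inverse_at_top_right])
  moreover have "\<forall>\<^sub>F x in at_right 0. inverse x ^ n / exp (inverse x) = flat_exp n x"
    by (auto simp: eventually_at_filter flat_exp_def field_simps exp_minus power_inverse inverse_eq_divide)
  ultimately have "(flat_exp n \<longlongrightarrow> 0) (at_right 0)"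
    by (rule Lim_transform_eventually)
  moreover have "(flat_exp n \<longlongrightarrow> 0) (at_left 0)"
    by (rule Lim_transform_eventually[OF tendsto_const]) (auto simp: eventually_at_filter flat_exp_def)
  ultimately show ?thesis by (simp add: filterlim_at_split)
qed

lemma flat_exp_has_derivative:
  "(flat_exp n has_real_derivative flat_exp (n + 2) x - real n * flat_exp (n + 1) x) (at x)"
proof -
  consider "x > 0" | "x < 0" | "x = 0" by linarith
  then show ?thesis
  proof cases
    case 1
    have "((\<lambda>x. exp (- 1 / x) / x ^ n) has_real_derivative flat_exp (n + 2) x - real n * flat_exp (n + 1) x) (at x)"
    proof (cases n)
      case 0
      then show ?thesis
        using 1 by (auto intro!: derivative_eq_intros simp: flat_exp_def divide_simps power2_eq_square)
    next
      case (Suc m)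
      then show ?thesis
        using 1 by (auto intro!: derivative_eq_intros simp: flat_exp_def divide_simps power2_eq_square)
          (auto simp: algebra_simps, metis One_nat_def Suc_pred neq0_conv power_Suc)
    qed
    then show ?thesis
      by (rule has_field_derivative_transform_within_open[where S = "{0<..}"]) (use 1 in \<open>auto simp: flat_exp_def\<close>)
  next
    case 2
    have "((\<lambda>x. 0) has_real_derivative flat_exp (n + 2) x - real n * flat_exp (n + 1) x) (at x)"
      using 2 by (auto simp: flat_exp_def)
    then show ?thesis
      by (rule has_field_derivative_transform_within_open[where S = "{..<0}"]) (use 2 in \<open>auto simp: flat_exp_def\<close>)
  next
    case 3
    \<comment> \<open>At \<open>0\<close> the difference quotient of \<open>flat_exp n\<close> is
      \<open>flat_exp (Suc n)\<close> itself.\<close>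
    have "((\<lambda>h. (flat_exp n (0 + h) - flat_exp n 0) / h) \<longlongrightarrow> 0) (at 0)"
      by (rule Lim_transform_eventually[OF flat_exp_tendsto_0[of "Suc n"]])
        (auto simp: flat_exp_def eventually_at_filter field_simps)
    then show ?thesis
      unfolding 3 DERIV_def by (simp add: flat_exp_def)
  qed
qed

lemma smooth_on_flat_exp: "smooth_on UNIV (flat_exp n)"
proof (rule smooth_onI)
  fix k show "Ck_on k UNIV (flat_exp n)"
  proof (induction k arbitrary: n)
    case 0
    show ?case using DERIV_isCont[OF flat_exp_has_derivative] by (auto intro!: continuous_at_imp_continuous_on)
  next
    case (Suc k)
    have "Ck_on k UNIV (\<lambda>x. flat_exp (n + 2) x - real n *\<^sub>R flat_exp (n + 1) x)"
      by (intro Ck_on_diff Suc Ck_on_bounded_linear[OF _ bounded_linear_scaleR_right]) auto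
    then show ?case
      by (rule Ck_on_vector_SucI[OF open_UNIV, rotated])
        (use flat_exp_has_derivative[of n] in
          \<open>auto simp: has_real_derivative_iff_has_vector_derivative[symmetric]\<close>)
  qed
qed

lemma flat_exp_pos_iff: "flat_exp 0 x > 0 \<longleftrightarrow> x > 0" and flat_exp_nonneg: "flat_exp 0 x \<ge> 0"
  and flat_exp_eq_0_iff: "flat_exp 0 x = 0 \<longleftrightarrow> x \<le> 0"
  by (auto simp: flat_exp_def)

subsection \<open>The local inverse of a smooth map\<close>

lemma bij_blinfun_inverse:
  fixes D :: "'a::euclidean_space \<Rightarrow> 'a"
  assumes "bounded_linear D" "bij D"
  shows "Blinfun (inv D) o\<^sub>L Blinfun D = id_blinfun"
proof -
  have "linear (inv D)"
    using assms by (simp add: bij_is_inj bounded_linear.linear inj_linear_imp_inv_linear)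
  then have "bounded_linear (inv D)" by (simp add: linear_conv_bounded_linear)
  then show ?thesis
    using assms by (intro blinfun_eqI) (simp add: bounded_linear_Blinfun_apply bij_is_inj)
qed

text \<open>The tangent map \<open>(x, u) \<mapsto> (f x, Df x u)\<close> is differentiable with invertible derivative, so
  its inverse is differentiable; this gives the derivative of \<open>y \<mapsto> (Df (g y))\<^sup>-\<^sup>1 v\<close>.\<close>

lemma has_derivative_inverse_frechet:
  fixes f g :: "'a::euclidean_space \<Rightarrow> 'a"
  defines "J \<equiv> \<lambda>y. inv (frechet_derivative f (at (g y)))"
  assumes U: "open U" and f: "smooth_on U f" and V: "open V" and fg: "\<And>y. y \<in> V \<Longrightarrow> g y \<in> U \<and> f (g y) = y"
    and gf: "\<And>x. x \<in> U \<Longrightarrow> f x \<in> V \<and> g (f x) = x"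
    and bij: "\<And>y. y \<in> V \<Longrightarrow> bij (frechet_derivative f (at (g y)))"
    and y: "y \<in> V"
  shows "((\<lambda>y. J y v) has_derivative
     (\<lambda>w. - J y (\<Sum>c\<in>Basis. (J y v \<bullet> c) *\<^sub>R
        frechet_derivative (\<lambda>x. frechet_derivative f (at x) c) (at (g y)) (J y w)))) (at y)"
proof -
  let ?D = "\<lambda>x. frechet_derivative f (at x)"
  let ?H = "\<lambda>x c. frechet_derivative (\<lambda>x. ?D x c) (at x)"
  have Dbl: "bounded_linear (?D x)" if "x \<in> U" for x
    using has_derivative_bounded_linear[OF smooth_on_has_derivative[OF f that]] .
  have Dder: "((\<lambda>x. ?D x c) has_derivative ?H x c) (at x)" if "x \<in> U" for x c
    using smooth_on_has_derivative[OF smooth_on_frechet_derivative[OF f] that] .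
  \<comment> \<open>The linear part is written out in \<open>Basis\<close> because smoothness is
    known for the derivative in each fixed direction.\<close>
  define \<Phi> where "\<Phi> = (\<lambda>p::'a\<times>'a. (f (fst p), \<Sum>c\<in>Basis. (snd p \<bullet> c) *\<^sub>R ?D (fst p) c))"
  define \<Psi> where "\<Psi> = (\<lambda>q::'a\<times>'a. (g (fst q), J (fst q) (snd q)))"
  have \<Phi>: "\<Phi> p = (f (fst p), ?D (fst p) (snd p))" if "fst p \<in> U" for p
    using bounded_linear_euclidean_expand[OF Dbl[OF that], of "snd p"] by (simp add: \<Phi>_def)
  have inJ: "J y (?D (g y) u) = u" "?D (g y) (J y u) = u" if "y \<in> V" for y u
    using bij[OF that] unfolding J_def by (simp_all add: bij_is_inj bij_is_surj surj_f_inv_f)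
  define x where "x = g y"
  have x: "x \<in> U" "f x = y" using fg[OF y] by (auto simp: x_def)
  define u where "u = J y v"
  define \<Phi>' where "\<Phi>' = (\<lambda>h::'a\<times>'a. (?D x (fst h), \<Sum>c\<in>Basis. (u \<bullet> c) *\<^sub>R ?H x c (fst h) + (snd h \<bullet> c) *\<^sub>R ?D x c))"
  \<comment> \<open>The inverse of the block triangular map \<open>\<Phi>'\<close>: the first
    component is solved by \<open>J y\<close>, then substituted into the second.\<close>
  define \<Psi>' where "\<Psi>' = (\<lambda>k::'a\<times>'a. (J y (fst k), J y (snd k - (\<Sum>c\<in>Basis. (u \<bullet> c) *\<^sub>R ?H x c (J y (fst k))))))"
  have "(\<Psi> has_derivative \<Psi>') (at (\<Phi> (x, u)))"
  proof (rule has_derivative_inverse_strong[where f' = \<Phi>' and f = \<Phi> and x = "(x, u)" and S = "U \<times> UNIV"])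
    show "open (U \<times> (UNIV :: 'a set))" "(x, u) \<in> U \<times> (UNIV :: 'a set)" using U x by (auto intro: open_Times)
    have cf: "continuous_on U f" and cD: "\<And>c. continuous_on U (\<lambda>x. ?D x c)"
      using smooth_on_continuous_on[OF f] smooth_on_continuous_on[OF smooth_on_frechet_derivative[OF f]] by auto
    show "continuous_on (U \<times> UNIV) \<Phi>"
      unfolding \<Phi>_def by (auto intro!: continuous_intros continuous_on_compose2[OF cf] continuous_on_compose2[OF cD])
    show "\<Psi> (\<Phi> p) = p" if "p \<in> U \<times> UNIV" for p
      using that gf[of "fst p"] inJ(1)[of "f (fst p)" "snd p"] \<Phi>[of p] by (auto simp: \<Psi>_def)
    show "(\<Phi> has_derivative \<Phi>') (at (x, u))"
    proof -
      have f1: "((\<lambda>p::'a\<times>'a. f (fst p)) has_derivative (\<lambda>h. ?D x (fst h))) (at (x, u))"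
        using has_derivative_compose[OF has_derivative_fst[OF has_derivative_ident], of f "?D x" "(x,u)" UNIV]
          smooth_on_has_derivative[OF f x(1)] by simp
      have f2: "((\<lambda>p::'a\<times>'a. ?D (fst p) c) has_derivative (\<lambda>h. ?H x c (fst h))) (at (x, u))" for c
        using has_derivative_compose[OF has_derivative_fst[OF has_derivative_ident], of "\<lambda>x. ?D x c" "?H x c" "(x,u)" UNIV]
          Dder[OF x(1), of c] by simp
      show ?thesis
        unfolding \<Phi>_def \<Phi>'_def by (auto intro!: derivative_eq_intros f1 f2 ext simp: add.commute)
    qed
    have "?D x (J y k) = k" for k using inJ(2)[OF y] by (simp add: x_def)
    then show "\<Phi>' \<circ> \<Psi>' = id"
      by (auto simp: \<Phi>'_def \<Psi>'_def fun_eq_iff sum.distrib bounded_linear_euclidean_expand[OF Dbl[OF x(1)], symmetric])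
  qed
  moreover have "\<Phi> (x, u) = (y, v)" using \<Phi>[of "(x,u)"] x inJ(2)[OF y] by (auto simp: u_def x_def)
  ultimately have "(\<Psi> has_derivative \<Psi>') (at (y, v))" by simp
  then have "((\<lambda>z. snd (\<Psi> z)) has_derivative (\<lambda>k. snd (\<Psi>' k))) (at (y, v))"
    by (rule has_derivative_snd)
  \<comment> \<open>Freezing the vector \<open>v\<close> and reading off the second component
    isolates the derivative of \<open>y \<mapsto> J y v\<close>.\<close>
  then have "((\<lambda>z. snd (\<Psi> (z, v))) has_derivative (\<lambda>k. snd (\<Psi>' (k, 0)))) (at y)"
    by (rule has_derivative_compose[rotated]) (auto intro!: derivative_eq_intros)
  moreover have "J y (0 - z) = - J y z" for z
  proof -
    have "linear (J y)"
      unfolding J_def using bij[OF y] Dbl[of "g y"] fg[OF y]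
      by (simp add: bij_is_inj bounded_linear.linear inj_linear_imp_inv_linear)
    then show ?thesis by (simp add: linear_neg)
  qed
  ultimately show ?thesis by (simp add: \<Psi>_def \<Psi>'_def u_def x_def)
qed

text \<open>Bootstrapping: the inverse \<open>g\<close> has derivative \<open>J y\<close>, the
  inverse of the derivative of \<open>f\<close> at \<open>g y\<close>. If \<open>J\<close> is of
  class \<open>k\<close> in every direction, then so is \<open>g\<close>, and the derivative of
  \<open>J\<close> is a polynomial in components of \<open>J\<close> and second partial derivatives
  of \<open>f\<close> at \<open>g y\<close>; hence \<open>J\<close> is of class
  \<open>k + 1\<close>.\<close>

lemma smooth_local_inverse:
  fixes f :: "'a::euclidean_space \<Rightarrow> 'a"
  assumes U: "open U" and f: "smooth_on U f" and x0: "x0 \<in> U" and bij: "bij (frechet_derivative f (at x0))"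
  obtains U' V g where "open U'" "U' \<subseteq> U" "x0 \<in> U'" "open V" "homeomorphism U' V f g" "smooth_on V g"
proof -
  let ?D = "\<lambda>x. frechet_derivative f (at x)"
  have Dbl: "bounded_linear (?D x)" if "x \<in> U" for x
    using has_derivative_bounded_linear[OF smooth_on_has_derivative[OF f that]] .
  note app = bounded_linear_Blinfun_apply[OF Dbl]
  have cont: "continuous_on U (\<lambda>x. Blinfun (?D x))"
  proof (rule continuous_on_blinfun_componentwise)
    fix i :: 'a
    show "continuous_on U (\<lambda>x. blinfun_apply (Blinfun (?D x)) i)"
      using smooth_on_continuous_on[OF smooth_on_frechet_derivative[OF f, of i]]
      by (rule continuous_on_eq) (simp add: app)
  qed
  have der: "(f has_derivative blinfun_apply (Blinfun (?D x))) (at x)" if "x \<in> U" for x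
    using smooth_on_has_derivative[OF f that] by (simp add: app[OF that])
  obtain U' V g g' where *: "open U'" "U' \<subseteq> U" "x0 \<in> U'" "open V" "f x0 \<in> V" and hom: "homeomorphism U' V f g"
    and g': "\<And>y. y \<in> V \<Longrightarrow> (g has_derivative (g' y)) (at y)"
    "\<And>y. y \<in> V \<Longrightarrow> g' y = inv (blinfun_apply (Blinfun (?D (g y))))"
    "\<And>y. y \<in> V \<Longrightarrow> bij (blinfun_apply (Blinfun (?D (g y))))"
    using inverse_function_theorem[OF U der cont x0 bij_blinfun_inverse[OF Dbl[OF x0] bij]] by blast
  have fg: "g y \<in> U' \<and> f (g y) = y" if "y \<in> V" for y
    using hom that by (auto simp: homeomorphism_def)
  have gf: "f x \<in> V \<and> g (f x) = x" if "x \<in> U'" for x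
    using hom that by (auto simp: homeomorphism_def)
  have bijg: "bij (?D (g y))" if "y \<in> V" for y
    using g'(3)[OF that] fg[OF that] *(2) app by (metis subsetD)
  define J where "J = (\<lambda>y. inv (?D (g y)))"
  have g'J: "g' y = J y" if "y \<in> V" for y
    using g'(2)[OF that] fg[OF that] *(2) app by (metis J_def subsetD)
  have gJ: "(g has_derivative J y) (at y)" if "y \<in> V" for y
    using g'(1)[OF that] g'J[OF that] by simp
  let ?M = "\<lambda>c d x. frechet_derivative (\<lambda>x. ?D x c) (at x) d"
  have f': "smooth_on U' f" using f *(2) by (rule smooth_on_subset)
  have Jbl: "bounded_linear (J y)" if "y \<in> V" for y
    using has_derivative_bounded_linear[OF g'(1)[OF that]] g'J[OF that] by simp
  have Hbl: "bounded_linear (frechet_derivative (\<lambda>x. ?D x c) (at x))" if "x \<in> U'" for x c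
    using has_derivative_bounded_linear[OF smooth_on_has_derivative[OF smooth_on_frechet_derivative[OF f'] that]] .
  \<comment> \<open>All vectors are expanded in \<open>Basis\<close>, so that only \<open>J\<close>
    and second derivatives in fixed directions occur, as the induction requires.\<close>
  have Jder: "((\<lambda>y. J y v) has_derivative
       (\<lambda>w. - (\<Sum>e\<in>Basis. ((\<Sum>c\<in>Basis. (J y v \<bullet> c) *\<^sub>R (\<Sum>d\<in>Basis. (J y w \<bullet> d) *\<^sub>R ?M c d (g y))) \<bullet> e) *\<^sub>R J y e))) (at y)"
    if y: "y \<in> V" for y v
  proof -
    have "J y (\<Sum>c\<in>Basis. (J y v \<bullet> c) *\<^sub>R frechet_derivative (\<lambda>x. ?D x c) (at (g y)) (J y w))
      = (\<Sum>e\<in>Basis. ((\<Sum>c\<in>Basis. (J y v \<bullet> c) *\<^sub>R (\<Sum>d\<in>Basis. (J y w \<bullet> d) *\<^sub>R ?M c d (g y))) \<bullet> e) *\<^sub>R J y e)" for w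
      unfolding bounded_linear_euclidean_expand[OF Hbl[OF conjunct1[OF fg[OF y]]], of _ "J y w"]
      by (rule bounded_linear_euclidean_expand[OF Jbl[OF y]])
    then show ?thesis
      using has_derivative_inverse_frechet[OF *(1) f' *(4) fg gf bijg y, of v] by (simp add: J_def)
  qed
  have J: "Ck_on k V (\<lambda>y. J y v)" for k v
  proof (induction k arbitrary: v)
    case 0
    show ?case using has_derivative_continuous[OF Jder] by (auto intro!: continuous_at_imp_continuous_on)
  next
    case (Suc k)
    have g: "Ck_on k V g"
      by (rule Ck_on_Suc_imp, rule Ck_on_SucI[OF *(4) gJ Suc])
    have M: "Ck_on k V (\<lambda>y. ?M c d (g y))" for c d
      by (rule Ck_on_compose[OF *(4) g smooth_on_Ck_on[OF smooth_on_frechet_derivative[OF smooth_on_frechet_derivative[OF f']]]])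
        (use fg in auto)
    have i: "Ck_on k V (\<lambda>y. h y \<bullet> e)" if "Ck_on k V h" for h and e :: 'a
      by (rule Ck_on_bounded_linear[OF *(4) bounded_linear_inner_left that])
    show ?case
      by (rule Ck_on_SucI[OF *(4) Jder], assumption)
        (intro Ck_on_minus Ck_on_sum Ck_on_scaleR finite_Basis *(4) Suc M i)
  qed
  have "Ck_on k V g" for k
    by (rule Ck_on_Suc_imp, rule Ck_on_SucI[OF *(4) gJ J])
  then show ?thesis using that[OF *(1-4) hom] by (simp add: smooth_on_def)
qed

section \<open>Smooth maps into a Lie group\<close>

context lie_group
begin

lemma chart_exists: obtains U \<phi> where "(U, \<phi>) \<in> \<A>" "x \<in> U"
proof -
  have "x \<in> (\<Union>(U, \<phi>)\<in>\<A>. U)" using atlas by (simp add: smooth_atlas_def)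
  then show ?thesis using that by auto
qed

lemma chart:
  assumes "(U, \<phi>) \<in> \<A>"
  shows "open U" "open (\<phi> ` U)" "homeomorphism U (\<phi> ` U) \<phi> (inv_into U \<phi>)"
proof -
  have "\<forall>(U, \<phi>)\<in>\<A>. open U \<and> open (\<phi> ` U) \<and> homeomorphism U (\<phi> ` U) \<phi> (inv_into U \<phi>)"
    using atlas by (simp add: smooth_atlas_def)
  from bspec[OF this assms] show "open U" "open (\<phi> ` U)" "homeomorphism U (\<phi> ` U) \<phi> (inv_into U \<phi>)"
    by auto
qed

lemma chart_transition:
  assumes "(U, \<phi>) \<in> \<A>" "(V, \<psi>) \<in> \<A>"
  shows "smooth_on (\<phi> ` (U \<inter> V)) (\<psi> \<circ> inv_into U \<phi>)"
proof -
  have "\<forall>(U, \<phi>)\<in>\<A>. \<forall>(V, \<psi>)\<in>\<A>. smooth_on (\<phi> ` (U \<inter> V)) (\<psi> \<circ> inv_into U \<phi>)"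
    using atlas by (simp add: smooth_atlas_def)
  from bspec[OF this assms(1)] assms(2) show ?thesis by auto
qed

lemma chart_inv_into: "(U, \<phi>) \<in> \<A> \<Longrightarrow> x \<in> U \<Longrightarrow> inv_into U \<phi> (\<phi> x) = x"
  using chart(3) by (metis homeomorphism_apply1)

text \<open>\<open>smooth_into\<close> relative to an open set \<open>S\<close>. Continuity is
  included because it makes the preimages of chart domains open.\<close>

definition smooth_map :: "'p::euclidean_space set \<Rightarrow> ('p \<Rightarrow> 'g) \<Rightarrow> bool" where
  "smooth_map S c \<longleftrightarrow> continuous_on S c \<and> (\<forall>(U, \<phi>)\<in>\<A>. smooth_on (S \<inter> c -` U) (\<lambda>p. \<phi> (c p)))"

definition smooth_from_on :: "'g set \<Rightarrow> ('g \<Rightarrow> 'b::real_normed_vector) \<Rightarrow> bool" where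
  "smooth_from_on W f \<longleftrightarrow> (\<forall>(U, \<phi>)\<in>\<A>. smooth_on (\<phi> ` (U \<inter> W)) (f \<circ> inv_into U \<phi>))"

lemma smooth_map_continuous_on: "smooth_map S c \<Longrightarrow> continuous_on S c"
  by (simp add: smooth_map_def)

lemma smooth_map_chart: "smooth_map S c \<Longrightarrow> (U, \<phi>) \<in> \<A> \<Longrightarrow> smooth_on (S \<inter> c -` U) (\<lambda>p. \<phi> (c p))"
  by (auto simp: smooth_map_def)

lemma smooth_map_subset: "smooth_map S c \<Longrightarrow> T \<subseteq> S \<Longrightarrow> smooth_map T c"
  by (auto simp: smooth_map_def intro: continuous_on_subset smooth_on_subset)

lemma open_preimage_continuous_on: "open S \<Longrightarrow> continuous_on S c \<Longrightarrow> open U \<Longrightarrow> open (S \<inter> c -` U)"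
  by (simp add: continuous_open_preimage)

lemma smooth_map_const: "open S \<Longrightarrow> smooth_map S (\<lambda>p. x)"
  unfolding smooth_map_def
proof safe
  fix U \<phi> assume S: "open S"
  have "open (S \<inter> (\<lambda>p. x) -` U)" using S by (cases "x \<in> U") auto
  then show "smooth_on (S \<inter> (\<lambda>p. x) -` U) (\<lambda>p. \<phi> x)" by (rule smooth_on_const)
qed auto

lemma smooth_map_add:
  assumes S: "open S" and c: "smooth_map S c" and d: "smooth_map S d"
  shows "smooth_map S (\<lambda>p. c p + d p)"
proof -
  note cc = smooth_map_continuous_on[OF c] and cd = smooth_map_continuous_on[OF d]
  have cont: "continuous_on S (\<lambda>p. c p + d p)" by (intro continuous_on_add cc cd)
  have "smooth_on (S \<inter> (\<lambda>p. c p + d p) -` W) (\<lambda>p. \<theta> (c p + d p))" if W: "(W, \<theta>) \<in> \<A>" for W \<theta>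
  proof (rule smooth_on_local)
    fix p assume p: "p \<in> S \<inter> (\<lambda>p. c p + d p) -` W"
    obtain U \<phi> where U: "(U, \<phi>) \<in> \<A>" "c p \<in> U" by (rule chart_exists)
    obtain V \<psi> where V: "(V, \<psi>) \<in> \<A>" "d p \<in> V" by (rule chart_exists)
    define T where "T = (S \<inter> c -` U) \<inter> (S \<inter> d -` V) \<inter> (S \<inter> (\<lambda>p. c p + d p) -` W)"
    have T: "open T"
      unfolding T_def
      by (intro open_Int open_preimage_continuous_on S cc cd cont chart(1)[OF U(1)] chart(1)[OF V(1)] chart(1)[OF W])
    have "smooth_on T (\<lambda>q. (\<phi> (c q), \<psi> (d q)))"
      by (intro smooth_on_Pair T smooth_on_subset[OF smooth_map_chart[OF c U(1)]]
          smooth_on_subset[OF smooth_map_chart[OF d V(1)]]) (auto simp: T_def)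
    from smooth_on_compose[OF T this smooth_mult[OF U(1) V(1) W]]
    have "smooth_on T (\<lambda>q. \<theta> (inv_into U \<phi> (\<phi> (c q)) + inv_into V \<psi> (\<psi> (d q))))"
      by (auto simp: T_def)
    then have "smooth_on T (\<lambda>q. \<theta> (c q + d q))"
      by (subst smooth_on_cong[OF T]) (auto simp: T_def chart_inv_into[OF U(1)] chart_inv_into[OF V(1)])
    then show "\<exists>T. open T \<and> p \<in> T \<and> smooth_on T (\<lambda>p. \<theta> (c p + d p))"
      using T p U V by (auto simp: T_def)
  qed
  then show ?thesis using cont by (auto simp: smooth_map_def)
qed

lemma smooth_map_compose:
  fixes f :: "'p::euclidean_space \<Rightarrow> 'q::euclidean_space"
  assumes S: "open S" and f: "smooth_on S f" and c: "smooth_map T c" and fST: "f ` S \<subseteq> T"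
  shows "smooth_map S (\<lambda>p. c (f p))"
proof -
  have cont: "continuous_on S (\<lambda>p. c (f p))"
    using continuous_on_compose2[OF smooth_map_continuous_on[OF c] smooth_on_continuous_on[OF f] fST] .
  have "smooth_on (S \<inter> (\<lambda>p. c (f p)) -` U) (\<lambda>p. \<phi> (c (f p)))" if U: "(U, \<phi>) \<in> \<A>" for U \<phi>
    by (rule smooth_on_compose[OF _ smooth_on_subset[OF f] smooth_map_chart[OF c U]])
      (use fST open_preimage_continuous_on[OF S cont chart(1)[OF U]] in auto)
  then show ?thesis using cont by (auto simp: smooth_map_def)
qed

lemma smooth_map_inv_chart:
  assumes U: "(U, \<phi>) \<in> \<A>"
  shows "smooth_map (\<phi> ` U) (inv_into U \<phi>)"
  unfolding smooth_map_def
proof safe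
  show "continuous_on (\<phi> ` U) (inv_into U \<phi>)" using chart(3)[OF U] by (simp add: homeomorphism_def)
  fix V \<psi> assume V: "(V, \<psi>) \<in> \<A>"
  have "\<phi> ` U \<inter> inv_into U \<phi> -` V = \<phi> ` (U \<inter> V)" using chart_inv_into[OF U] by force
  moreover have "smooth_on (\<phi> ` (U \<inter> V)) (\<psi> \<circ> inv_into U \<phi>)"
    by (rule chart_transition[OF U V])
  ultimately show "smooth_on (\<phi> ` U \<inter> inv_into U \<phi> -` V) (\<lambda>p. \<psi> (inv_into U \<phi> p))"
    by (simp add: o_def)
qed

lemma smooth_from_on_compose:
  fixes c :: "'p::euclidean_space \<Rightarrow> 'g"
  assumes W: "open W" and f: "smooth_from_on W f" and S: "open S" and c: "smooth_map S c" and cW: "c ` S \<subseteq> W"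
  shows "smooth_on S (\<lambda>p. f (c p))"
proof (rule smooth_on_local)
  fix p assume p: "p \<in> S"
  obtain U \<phi> where U: "(U, \<phi>) \<in> \<A>" "c p \<in> U" by (rule chart_exists)
  let ?T = "S \<inter> c -` U"
  have T: "open ?T" by (intro open_preimage_continuous_on S smooth_map_continuous_on[OF c] chart(1)[OF U(1)])
  have "smooth_on (\<phi> ` (U \<inter> W)) (f \<circ> inv_into U \<phi>)" using f U by (auto simp: smooth_from_on_def)
  from smooth_on_compose[OF T smooth_map_chart[OF c U(1)] this]
  have "smooth_on ?T (\<lambda>q. f (inv_into U \<phi> (\<phi> (c q))))" using cW by auto
  then have "smooth_on ?T (\<lambda>q. f (c q))"
    by (subst smooth_on_cong[OF T]) (auto simp: chart_inv_into[OF U(1)])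
  then show "\<exists>T. open T \<and> p \<in> T \<and> smooth_on T (\<lambda>p. f (c p))" using T p U by auto
qed

lemma smooth_from_eq: "smooth_from \<A> f \<longleftrightarrow> smooth_from_on UNIV f"
  by (simp add: smooth_from_def smooth_from_on_def)

lemma smooth_from_compose:
  fixes c :: "'p::euclidean_space \<Rightarrow> 'g"
  shows "smooth_from \<A> f \<Longrightarrow> open S \<Longrightarrow> smooth_map S c \<Longrightarrow> smooth_on S (\<lambda>p. f (c p))"
  using smooth_from_on_compose[of UNIV f S c] by (simp add: smooth_from_eq)

text \<open>Inverse charts are smooth maps into the group, so testing \<open>f\<close> against all
  smooth maps with parameters in \<open>'a\<close> covers all chart expressions.\<close>

lemma smooth_fromI:
  assumes "\<And>S (c :: 'a \<Rightarrow> 'g). open S \<Longrightarrow> smooth_map S c \<Longrightarrow> smooth_on S (\<lambda>p. f (c p))"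
  shows "smooth_from \<A> f"
  unfolding smooth_from_def using assms[OF chart(2) smooth_map_inv_chart] by (auto simp: o_def)

end

section \<open>The exponential chart\<close>

context lie_group_with_algebra
begin

lemma E_0: "E 0 = 0"
  using exp_one_parameter[of 0 0 0] by simp (metis add.right_neutral add_left_cancel)

lemma E_uminus: "E (- X) = - E X"
  using exp_one_parameter[of 1 "-1" X] E_0 by (metis add.right_inverse minus_unique scaleR_minus1_left scaleR_one scaleR_zero_left)

lemma smooth_map_E: "smooth_map UNIV E"
  using exp_smooth by (auto simp: smooth_into_def smooth_map_def o_def)

lemma continuous_on_E: "continuous_on S E"
  using continuous_on_subset[OF smooth_map_continuous_on[OF smooth_map_E]] by simp

text \<open>Read in a chart at the identity, \<open>E\<close> has an invertible derivative at
  \<open>0\<close>; its local inverse there, composed with the chart, is a logarithm. The domain is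
  shrunk to a ball so that its size is a single number \<open>e\<close>.\<close>

lemma exp_chart_exists:
  obtains e lg where "e > 0" "open (E ` ball 0 e)" "homeomorphism (ball 0 e) (E ` ball 0 e) E lg"
    "smooth_from_on (E ` ball 0 e) lg"
proof -
  obtain U \<phi> where U: "(U, \<phi>) \<in> \<A>" "0 \<in> U" by (rule chart_exists)
  define F where "F = (\<lambda>X. \<phi> (E X))"
  have EU: "open (E -` U)"
    using open_preimage_continuous_on[OF open_UNIV continuous_on_E chart(1)[OF U(1)]] by simp
  have F: "smooth_on (E -` U) F"
    using smooth_map_chart[OF smooth_map_E U(1)] by (simp add: F_def)
  have bij: "bij (frechet_derivative F (at 0))"
    using exp_derivative[OF U] by (simp add: F_def o_def)
  obtain U' V g where *: "open U'" "U' \<subseteq> E -` U" "0 \<in> U'" "open V" "homeomorphism U' V F g" "smooth_on V g"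
    by (rule smooth_local_inverse[OF EU F _ bij]) (use U E_0 in auto)
  obtain e where e: "e > 0" "ball 0 e \<subseteq> U'" using * by (meson openE)
  let ?B = "ball 0 e :: 'a set"
  define W where "W = E ` ?B"
  define lg where "lg = (\<lambda>x. g (\<phi> x))"
  have WU: "W \<subseteq> U" using e * by (auto simp: W_def)
  have FB: "F ` ?B = V \<inter> g -` ?B" using *(5) e(2) unfolding homeomorphism_def by force
  have oFB: "open (F ` ?B)"
    unfolding FB using *(4,5) by (intro open_preimage_continuous_on) (auto simp: homeomorphism_def)
  have inj: "inj_on \<phi> U" using chart_inv_into[OF U(1)] by (metis inj_onI)
  have "W = U \<inter> \<phi> -` (F ` ?B)"
    using WU inj unfolding W_def F_def by (auto simp: inj_on_def image_iff)
  moreover have "continuous_on U \<phi>" using chart(3)[OF U(1)] by (simp add: homeomorphism_def)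
  ultimately have oW: "open W" using open_preimage_continuous_on[OF chart(1)[OF U(1)] _ oFB] by simp
  have lgE: "lg (E X) = X" if "X \<in> ?B" for X
    using *(5) that e(2) by (auto simp: lg_def F_def homeomorphism_def)
  have \<phi>W: "\<phi> ` W \<subseteq> V" using FB by (auto simp: W_def F_def)
  have "continuous_on W lg"
    unfolding lg_def
    by (rule continuous_on_compose2[of V g, OF _ _ \<phi>W])
      (use *(5) \<open>continuous_on U \<phi>\<close> WU in \<open>auto simp: homeomorphism_def intro: continuous_on_subset\<close>)
  moreover have "lg ` W = ?B" using lgE by (force simp: W_def image_image)
  ultimately have hom: "homeomorphism ?B W E lg"
    using lgE continuous_on_E by (auto simp: homeomorphism_def W_def)
  have "smooth_from_on W lg"
    unfolding smooth_from_on_def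
  proof safe
    fix U2 \<phi>2 assume U2: "(U2, \<phi>2) \<in> \<A>"
    note m = smooth_map_inv_chart[OF U2]
    have W2: "\<phi>2 ` (U2 \<inter> W) = \<phi>2 ` U2 \<inter> inv_into U2 \<phi>2 -` W"
      using chart_inv_into[OF U2] by force
    have o: "open (\<phi>2 ` (U2 \<inter> W))"
      unfolding W2 by (intro open_preimage_continuous_on chart(2)[OF U2] smooth_map_continuous_on[OF m] oW)
    have "smooth_on (\<phi>2 ` (U2 \<inter> W)) (\<lambda>p. g (\<phi> (inv_into U2 \<phi>2 p)))"
      by (rule smooth_on_compose[OF o smooth_on_subset[OF smooth_map_chart[OF m U(1)]] *(6)])
        (use WU W2 \<phi>W in auto)
    then show "smooth_on (\<phi>2 ` (U2 \<inter> W)) (lg \<circ> inv_into U2 \<phi>2)"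
      by (simp add: lg_def o_def)
  qed
  then show ?thesis using that[of e lg] e oW hom by (simp add: W_def)
qed

end

text \<open>One logarithm near the identity is fixed here. It is discarded again once
  \<open>E\<close> is known to be bijective with smooth inverse.\<close>

locale exp_chart = lie_group_with_algebra \<A> E bracket
  for \<A> :: "('g::{topological_group_add, t2_space, second_countable_topology},
              'a::euclidean_space) chart set"
    and E :: "'a \<Rightarrow> 'g"
    and bracket :: "'a \<Rightarrow> 'a \<Rightarrow> 'a" +
  fixes e :: real and lg :: "'g \<Rightarrow> 'a"
  assumes e_pos: "e > 0"
    and open_W: "open (E ` ball 0 e)"
    and lg_homeo: "homeomorphism (ball 0 e) (E ` ball 0 e) E lg"
    and lg_smooth: "smooth_from_on (E ` ball 0 e) lg"
begin

abbreviation "W \<equiv> E ` ball 0 e"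

lemma lg_E: "norm X < e \<Longrightarrow> lg (E X) = X"
  using lg_homeo by (auto simp: homeomorphism_def)

lemma E_lg: "x \<in> W \<Longrightarrow> E (lg x) = x"
  using lg_homeo by (auto simp: homeomorphism_def)

lemma zero_in_W: "0 \<in> W"
  using e_pos E_0 by (metis centre_in_ball imageI)

lemma lg_0: "lg 0 = 0"
  using lg_E[of 0] e_pos E_0 by simp

lemma smooth_lg:
  fixes c :: "'p::euclidean_space \<Rightarrow> 'g"
  assumes "open S" "smooth_map S c"
  shows "open (S \<inter> c -` W)" "smooth_on (S \<inter> c -` W) (\<lambda>p. lg (c p))"
proof -
  show o: "open (S \<inter> c -` W)"
    by (intro open_preimage_continuous_on assms smooth_map_continuous_on open_W)
  show "smooth_on (S \<inter> c -` W) (\<lambda>p. lg (c p))"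
    by (rule smooth_from_on_compose[OF open_W lg_smooth o smooth_map_subset[OF assms(2)]]) auto
qed

lemma smooth_map_E_compose:
  fixes f :: "'p::euclidean_space \<Rightarrow> 'a"
  shows "open S \<Longrightarrow> smooth_on S f \<Longrightarrow> smooth_map S (\<lambda>p. E (f p))"
  using smooth_map_compose[OF _ _ smooth_map_E] by blast

lemma smooth_map_E_linear:
  fixes f :: "'p::euclidean_space \<Rightarrow> 'a"
  shows "open S \<Longrightarrow> bounded_linear f \<Longrightarrow> smooth_map S (\<lambda>p. E (f p))"
  by (intro smooth_map_E_compose smooth_on_linear)

subsection \<open>Left logarithmic derivatives\<close>

text \<open>The differential of \<open>c\<close> at \<open>p\<close>, carried to the Lie algebra by
  left translation (the pullback of the Maurer-Cartan form). Continuity keeps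
  \<open>- c p + c q\<close> inside \<open>W\<close> for \<open>q\<close> near \<open>p\<close>, so
  the values of \<open>lg\<close> outside \<open>W\<close> do not matter.\<close>

definition left_deriv :: "('p::euclidean_space \<Rightarrow> 'g) \<Rightarrow> 'p \<Rightarrow> ('p \<Rightarrow> 'a) \<Rightarrow> bool" where
  "left_deriv c p D \<longleftrightarrow> isCont c p \<and> ((\<lambda>q. lg (- c p + c q)) has_derivative D) (at p)"

text \<open>The adjoint representation: the differential at the identity of conjugation by
  \<open>y\<close>.\<close>

definition Ad :: "'g \<Rightarrow> 'a \<Rightarrow> 'a" where
  "Ad y = frechet_derivative (\<lambda>Z. lg (y + E Z + - y)) (at 0)"

lemma smooth_map_translate: "open S \<Longrightarrow> smooth_map S c \<Longrightarrow> smooth_map S (\<lambda>q. x + c q)"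
  by (intro smooth_map_add smooth_map_const)

lemma has_derivative_lg:
  fixes c :: "'p::euclidean_space \<Rightarrow> 'g"
  assumes "open S" "smooth_map S c" "p \<in> S" "c p \<in> W"
  shows "((\<lambda>q. lg (c q)) has_derivative frechet_derivative (\<lambda>q. lg (c q)) (at p)) (at p)"
  by (rule smooth_on_has_derivative[OF smooth_lg(2)[OF assms(1,2)]]) (use assms in auto)

lemma left_deriv_exists:
  fixes c :: "'p::euclidean_space \<Rightarrow> 'g"
  assumes "open S" "smooth_map S c" "p \<in> S"
  shows "left_deriv c p (frechet_derivative (\<lambda>q. lg (- c p + c q)) (at p))"
  unfolding left_deriv_def
  using has_derivative_lg[OF assms(1) smooth_map_translate[OF assms(1,2)] assms(3), of "- c p"] zero_in_W
    smooth_map_continuous_on[OF assms(2)] assms(1,3)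
  by (auto simp: continuous_on_eq_continuous_at)

lemma left_deriv_unique: "left_deriv c p D \<Longrightarrow> left_deriv c p D' \<Longrightarrow> D = D'"
  unfolding left_deriv_def by (blast intro: has_derivative_unique)

lemma left_deriv_linear: "left_deriv c p D \<Longrightarrow> bounded_linear D"
  unfolding left_deriv_def by (blast intro: has_derivative_bounded_linear)

lemma left_deriv_compose:
  fixes f :: "'p::euclidean_space \<Rightarrow> 'q::euclidean_space"
  assumes "left_deriv c (f q) D" "(f has_derivative f') (at q)"
  shows "left_deriv (\<lambda>q. c (f q)) q (\<lambda>v. D (f' v))"
  using assms has_derivative_compose[OF assms(2), of "\<lambda>p. lg (- c (f q) + c p)" D]
    isCont_o2[OF has_derivative_continuous[OF assms(2)]]
  by (auto simp: left_deriv_def)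

lemma eventually_W:
  assumes "isCont c p"
  shows "eventually (\<lambda>q. - c p + c q \<in> W) (at p)"
proof -
  have "isCont (\<lambda>q. - c p + c q) p" by (intro continuous_intros assms)
  then show ?thesis
    using open_W zero_in_W unfolding isCont_def by (auto dest!: topological_tendstoD)
qed

lemma Ad_has_derivative: "((\<lambda>Z. lg (y + E Z + - y)) has_derivative Ad y) (at 0)"
proof -
  have "smooth_map UNIV (\<lambda>Z. y + E Z + - y)"
    by (intro smooth_map_add smooth_map_const smooth_map_E open_UNIV)
  then show ?thesis
    unfolding Ad_def by (rule has_derivative_lg[OF open_UNIV]) (use E_0 zero_in_W in auto)
qed

lemma Ad_linear: "bounded_linear (Ad y)"
  using has_derivative_bounded_linear[OF Ad_has_derivative] .

lemma has_derivative_lg_E: "((\<lambda>Z. lg (E Z)) has_derivative (\<lambda>v. v)) (at 0)"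
  by (rule has_derivative_transform_within_open[OF has_derivative_ident open_ball, of _ 0 e])
    (use e_pos lg_E in auto)

text \<open>The product rule. Since \<open>- (c p + d p) + (c q + d q)\<close> equals
  \<open>- d p + (- c p + c q) + d p + (- d p + d q)\<close>, its logarithm is a smooth function
  \<open>K\<close> of the logarithms of the two increments. The partial derivatives of
  \<open>K\<close> at the origin are \<open>Ad (- d p)\<close> and the identity.\<close>

lemma left_deriv_add:
  fixes c d :: "'p::euclidean_space \<Rightarrow> 'g"
  assumes c: "left_deriv c p C" and d: "left_deriv d p D"
  shows "left_deriv (\<lambda>q. c q + d q) p (\<lambda>v. Ad (- d p) (C v) + D v)"
proof -
  define y where "y = - d p"
  define a where "a = (\<lambda>q. lg (- c p + c q))"
  define b where "b = (\<lambda>q. lg (- d p + d q))"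
  define K where "K = (\<lambda>z. lg (y + E (fst z) + - y + E (snd z)))"
  have a: "(a has_derivative C) (at p)" and b: "(b has_derivative D) (at p)"
    and cont: "isCont c p" "isCont d p" and a0: "a p = 0" and b0: "b p = 0"
    using c d lg_0 by (auto simp: left_deriv_def a_def b_def)
  have sm: "smooth_map UNIV (\<lambda>z::'a\<times>'a. y + E (fst z) + - y + E (snd z))"
    by (intro smooth_map_add smooth_map_const smooth_map_E_linear bounded_linear_fst bounded_linear_snd open_UNIV)
  have "((\<lambda>z. lg (y + E (fst z) + - y + E (snd z))) has_derivative
      frechet_derivative (\<lambda>z. lg (y + E (fst z) + - y + E (snd z))) (at (0, 0))) (at (0, 0))"
    by (rule has_derivative_lg[OF open_UNIV sm]) (use E_0 zero_in_W in auto)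
  then obtain DK where DK: "(K has_derivative DK) (at (0, 0))"
    unfolding K_def by blast
  interpret DK: bounded_linear DK using DK by (rule has_derivative_bounded_linear)
  have "((\<lambda>Z. K (Z, 0)) has_derivative (\<lambda>v. DK (v, 0))) (at 0)"
    by (rule has_derivative_compose[where g = K and g' = DK and f = "\<lambda>Z. (Z, 0)" and f' = "\<lambda>v. (v, 0)"])
      (auto intro!: derivative_eq_intros DK)
  moreover have "(\<lambda>Z. K (Z, 0)) = (\<lambda>Z. lg (y + E Z + - y))" by (simp add: K_def E_0)
  ultimately have 1: "DK (v, 0) = Ad y v" for v
    using has_derivative_unique[OF _ Ad_has_derivative] by metis
  have "((\<lambda>Z. K (0, Z)) has_derivative (\<lambda>v. DK (0, v))) (at 0)"
    by (rule has_derivative_compose[where g = K and g' = DK and f = "\<lambda>Z. (0, Z)" and f' = "\<lambda>v. (0, v)"])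
      (auto intro!: derivative_eq_intros DK)
  moreover have "(\<lambda>Z. K (0, Z)) = (\<lambda>Z. lg (E Z))" by (simp add: K_def E_0)
  ultimately have 2: "DK (0, v) = v" for v
    using has_derivative_unique[OF _ has_derivative_lg_E] by metis
  have DKuv: "DK (u, v) = Ad y u + v" for u v
    using DK.add[of "(u, 0)" "(0, v)"] 1 2 by simp
  have "((\<lambda>q. K (a q, b q)) has_derivative (\<lambda>v. DK (C v, D v))) (at p)"
    by (rule has_derivative_compose[OF has_derivative_Pair[OF a b]]) (simp add: a0 b0 DK)
  moreover have "eventually (\<lambda>q. K (a q, b q) = lg (- (c p + d p) + (c q + d q))) (at p)"
    using eventually_W[OF cont(1)] eventually_W[OF cont(2)]
  proof eventually_elim
    case (elim q)
    then have "E (a q) = - c p + c q" "E (b q) = - d p + d q"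
      using E_lg by (auto simp: a_def b_def)
    then show ?case
      by (simp add: K_def y_def minus_add add.assoc del: add_uminus_conv_diff)
  qed
  moreover have "K (a p, b p) = lg (- (c p + d p) + (c p + d p))"
    by (simp add: a0 b0 K_def E_0)
  ultimately have "((\<lambda>q. lg (- (c p + d p) + (c q + d q))) has_derivative (\<lambda>v. DK (C v, D v))) (at p)"
    by (rule has_derivative_transform_eventually) auto
  moreover have "isCont (\<lambda>q. c q + d q) p" using cont by (intro continuous_intros)
  ultimately show ?thesis by (simp add: left_deriv_def DKuv y_def)
qed

lemma E_diff: "- E (t *\<^sub>R Y) + E (s *\<^sub>R Y) = E ((s - t) *\<^sub>R Y)"
  using exp_one_parameter[of "-t" s Y] E_uminus[of "t *\<^sub>R Y"] by simp

lemma isCont_E: "isCont E X"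
  using continuous_on_E[of UNIV] by (simp add: continuous_on_eq_continuous_at)

lemma left_deriv_one_parameter: "left_deriv (\<lambda>t. x + E (t *\<^sub>R Y)) t (\<lambda>h. h *\<^sub>R Y)"
proof -
  have "((\<lambda>s. lg (E ((s - t) *\<^sub>R Y))) has_derivative (\<lambda>h. h *\<^sub>R Y)) (at t)"
    by (rule has_derivative_compose[of _ _ _ _ "\<lambda>Z. lg (E Z)" "\<lambda>v. v", simplified])
      (auto intro!: derivative_eq_intros has_derivative_lg_E)
  moreover have "isCont (\<lambda>t. x + E (t *\<^sub>R Y)) t"
    by (intro continuous_intros isCont_o2[OF _ isCont_E])
  ultimately show ?thesis
    unfolding left_deriv_def by (simp add: minus_add add.assoc[symmetric] E_diff)
qed

text \<open>Near a point \<open>a\<close> the logarithm of \<open>- c a + c q\<close> has derivative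
  \<open>0\<close> in the ordinary sense, hence is constant on a ball; connectedness extends this to
  \<open>S\<close>.\<close>

lemma left_deriv_0_constant:
  fixes c :: "'p::euclidean_space \<Rightarrow> 'g"
  assumes S: "open S" "connected S" and c: "\<And>t. t \<in> S \<Longrightarrow> left_deriv c t (\<lambda>_. 0)"
  shows "c constant_on S"
proof (rule locally_constant_imp_constant[OF S(2)])
  fix a assume a: "a \<in> S"
  have cont: "continuous_on S c"
    using c by (auto simp: left_deriv_def intro: continuous_at_imp_continuous_on)
  have "open (S \<inter> (\<lambda>q. - c a + c q) -` W)"
    by (intro open_preimage_continuous_on S open_W continuous_intros cont)
  then obtain r where r: "r > 0" "ball a r \<subseteq> S \<inter> (\<lambda>q. - c a + c q) -` W"
    using a zero_in_W openE[of "S \<inter> (\<lambda>q. - c a + c q) -` W" a] by auto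
  have d: "((\<lambda>q. lg (- c a + c q)) has_derivative (\<lambda>_. 0)) (at q)" if q: "q \<in> ball a r" for q
  proof -
    \<comment> \<open>\<open>R\<close> moves the base point: it turns the logarithm of the increment
      from \<open>q\<close> into the logarithm of the increment from \<open>a\<close>, and is
      differentiable at \<open>0\<close>.\<close>
    define R where "R = (\<lambda>Z. lg (- c a + c q + E Z))"
    have "(R has_derivative frechet_derivative R (at 0)) (at 0)"
      unfolding R_def
      by (rule has_derivative_lg[OF open_UNIV]) (use q r in \<open>auto simp: E_0 intro!: smooth_map_add smooth_map_const smooth_map_E\<close>)
    then obtain DR where DR: "(R has_derivative DR) (at 0)" by blast
    have "((\<lambda>q'. lg (- c q + c q')) has_derivative (\<lambda>_. 0)) (at q)" and cq: "isCont c q"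
      using c[of q] q r by (auto simp: left_deriv_def)
    from has_derivative_compose[OF this(1), of R DR]
    have "((\<lambda>q'. R (lg (- c q + c q'))) has_derivative (\<lambda>_. 0)) (at q)"
      using DR linear_0[OF bounded_linear.linear[OF has_derivative_bounded_linear[OF DR]]] by (simp add: lg_0)
    moreover have "eventually (\<lambda>q'. R (lg (- c q + c q')) = lg (- c a + c q')) (at q)"
      using eventually_W[OF cq]
    proof eventually_elim
      case (elim q')
      have "- c a + c q + (- c q + c q') = - c a + c q'" by (metis add.assoc add_minus_cancel)
      then show ?case using elim by (simp add: R_def E_lg)
    qed
    ultimately show ?thesis
      by (rule has_derivative_transform_eventually) (simp_all add: R_def lg_0 E_0)
  qed
  have "c x = c a" if x: "x \<in> ball a r" for x
  proof -
    have "lg (- c a + c x) = lg (- c a + c a)"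
      by (rule has_derivative_zero_unique_connected[OF open_ball connected_ball, where f = "\<lambda>q. lg (- c a + c q)"])
        (use d x r in auto)
    then have "- c a + c x = 0"
      using E_lg[of "- c a + c x"] x r E_0 by (auto simp: lg_0)
    then show ?thesis by (metis add.right_neutral add_minus_cancel)
  qed
  moreover have "openin (top_of_set S) (ball a r)"
    by (rule open_subset) (use r(2) in auto)
  ultimately show "\<exists>T. openin (top_of_set S) T \<and> a \<in> T \<and> (\<forall>x\<in>T. c x = c a)"
    using r(1) centre_in_ball by blast
qed

end

section \<open>The bracket and the differential of the exponential map\<close>

lemma has_derivative_compose_at:
  assumes "(f has_derivative f') (at x)" "f x = y" "(g has_derivative g') (at y)"
  shows "((\<lambda>x. g (f x)) has_derivative (\<lambda>v. g' (f' v))) (at x)"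
  using has_derivative_compose[of f f' x UNIV g g'] assms by simp

text \<open>The factor \<open>h\<close> upgrades continuity of \<open>w\<close> at \<open>0\<close>
  to differentiability; this is applied to \<open>dexp (h X) (h Y)\<close>, where only continuity of
  \<open>dexp\<close> is at hand.\<close>

lemma has_vector_derivative_scaleR_isCont:
  fixes w :: "real \<Rightarrow> 'a::real_normed_vector"
  assumes "isCont w 0"
  shows "((\<lambda>h. h *\<^sub>R w h) has_vector_derivative w 0) (at 0)"
  unfolding has_vector_derivative_def has_derivative_iff_norm
proof
  have "((\<lambda>h. norm (w h - w 0)) \<longlongrightarrow> 0) (at 0)"
    using assms by (simp add: isCont_def LIM_zero_iff tendsto_norm_zero_iff)
  then show "((\<lambda>h. norm (h *\<^sub>R w h - 0 *\<^sub>R w 0 - (h - 0) *\<^sub>R w 0) / norm (h - 0)) \<longlongrightarrow> 0) (at 0)"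
    by (rule Lim_transform_eventually) (auto simp: eventually_at_filter scaleR_diff_right[symmetric])
qed (rule bounded_linear_scaleR_left)

lemma deriv_along_line:
  fixes f :: "'a::euclidean_space \<Rightarrow> real"
  assumes "smooth_on UNIV f"
  shows "((\<lambda>h. f (p + h *\<^sub>R v)) has_real_derivative frechet_derivative f (at p) v) (at 0)"
proof -
  have f: "(f has_derivative frechet_derivative f (at p)) (at p)"
    using smooth_on_has_derivative[OF assms, of p] by simp
  have "((\<lambda>h. f (p + h *\<^sub>R v)) has_derivative (\<lambda>h. frechet_derivative f (at p) (h *\<^sub>R v))) (at 0)"
    by (rule has_derivative_compose_at[OF _ _ f]) (auto intro!: derivative_eq_intros)
  moreover have "linear (frechet_derivative f (at p))"
    using f by (simp add: has_derivative_linear)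
  ultimately show ?thesis
    by (intro has_derivative_imp_has_field_derivative) (auto simp: linear_scale)
qed

text \<open>The mean value theorem is applied twice to the second difference, along \<open>v\<close>
  and then along \<open>w\<close>; the intermediate point stays within distance of order
  \<open>h\<close>.\<close>

lemma mixed_difference_quotient:
  fixes f :: "'a::euclidean_space \<Rightarrow> real"
  assumes f: "smooth_on UNIV f" and h: "h > 0"
  shows "\<exists>p. dist p x \<le> h * (norm v + norm w) \<and>
    f (x + h *\<^sub>R v + h *\<^sub>R w) - f (x + h *\<^sub>R v) - f (x + h *\<^sub>R w) + f x
      = h * h * frechet_derivative (\<lambda>p. frechet_derivative f (at p) v) (at p) w"
proof -
  have d: "((\<lambda>s. g (y + s *\<^sub>R u)) has_real_derivative frechet_derivative g (at (y + s *\<^sub>R u)) u) (at s)"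
    if "smooth_on UNIV g" for g :: "'a \<Rightarrow> real" and y u s
    using deriv_along_line[OF that, of "y + s *\<^sub>R u" u]
      DERIV_shift[of "\<lambda>s. g (y + s *\<^sub>R u)" _ 0 s] by (simp add: algebra_simps)
  let ?k = "\<lambda>s. f (x + h *\<^sub>R w + s *\<^sub>R v) - f (x + s *\<^sub>R v)"
  obtain a where a: "0 < a" "a < h" "?k h - ?k 0 = (h - 0) *
      (frechet_derivative f (at (x + h *\<^sub>R w + a *\<^sub>R v)) v - frechet_derivative f (at (x + a *\<^sub>R v)) v)"
    using MVT2[OF h, of ?k "\<lambda>s. frechet_derivative f (at (x + h *\<^sub>R w + s *\<^sub>R v)) v
      - frechet_derivative f (at (x + s *\<^sub>R v)) v"] DERIV_diff[OF d[OF f] d[OF f]] by blast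
  let ?g = "\<lambda>p. frechet_derivative f (at p) v"
  obtain b where b: "0 < b" "b < h" "?g (x + a *\<^sub>R v + h *\<^sub>R w) - ?g (x + a *\<^sub>R v + 0 *\<^sub>R w)
      = (h - 0) * frechet_derivative ?g (at (x + a *\<^sub>R v + b *\<^sub>R w)) w"
    using MVT2[OF h, of "\<lambda>s. ?g (x + a *\<^sub>R v + s *\<^sub>R w)" "\<lambda>s. frechet_derivative ?g (at (x + a *\<^sub>R v + s *\<^sub>R w)) w"]
      d[OF smooth_on_frechet_derivative[OF f, of v], of "x + a *\<^sub>R v" w] by blast
  have "dist (x + a *\<^sub>R v + b *\<^sub>R w) x \<le> a * norm v + b * norm w"
    using norm_triangle_ineq[of "a *\<^sub>R v" "b *\<^sub>R w"] a b by (simp add: dist_norm add.assoc)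
  also have "\<dots> \<le> h * (norm v + norm w)"
    unfolding distrib_left using a b by (intro add_mono mult_right_mono) auto
  finally show ?thesis
    using a(3) b(3) by (intro exI[of _ "x + a *\<^sub>R v + b *\<^sub>R w"]) (simp add: algebra_simps)
qed

text \<open>Schwarz's theorem: the second difference is symmetric in \<open>v\<close> and
  \<open>w\<close>, so both mixed derivatives take a common value at points arbitrarily close to
  \<open>x\<close>, and they are continuous there.\<close>

lemma mixed_derivative_symmetric:
  fixes f :: "'a::euclidean_space \<Rightarrow> real"
  assumes f: "smooth_on UNIV f"
  shows "frechet_derivative (\<lambda>p. frechet_derivative f (at p) v) (at x) w
       = frechet_derivative (\<lambda>p. frechet_derivative f (at p) w) (at x) v" (is "?a x = ?b x")
proof (rule ccontr)
  assume ne: "?a x \<noteq> ?b x"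
  define \<epsilon> where "\<epsilon> = \<bar>?a x - ?b x\<bar> / 2"
  have e: "\<epsilon> > 0" using ne by (simp add: \<epsilon>_def)
  have "isCont ?a x" "isCont ?b x"
    using smooth_on_continuous_on[OF smooth_on_frechet_derivative[OF smooth_on_frechet_derivative[OF f]]]
    by (auto simp: continuous_on_eq_continuous_at)
  then obtain d1 d2 where d1: "d1 > 0" "\<And>p. dist p x < d1 \<Longrightarrow> dist (?a p) (?a x) < \<epsilon>"
    and d2: "d2 > 0" "\<And>p. dist p x < d2 \<Longrightarrow> dist (?b p) (?b x) < \<epsilon>"
    using e unfolding continuous_at_eps_delta by metis
  \<comment> \<open>Small enough for both intermediate points to fall within
    \<open>min d1 d2\<close> of \<open>x\<close>; the summand \<open>1\<close> covers the case
    \<open>v = w = 0\<close>.\<close>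
  define h where "h = min d1 d2 / (2 * (norm v + norm w + 1))"
  have nn: "norm v + norm w + 1 > 0" by (simp add: add_nonneg_pos)
  then have h: "h > 0" using d1 d2 by (simp add: h_def)
  have "h * (norm v + norm w) < h * (2 * (norm v + norm w + 1))"
    using h nn by (intro mult_strict_left_mono) auto
  also have "\<dots> = min d1 d2" using nn by (simp add: h_def)
  finally have small: "h * (norm v + norm w) < d1" "h * (norm w + norm v) < d2" by (simp_all add: add.commute)
  obtain p where p: "dist p x \<le> h * (norm v + norm w)"
    "f (x + h *\<^sub>R v + h *\<^sub>R w) - f (x + h *\<^sub>R v) - f (x + h *\<^sub>R w) + f x = h * h * ?a p"
    using mixed_difference_quotient[OF f h] by blast
  obtain q where q: "dist q x \<le> h * (norm w + norm v)"
    "f (x + h *\<^sub>R w + h *\<^sub>R v) - f (x + h *\<^sub>R w) - f (x + h *\<^sub>R v) + f x = h * h * ?b q"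
    using mixed_difference_quotient[OF f h] by blast
  have eq: "x + h *\<^sub>R w + h *\<^sub>R v = x + h *\<^sub>R v + h *\<^sub>R w" by simp
  have "h * h * ?a p = h * h * ?b q" using p(2) q(2) unfolding eq by linarith
  then have "?a p = ?b q" using h by simp
  moreover have "\<bar>?a p - ?a x\<bar> < \<epsilon>" "\<bar>?b q - ?b x\<bar> < \<epsilon>"
    using d1(2)[of p] d2(2)[of q] p(1) q(1) small by (simp_all add: dist_real_def)
  ultimately show False unfolding \<epsilon>_def by (simp add: abs_if field_simps split: if_splits)
qed

text \<open>Gronwall's argument: with \<open>K\<close> a bound of \<open>B\<close>, the function
  \<open>(D s \<bullet> D s) * exp (- 2 * K * s)\<close> is nonincreasing, nonnegative and zero at
  \<open>0\<close>.\<close>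

lemma linear_ode_zero:
  fixes D :: "real \<Rightarrow> 'a::euclidean_space"
  assumes B: "bounded_linear B" and D: "\<And>s. (D has_vector_derivative - B (D s)) (at s)" and D0: "D 0 = 0"
    and s: "s \<ge> 0"
  shows "D s = 0"
proof -
  obtain K where K: "\<And>x. norm (B x) \<le> norm x * K" using bounded_linear.bounded[OF B] by blast
  define g where "g = (\<lambda>s. (D s \<bullet> D s) * exp (- 2 * K * s))"
  have "(g has_real_derivative (2 * (D s \<bullet> - B (D s)) - 2 * K * (D s \<bullet> D s)) * exp (- 2 * K * s)) (at s)" for s
  proof -
    note Ds = D[of s, unfolded has_vector_derivative_def]
    have "((\<lambda>s. D s \<bullet> D s) has_derivative (\<lambda>h. D s \<bullet> (h *\<^sub>R - B (D s)) + (h *\<^sub>R - B (D s)) \<bullet> D s)) (at s)"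
      by (rule has_derivative_inner[OF Ds Ds])
    then have "((\<lambda>s. D s \<bullet> D s) has_real_derivative 2 * (D s \<bullet> - B (D s))) (at s)"
      by (rule has_derivative_imp_has_field_derivative) (simp add: inner_commute algebra_simps)
    moreover have "((\<lambda>s. exp (- 2 * K * s)) has_real_derivative - 2 * K * exp (- 2 * K * s)) (at s)"
      by (auto intro!: derivative_eq_intros)
    ultimately show ?thesis
      unfolding g_def by (rule DERIV_cong[OF DERIV_mult]) (simp add: algebra_simps)
  qed
  moreover have "(2 * (D s \<bullet> - B (D s)) - 2 * K * (D s \<bullet> D s)) * exp (- 2 * K * s) \<le> 0" for s
  proof -
    have "\<bar>D s \<bullet> - B (D s)\<bar> \<le> norm (D s) * (norm (D s) * K)"
      using Cauchy_Schwarz_ineq2[of "D s" "- B (D s)"] mult_left_mono[OF K[of "D s"] norm_ge_zero[of "D s"]] by simp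
    moreover have "norm (D s) * (norm (D s) * K) = K * (D s \<bullet> D s)"
      by (simp add: power2_norm_eq_inner[symmetric] power2_eq_square)
    ultimately have "2 * (D s \<bullet> - B (D s)) - 2 * K * (D s \<bullet> D s) \<le> 0"
      by linarith
    then show ?thesis by (simp add: mult_nonpos_nonneg)
  qed
  ultimately have "g s \<le> g 0"
    by (intro DERIV_nonpos_imp_nonincreasing[OF s]) blast
  moreover have "g s > 0" if "D s \<noteq> 0" using that by (simp add: g_def)
  moreover have "g 0 = 0" using D0 by (simp add: g_def)
  ultimately show ?thesis by linarith
qed

section \<open>The bracket as the derivative of the adjoint representation\<close>

context exp_chart
begin

lemma left_deriv_cong:
  assumes "open T" "p \<in> T" "\<And>q. q \<in> T \<Longrightarrow> c q = d q" "left_deriv c p D"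
  shows "left_deriv d p D"
  unfolding left_deriv_def
proof
  show "isCont d p"
  proof -
    have "eventually (\<lambda>q. c q = d q) (nhds p)" using assms by (auto simp: eventually_nhds)
    then show ?thesis using assms(4) isCont_cong by (auto simp: left_deriv_def)
  qed
  show "((\<lambda>q. lg (- d p + d q)) has_derivative D) (at p)"
    by (rule has_derivative_transform_within_open[OF _ assms(1,2), of "\<lambda>q. lg (- c p + c q)"])
      (use assms in \<open>auto simp: left_deriv_def\<close>)
qed

text \<open>For \<open>G (a, b, c) = f (E (a X) + E (b Y) + E (c X))\<close> the iterated
  derivatives of \<open>f\<close> along \<open>X\<close> and \<open>Y\<close> at the identity are
  the mixed partials of \<open>G\<close> at \<open>0\<close> in \<open>a\<close>, \<open>b\<close>
  and in \<open>b\<close>, \<open>c\<close>. By symmetry of second derivatives their difference is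
  the derivative of the \<open>b\<close>-partial in direction \<open>(1, 0, - 1)\<close>, and along
  that line the first and last factor form a conjugation.\<close>

lemma left_invariant_commutator:
  fixes f :: "'g \<Rightarrow> real"
  assumes f: "smooth_from \<A> f"
  shows "((\<lambda>s. deriv (\<lambda>t. f (E (s *\<^sub>R X) + E (t *\<^sub>R Y) + - E (s *\<^sub>R X))) 0) has_real_derivative
    deriv (\<lambda>t. f (E (t *\<^sub>R bracket X Y))) 0) (at 0)"
proof -
  define G where "G = (\<lambda>p::real\<times>real\<times>real. f (E (fst p *\<^sub>R X) + E (fst (snd p) *\<^sub>R Y) + E (snd (snd p) *\<^sub>R X)))"
  have "smooth_map UNIV (\<lambda>p::real\<times>real\<times>real. E (fst p *\<^sub>R X) + E (fst (snd p) *\<^sub>R Y) + E (snd (snd p) *\<^sub>R X))"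
    by (intro smooth_map_add smooth_map_E_linear open_UNIV
       bounded_linear_compose[OF bounded_linear_scaleR_left] bounded_linear_fst bounded_linear_snd
       bounded_linear_compose[OF bounded_linear_fst] bounded_linear_compose[OF bounded_linear_snd])
  then have G: "smooth_on UNIV G"
    unfolding G_def by (intro smooth_from_compose[OF f] open_UNIV)
  define P where "P = (\<lambda>p. frechet_derivative G (at p) (0, 1, 0))"
  define R where "R = (\<lambda>p. frechet_derivative G (at p) (0, 0, 1))"
  have P: "smooth_on UNIV P" and R: "smooth_on UNIV R"
    unfolding P_def R_def by (intro smooth_on_frechet_derivative G)+
  have d: "deriv (\<lambda>h. g (p + h *\<^sub>R v)) 0 = frechet_derivative g (at p) v" if "smooth_on UNIV g"
    for g :: "real\<times>real\<times>real \<Rightarrow> real" and p v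
    using DERIV_imp_deriv[OF deriv_along_line[OF that]] .
  have X0: "E (0 *\<^sub>R Z) = 0" for Z by (simp add: E_0)
  have XY: "left_invariant_field E X (left_invariant_field E Y f) 0 = frechet_derivative P (at 0) (1, 0, 0)"
  proof -
    have "left_invariant_field E Y f (0 + E (s *\<^sub>R X)) = P (0 + s *\<^sub>R (1, 0, 0))" for s
      using d[OF G, of "(s, 0, 0)" "(0, 1, 0)"] by (simp add: left_invariant_field_def P_def G_def X0 E_0)
    then show ?thesis using d[OF P, of 0 "(1, 0, 0)"] by (simp add: left_invariant_field_def[of E X])
  qed
  have YX: "left_invariant_field E Y (left_invariant_field E X f) 0 = frechet_derivative R (at 0) (0, 1, 0)"
  proof -
    have "left_invariant_field E X f (0 + E (s *\<^sub>R Y)) = R (0 + s *\<^sub>R (0, 1, 0))" for s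
      using d[OF G, of "(0, s, 0)" "(0, 0, 1)"] by (simp add: left_invariant_field_def R_def G_def X0 E_0)
    then show ?thesis using d[OF R, of 0 "(0, 1, 0)"] by (simp add: left_invariant_field_def[of E Y])
  qed
  have sym: "frechet_derivative R (at 0) (0, 1, 0) = frechet_derivative P (at 0) (0, 0, 1)"
    unfolding R_def P_def by (rule mixed_derivative_symmetric[OF G])
  have lin: "linear (frechet_derivative P (at 0))"
    by (rule has_derivative_linear[OF smooth_on_has_derivative[OF P UNIV_I]])
  have "frechet_derivative P (at 0) (1, 0, - 1) = frechet_derivative P (at 0) (1, 0, 0) - frechet_derivative P (at 0) (0, 0, 1)"
    using linear_diff[OF lin, of "(1, 0, 0)" "(0, 0, 1)"] by simp
  also have "\<dots> = left_invariant_field E (bracket X Y) f 0"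
    unfolding bracket_commutator[OF f] XY YX sym ..
  also have "\<dots> = deriv (\<lambda>t. f (E (t *\<^sub>R bracket X Y))) 0"
    by (simp add: left_invariant_field_def)
  finally have "frechet_derivative P (at 0) (1, 0, - 1) = deriv (\<lambda>t. f (E (t *\<^sub>R bracket X Y))) 0" .
  moreover have "deriv (\<lambda>t. f (E (s *\<^sub>R X) + E (t *\<^sub>R Y) + - E (s *\<^sub>R X))) 0 = P (0 + s *\<^sub>R (1, 0, - 1))" for s
    using d[OF G, of "(s, 0, - s)" "(0, 1, 0)"] E_uminus[of "s *\<^sub>R X"] by (simp add: P_def G_def)
  ultimately show ?thesis using deriv_along_line[OF P, of 0 "(1, 0, - 1)"] by simp
qed

text \<open>A globally smooth substitute for the coordinate \<open>lg x \<bullet> b\<close>, because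
  \<open>bracket_commutator\<close> speaks of functions that are smooth on the whole group. The
  second factor vanishes once \<open>lg x\<close> has norm at least \<open>e / 2\<close>.\<close>

definition bump_coordinate :: "'a \<Rightarrow> 'g \<Rightarrow> real" where
  "bump_coordinate b x = (if x \<in> W then (lg x \<bullet> b) * flat_exp 0 ((e / 2)\<^sup>2 - lg x \<bullet> lg x) else 0)"

text \<open>The function is smooth on \<open>W\<close>, and it vanishes off the image
  \<open>C\<close> of a closed ball. \<open>C\<close> is compact, hence closed in a Hausdorff group,
  so \<open>W\<close> and its complement form an open cover.\<close>

lemma bump_coordinate_smooth: "smooth_from \<A> (bump_coordinate b)"
proof (rule smooth_fromI, rule smooth_on_local)
  fix S and c :: "'a \<Rightarrow> 'g" and p
  assume S: "open S" and c: "smooth_map S c" and p: "p \<in> S"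
  define C where "C = E ` cball 0 (e / 2)"
  have "compact C" unfolding C_def by (intro compact_continuous_image continuous_on_E compact_cball)
  then have C: "closed C" by (rule compact_imp_closed)
  have CW: "C \<subseteq> W" using e_pos by (auto simp: C_def)
  show "\<exists>T. open T \<and> p \<in> T \<and> smooth_on T (\<lambda>p. bump_coordinate b (c p))"
  proof (cases "c p \<in> W")
    case True
    let ?T = "S \<inter> c -` W"
    note T = smooth_lg[OF S c]
    have "smooth_on ?T (\<lambda>q. (lg (c q) \<bullet> b) * flat_exp 0 ((e / 2)\<^sup>2 - lg (c q) \<bullet> lg (c q)))"
      by (intro smooth_on_mult T smooth_on_compose[OF T(1) _ smooth_on_flat_exp] smooth_on_diff smooth_on_const
          smooth_on_inner) auto
    then have "smooth_on ?T (\<lambda>q. bump_coordinate b (c q))"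
      by (subst smooth_on_cong[OF T(1)]) (auto simp: bump_coordinate_def)
    then show ?thesis using T p True by blast
  next
    case False
    let ?T = "S \<inter> c -` (- C)"
    have T: "open ?T" by (intro open_preimage_continuous_on S smooth_map_continuous_on[OF c]) (use C in auto)
    have "bump_coordinate b x = 0" if "x \<notin> C" for x
    proof (cases "x \<in> W")
      case True
      then obtain X where X: "x = E X" "norm X < e" by auto
      then have "norm X > e / 2" using that by (auto simp: C_def)
      then have "(e / 2)\<^sup>2 \<le> X \<bullet> X"
        using e_pos by (simp add: power2_norm_eq_inner[symmetric] power_mono)
      then show ?thesis using X lg_E by (simp add: bump_coordinate_def flat_exp_eq_0_iff)
    qed (simp add: bump_coordinate_def)
    then have "smooth_on ?T (\<lambda>q. bump_coordinate b (c q))"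
      by (subst smooth_on_cong[OF T, of _ "\<lambda>_. 0"]) (auto intro: smooth_on_const T)
    then show ?thesis using T p False CW by blast
  qed
qed

text \<open>The cut-off depends on the squared length of \<open>lg x\<close> only, so its derivative
  at the identity vanishes and the coordinate is merely multiplied by a constant.\<close>

lemma deriv_bump_coordinate:
  assumes c: "isCont c 0" "c 0 = 0" and d: "((\<lambda>t. lg (c t)) has_vector_derivative v) (at 0)"
  shows "deriv (\<lambda>t::real. bump_coordinate b (c t)) 0 = (v \<bullet> b) * flat_exp 0 ((e / 2)\<^sup>2)"
proof (rule DERIV_imp_deriv)
  let ?k = "\<lambda>Z::'a. (Z \<bullet> b) * flat_exp 0 ((e / 2)\<^sup>2 - Z \<bullet> Z)"
  have fe: "((\<lambda>Z::'a. flat_exp 0 ((e / 2)\<^sup>2 - Z \<bullet> Z)) has_derivative (\<lambda>v. 0)) (at 0)"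
  proof -
    have "(flat_exp 0 has_derivative (*) (flat_exp 2 ((e / 2)\<^sup>2))) (at ((e / 2)\<^sup>2))"
      using flat_exp_has_derivative[of 0 "(e / 2)\<^sup>2"] by (simp add: has_field_derivative_def numeral_2_eq_2)
    moreover have "((\<lambda>Z::'a. (e / 2)\<^sup>2 - Z \<bullet> Z) has_derivative (\<lambda>_. 0)) (at 0)"
      by (auto intro!: derivative_eq_intros)
    ultimately show ?thesis
      using has_derivative_compose_at[of "\<lambda>Z::'a. (e / 2)\<^sup>2 - Z \<bullet> Z" "\<lambda>_. 0" 0 "(e / 2)\<^sup>2"
        "flat_exp 0" "(*) (flat_exp 2 ((e / 2)\<^sup>2))"] by simp
  qed
  have k: "(?k has_derivative (\<lambda>v. (v \<bullet> b) * flat_exp 0 ((e / 2)\<^sup>2))) (at (lg (c 0)))"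
    unfolding c(2) lg_0 by (auto intro!: derivative_eq_intros fe)
  have "((\<lambda>t. ?k (lg (c t))) has_derivative (\<lambda>h. ((h *\<^sub>R v) \<bullet> b) * flat_exp 0 ((e / 2)\<^sup>2))) (at 0)"
    using has_derivative_compose[OF d[unfolded has_vector_derivative_def] k] .
  moreover have "eventually (\<lambda>t. ?k (lg (c t)) = bump_coordinate b (c t)) (at 0)"
    using eventually_W[OF c(1)] by eventually_elim (simp add: c(2) bump_coordinate_def)
  ultimately have "((\<lambda>t. bump_coordinate b (c t)) has_derivative (\<lambda>h. ((h *\<^sub>R v) \<bullet> b) * flat_exp 0 ((e / 2)\<^sup>2))) (at 0)"
    by (rule has_derivative_transform_eventually) (use zero_in_W in \<open>simp_all add: c(2) bump_coordinate_def\<close>)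
  then show "((\<lambda>t. bump_coordinate b (c t)) has_real_derivative (v \<bullet> b) * flat_exp 0 ((e / 2)\<^sup>2)) (at 0)"
    by (rule has_derivative_imp_has_field_derivative) (simp add: mult_ac)
qed

lemma lg_conj_has_vector_derivative:
  "((\<lambda>t. lg (y + E (t *\<^sub>R Y) + - y)) has_vector_derivative Ad y Y) (at 0)"
proof -
  have A: "((\<lambda>Z. lg (y + E Z + - y)) has_derivative Ad y) (at 0)"
    by (rule Ad_has_derivative)
  have "((\<lambda>t. lg (y + E (t *\<^sub>R Y) + - y)) has_derivative (\<lambda>h. Ad y (h *\<^sub>R Y))) (at 0)"
    by (rule has_derivative_compose_at[OF _ _ A]) (auto intro!: derivative_eq_intros)
  then show ?thesis
    using linear_scale[OF bounded_linear.linear[OF Ad_linear]] by (simp add: has_vector_derivative_def)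
qed

lemma lg_E_has_vector_derivative: "((\<lambda>t. lg (E (t *\<^sub>R Y))) has_vector_derivative Y) (at 0)"
proof -
  have A: "((\<lambda>Z. lg (E Z)) has_derivative (\<lambda>v. v)) (at 0)"
    by (rule has_derivative_lg_E)
  show ?thesis
    unfolding has_vector_derivative_def
    by (rule has_derivative_compose_at[OF _ _ A]) (auto intro!: derivative_eq_intros)
qed

text \<open>Testing \<open>left_invariant_commutator\<close> on the cut-off coordinates gives the
  claim componentwise; the positive constant \<open>?k\<close> appears on both sides and cancels.
  All later facts about the bracket rest on this description.\<close>

lemma Ad_has_derivative_bracket:
  "((\<lambda>s. Ad (E (s *\<^sub>R X)) Y) has_vector_derivative bracket X Y) (at 0)"
proof -
  have "((\<lambda>s. Ad (E (s *\<^sub>R X)) Y \<bullet> b) has_derivative (\<lambda>h. (h *\<^sub>R bracket X Y) \<bullet> b)) (at 0)" for b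
  proof -
    let ?k = "flat_exp 0 ((e / 2)\<^sup>2)"
    have k: "?k > 0" using e_pos by (simp add: flat_exp_pos_iff)
    have 1: "deriv (\<lambda>t. bump_coordinate b (y + E (t *\<^sub>R Y) + - y)) 0 = (Ad y Y \<bullet> b) * ?k" for y
      by (rule deriv_bump_coordinate[OF _ _ lg_conj_has_vector_derivative])
        (auto simp: E_0 intro!: continuous_intros isCont_o2[OF _ isCont_E])
    have 2: "deriv (\<lambda>t. bump_coordinate b (E (t *\<^sub>R bracket X Y))) 0 = (bracket X Y \<bullet> b) * ?k"
      by (rule deriv_bump_coordinate[OF _ _ lg_E_has_vector_derivative])
        (auto simp: E_0 intro!: continuous_intros isCont_o2[OF _ isCont_E])
    have "((\<lambda>s. (Ad (E (s *\<^sub>R X)) Y \<bullet> b) * ?k / ?k) has_real_derivative (bracket X Y \<bullet> b) * ?k / ?k) (at 0)"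
      using left_invariant_commutator[OF bump_coordinate_smooth, of b X Y] unfolding 1 2 by (rule DERIV_cdivide)
    then have "((\<lambda>s. Ad (E (s *\<^sub>R X)) Y \<bullet> b) has_real_derivative bracket X Y \<bullet> b) (at 0)"
      using k by simp
    moreover have "(*) (bracket X Y \<bullet> b) = (\<lambda>h. (h *\<^sub>R bracket X Y) \<bullet> b)" by (simp add: fun_eq_iff)
    ultimately show ?thesis by (simp only: has_field_derivative_def)
  qed
  then show ?thesis
    unfolding has_vector_derivative_def by (subst has_derivative_componentwise_within) blast
qed

text \<open>Linearity passes from \<open>Ad (E (s X))\<close> to its derivative at
  \<open>s = 0\<close>.\<close>

lemma bracket_bounded_linear: "bounded_linear (bracket X)"
proof -
  have "bracket X (Y + Z) = bracket X Y + bracket X Z" for Y Z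
    using has_vector_derivative_add[OF Ad_has_derivative_bracket[of X Y] Ad_has_derivative_bracket[of X Z]]
      Ad_has_derivative_bracket[of X "Y + Z"] linear_add[OF bounded_linear.linear[OF Ad_linear]]
    by (simp add: vector_derivative_unique_at)
  moreover have "bracket X (r *\<^sub>R Y) = r *\<^sub>R bracket X Y" for r Y
    using bounded_linear.has_vector_derivative[OF bounded_linear_scaleR_right Ad_has_derivative_bracket[of X Y], of r]
      Ad_has_derivative_bracket[of X "r *\<^sub>R Y"] linear_scale[OF bounded_linear.linear[OF Ad_linear]]
    by (simp add: vector_derivative_unique_at)
  ultimately show ?thesis by (simp add: linear_conv_bounded_linear[symmetric] linearI)
qed

section \<open>The left-trivialised differential of the exponential map\<close>

definition dexp :: "'a \<Rightarrow> 'a \<Rightarrow> 'a" where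
  "dexp X = frechet_derivative (\<lambda>Z. lg (- E X + E Z)) (at X)"

lemma left_deriv_E: "left_deriv E X (dexp X)"
  unfolding dexp_def by (rule left_deriv_exists[OF open_UNIV smooth_map_E]) simp

lemma dexp_linear: "bounded_linear (dexp X)"
  using left_deriv_linear[OF left_deriv_E] .

text \<open>\<open>dexp X Y\<close> is the partial derivative at \<open>(X, 0)\<close> in direction
  \<open>(0, Y)\<close> of one smooth map of two variables, which makes the dependence on
  \<open>X\<close> visible.\<close>

lemma continuous_on_dexp: "continuous_on UNIV (\<lambda>X. dexp X Y)"
proof -
  define c where "c = (\<lambda>z::'a\<times>'a. E (- fst z) + E (fst z + snd z))"
  have sm: "smooth_map UNIV c"
    unfolding c_def
    by (intro smooth_map_add smooth_map_E_linear open_UNIV bounded_linear_minus bounded_linear_fst bounded_linear_snd bounded_linear_add)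
  have c0: "c (X, 0) = 0" for X by (simp add: c_def E_uminus)
  define T where "T = UNIV \<inter> c -` W"
  note T = smooth_lg[OF open_UNIV sm, folded T_def]
  have inT: "(X, 0) \<in> T" for X using c0 zero_in_W by (simp add: T_def)
  let ?F = "\<lambda>z. frechet_derivative (\<lambda>z. lg (c z)) (at z) (0, Y)"
  have "dexp X Y = ?F (X, 0)" for X
  proof -
    have F: "((\<lambda>z. lg (c z)) has_derivative frechet_derivative (\<lambda>z. lg (c z)) (at (X, 0))) (at (X, 0))"
      using smooth_on_has_derivative[OF T(2) inT[of X]] by simp
    have "((\<lambda>Z. lg (c (X, Z - X))) has_derivative (\<lambda>v. frechet_derivative (\<lambda>z. lg (c z)) (at (X, 0)) (0, v))) (at X)"
      by (rule has_derivative_compose_at[OF _ _ F]) (auto intro!: derivative_eq_intros)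
    moreover have "(\<lambda>Z. lg (c (X, Z - X))) = (\<lambda>Z. lg (- E X + E Z))" by (simp add: c_def E_uminus)
    ultimately show ?thesis unfolding dexp_def using frechet_derivative_at by metis
  qed
  moreover have "continuous_on T ?F"
    by (intro smooth_on_continuous_on smooth_on_frechet_derivative T)
  then have "continuous_on UNIV (\<lambda>X. ?F (X, 0))"
    by (rule continuous_on_compose2) (use inT in \<open>auto intro!: continuous_intros\<close>)
  ultimately show ?thesis by simp
qed

lemma dexp_0: "dexp 0 Y = Y"
proof -
  have "dexp 0 = (\<lambda>v. v)"
    unfolding dexp_def using frechet_derivative_at[OF has_derivative_lg_E] by (simp add: E_0)
  then show ?thesis by simp
qed

text \<open>Both sides are the left derivative at \<open>t = 0\<close> of
  \<open>E ((s + h) (X + t Y)) = E (s (X + t Y)) + E (h (X + t Y))\<close>, the right one by the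
  product rule.\<close>

lemma dexp_scaled_add:
  "dexp ((s + h) *\<^sub>R X) ((s + h) *\<^sub>R Y) = Ad (E ((- h) *\<^sub>R X)) (dexp (s *\<^sub>R X) (s *\<^sub>R Y)) + dexp (h *\<^sub>R X) (h *\<^sub>R Y)"
proof -
  have ld: "left_deriv (\<lambda>t. E (s *\<^sub>R (X + t *\<^sub>R Y))) 0 (\<lambda>v. dexp (s *\<^sub>R X) (s *\<^sub>R v *\<^sub>R Y))" for s
  proof (rule left_deriv_compose[where f = "\<lambda>t. s *\<^sub>R (X + t *\<^sub>R Y)" and D = "dexp (s *\<^sub>R X)" and f' = "\<lambda>v. s *\<^sub>R v *\<^sub>R Y"])
    show "((\<lambda>t. s *\<^sub>R (X + t *\<^sub>R Y)) has_derivative (\<lambda>v. s *\<^sub>R v *\<^sub>R Y)) (at 0)"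
      by (auto intro!: derivative_eq_intros)
  qed (use left_deriv_E[of "s *\<^sub>R X"] in simp)
  have "(\<lambda>t. E ((s + h) *\<^sub>R (X + t *\<^sub>R Y))) = (\<lambda>t. E (s *\<^sub>R (X + t *\<^sub>R Y)) + E (h *\<^sub>R (X + t *\<^sub>R Y)))"
    by (simp add: exp_one_parameter)
  from fun_cong[OF left_deriv_unique[OF ld[of "s + h", unfolded this] left_deriv_add[OF ld[of s] ld[of h]]], of 1]
  show ?thesis by (simp add: E_uminus)
qed

text \<open>The addition formula is differentiated in \<open>h\<close> at \<open>0\<close>: the
  \<open>Ad\<close> term contributes minus the bracket, the other term contributes
  \<open>Y\<close>.\<close>

lemma dexp_scaled_has_vector_derivative:
  "((\<lambda>s. dexp (s *\<^sub>R X) (s *\<^sub>R Y)) has_vector_derivative Y - bracket X (dexp (s *\<^sub>R X) (s *\<^sub>R Y))) (at s)"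
proof -
  define M where "M = (\<lambda>s. dexp (s *\<^sub>R X) (s *\<^sub>R Y))"
  have "isCont (\<lambda>h. dexp (h *\<^sub>R X) Y) 0"
  proof (rule isCont_o2[where g = "\<lambda>X. dexp X Y" and f = "\<lambda>h. h *\<^sub>R X"])
    show "isCont (\<lambda>X. dexp X Y) (0 *\<^sub>R X)"
      using continuous_on_dexp[of Y] by (simp add: continuous_on_eq_continuous_at)
  qed simp
  from has_vector_derivative_scaleR_isCont[OF this]
  have M0: "(M has_vector_derivative Y) (at 0)"
    by (simp add: dexp_0 M_def linear_scale[OF bounded_linear.linear[OF dexp_linear]])
  have A: "((\<lambda>h. Ad (E (h *\<^sub>R X)) (M s)) has_vector_derivative bracket X (M s)) (at (- 0))"
    using Ad_has_derivative_bracket by simp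
  have "((\<lambda>h. Ad (E ((- h) *\<^sub>R X)) (M s)) has_vector_derivative (- 1) *\<^sub>R bracket X (M s)) (at 0)"
  proof -
    have n: "((\<lambda>h. - h) has_vector_derivative - 1) (at (0::real))" by (auto intro!: derivative_eq_intros)
    show ?thesis using vector_diff_chain_at[OF n A] by (simp add: o_def)
  qed
  from has_vector_derivative_add[OF this M0]
  have "((\<lambda>h. M (s + h)) has_vector_derivative Y - bracket X (M s)) (at 0)"
    unfolding M_def dexp_scaled_add by simp
  then have "((\<lambda>h. M (s + (h - s))) has_vector_derivative 1 *\<^sub>R (Y - bracket X (M s))) (at s)"
  proof -
    assume A: "((\<lambda>h. M (s + h)) has_vector_derivative Y - bracket X (M s)) (at 0)"
    have n: "((\<lambda>h. h - s) has_vector_derivative 1) (at s)" by (auto intro!: derivative_eq_intros)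
    show ?thesis using vector_diff_chain_at[OF n, of "\<lambda>h. M (s + h)"] A by (simp add: o_def)
  qed
  then show ?thesis by (simp add: M_def)
qed

text \<open>Both sides solve the linear differential equation that determines the differential of the
  exponential map along a ray.\<close>

lemma dexp_automorphism:
  assumes \<delta>: "linear \<delta>" and hom: "\<And>X Y. \<delta> (bracket X Y) = bracket (\<delta> X) (\<delta> Y)"
  shows "dexp (\<delta> X) (\<delta> Y) = \<delta> (dexp X Y)"
proof -
  have bl: "bounded_linear \<delta>" using \<delta> by (simp add: linear_conv_bounded_linear)
  \<comment> \<open>The inhomogeneous terms \<open>\<delta> Y\<close> cancel in the difference,
    which leaves a homogeneous linear equation with initial value \<open>0\<close>.\<close>
  define D where "D = (\<lambda>s. dexp (s *\<^sub>R \<delta> X) (s *\<^sub>R \<delta> Y) - \<delta> (dexp (s *\<^sub>R X) (s *\<^sub>R Y)))"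
  have "(D has_vector_derivative - bracket (\<delta> X) (D s)) (at s)" for s
  proof -
    have "(D has_vector_derivative (\<delta> Y - bracket (\<delta> X) (dexp (s *\<^sub>R \<delta> X) (s *\<^sub>R \<delta> Y)))
        - \<delta> (Y - bracket X (dexp (s *\<^sub>R X) (s *\<^sub>R Y)))) (at s)"
      unfolding D_def
      by (intro has_vector_derivative_diff dexp_scaled_has_vector_derivative bounded_linear.has_vector_derivative[OF bl])
    then show ?thesis
      by (simp add: linear_diff[OF \<delta>] hom D_def linear_diff[OF bounded_linear.linear[OF bracket_bounded_linear]])
  qed
  from linear_ode_zero[OF bracket_bounded_linear this, of 1]
  have "D 1 = 0"
    by (simp add: D_def linear_0[OF bounded_linear.linear[OF dexp_linear]] linear_0[OF \<delta>])
  then show ?thesis by (simp add: D_def)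
qed

lemma Ad_self: "Ad (E (t *\<^sub>R V)) V = V"
proof -
  have "E (t *\<^sub>R V) + E (s *\<^sub>R V) + - E (t *\<^sub>R V) = E (s *\<^sub>R V)" for s
  proof -
    have "E (t *\<^sub>R V) + E (s *\<^sub>R V) = E (s *\<^sub>R V) + E (t *\<^sub>R V)"
      by (metis exp_one_parameter add.commute)
    then show ?thesis by (simp add: add.assoc)
  qed
  then show ?thesis
    using lg_conj_has_vector_derivative[of "E (t *\<^sub>R V)" V] lg_E_has_vector_derivative[of V]
    by (simp add: vector_derivative_unique_at)
qed

text \<open>Taking left derivatives in \<open>EZ\<close> gives \<open>dexp (Z t) (Z' t) = Y\<close>,
  and \<open>dexp_automorphism\<close> carries this to the images under \<open>\<delta>\<close>. By
  the product rule \<open>E (\<delta> (Z t)) + E (- t \<delta> Y)\<close> then has left derivative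
  \<open>0\<close>. This is the multiplicativity of \<open>\<delta>\<close> in a form that does not
  refer to an inverse of \<open>E\<close>.\<close>

lemma automorphism_translate_curve:
  fixes Z :: "real \<Rightarrow> 'a"
  assumes \<delta>: "linear \<delta>" and hom: "\<And>X Y. \<delta> (bracket X Y) = bracket (\<delta> X) (\<delta> Y)"
    and I: "open I" "connected I" "0 \<in> I" "t \<in> I"
    and Z: "\<And>t. t \<in> I \<Longrightarrow> (Z has_vector_derivative Z' t) (at t)"
    and EZ: "\<And>t. t \<in> I \<Longrightarrow> E (Z t) = x + E (t *\<^sub>R Y)"
  shows "E (\<delta> (Z t)) = E (\<delta> (Z 0)) + E (t *\<^sub>R \<delta> Y)"
proof -
  have bl: "bounded_linear \<delta>" using \<delta> by (simp add: linear_conv_bounded_linear)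
  \<comment> \<open>The summand \<open>0\<close> brings the second factor into the shape of
    \<open>left_deriv_one_parameter\<close>.\<close>
  define c where "c = (\<lambda>t. E (\<delta> (Z t)) + (0 + E (t *\<^sub>R - \<delta> Y)))"
  have "left_deriv c s (\<lambda>_. 0)" if s: "s \<in> I" for s
  proof -
    have l: "left_deriv (\<lambda>t. E (Z t)) s (\<lambda>h. dexp (Z s) (h *\<^sub>R Z' s))"
      by (rule left_deriv_compose[OF left_deriv_E]) (use Z[OF s] in \<open>simp add: has_vector_derivative_def\<close>)
    have "left_deriv (\<lambda>t. x + E (t *\<^sub>R Y)) s (\<lambda>h. dexp (Z s) (h *\<^sub>R Z' s))"
      by (rule left_deriv_cong[OF I(1) s EZ l])
    from fun_cong[OF left_deriv_unique[OF this left_deriv_one_parameter], of 1]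
    have "dexp (Z s) (Z' s) = Y" by simp
    then have *: "dexp (\<delta> (Z s)) (\<delta> (Z' s)) = \<delta> Y" by (simp add: dexp_automorphism[OF \<delta> hom])
    have "left_deriv (\<lambda>t. E (\<delta> (Z t))) s (\<lambda>h. dexp (\<delta> (Z s)) (h *\<^sub>R \<delta> (Z' s)))"
      by (rule left_deriv_compose[OF left_deriv_E, where f = "\<lambda>t. \<delta> (Z t)"])
        (use bounded_linear.has_vector_derivative[OF bl Z[OF s]] in \<open>simp add: has_vector_derivative_def\<close>)
    then have "left_deriv (\<lambda>t. E (\<delta> (Z t))) s (\<lambda>h. h *\<^sub>R \<delta> Y)"
      by (simp add: linear_scale[OF bounded_linear.linear[OF dexp_linear]] *)
    from left_deriv_add[OF this left_deriv_one_parameter[of 0 "- \<delta> Y" s]]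
    have "left_deriv c s (\<lambda>v. Ad (E (s *\<^sub>R \<delta> Y)) (v *\<^sub>R \<delta> Y) + v *\<^sub>R - \<delta> Y)"
      by (simp add: c_def E_uminus)
    then show ?thesis
      by (simp add: linear_scale[OF bounded_linear.linear[OF Ad_linear]] Ad_self)
  qed
  from left_deriv_0_constant[OF I(1,2) this]
  have "c t = c 0" using I(3,4) by (auto simp: constant_on_def)
  then have "E (\<delta> (Z t)) + - E (t *\<^sub>R \<delta> Y) = E (\<delta> (Z 0))"
    by (simp add: c_def E_0 E_uminus)
  then show ?thesis by (metis add.assoc add.right_neutral left_minus)
qed

end

section \<open>Dilations\<close>

context homogeneous_group
begin

abbreviation dil :: "real \<Rightarrow> 'a \<Rightarrow> 'a" where
  "dil \<equiv> algebra_dilation A"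

lemma eigenbasis_exists:
  obtains B \<nu> where "finite B" "independent B" "span B = UNIV"
    "\<And>b. b \<in> B \<Longrightarrow> A b = \<nu> b *\<^sub>R b" "\<And>b. b \<in> B \<Longrightarrow> \<nu> b > 0"
proof -
  obtain B where B: "independent B" "span B = UNIV" "\<forall>b\<in>B. \<exists>c. A b = c *\<^sub>R b"
    using A_diagonalisable unfolding diagonalisable_def by blast
  then obtain \<nu> where \<nu>: "\<And>b. b \<in> B \<Longrightarrow> A b = \<nu> b *\<^sub>R b" by metis
  have "b \<noteq> 0" if "b \<in> B" for b using B(1) that dependent_zero by blast
  then have "\<nu> b > 0" if "b \<in> B" for b using A_positive \<nu> that by blast
  moreover have "finite B" using B(1) by (rule independent_imp_finite)
  ultimately show ?thesis using that B \<nu> by blast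
qed

definition eigenbasis :: "'a set" where
  "eigenbasis = (SOME B. finite B \<and> independent B \<and> span B = UNIV \<and> (\<forall>b\<in>B. \<exists>c>0. A b = c *\<^sub>R b))"

definition eigenvalue :: "'a \<Rightarrow> real" where
  "eigenvalue b = (SOME c. c > 0 \<and> A b = c *\<^sub>R b)"

lemma eigenbasis: "finite eigenbasis" "independent eigenbasis" "span eigenbasis = UNIV"
  and eigenvalue: "b \<in> eigenbasis \<Longrightarrow> eigenvalue b > 0" "b \<in> eigenbasis \<Longrightarrow> A b = eigenvalue b *\<^sub>R b"
proof -
  have "\<exists>B. finite B \<and> independent B \<and> span B = UNIV \<and> (\<forall>b\<in>B. \<exists>c>0. A b = c *\<^sub>R b)"
    by (rule eigenbasis_exists) blast
  then have *: "finite eigenbasis \<and> independent eigenbasis \<and> span eigenbasis = UNIV \<and> (\<forall>b\<in>eigenbasis. \<exists>c>0. A b = c *\<^sub>R b)"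
    unfolding eigenbasis_def by (rule someI_ex)
  then show "finite eigenbasis" "independent eigenbasis" "span eigenbasis = UNIV" by auto
  assume "b \<in> eigenbasis"
  then have "\<exists>c. c > 0 \<and> A b = c *\<^sub>R b" using * by blast
  then have "eigenvalue b > 0 \<and> A b = eigenvalue b *\<^sub>R b" unfolding eigenvalue_def by (rule someI_ex)
  then show "eigenvalue b > 0" "A b = eigenvalue b *\<^sub>R b" by auto
qed

definition coord :: "'a \<Rightarrow> 'a \<Rightarrow> real" where
  "coord b X = representation eigenbasis X b"

lemma coord_linear: "bounded_linear (coord b)"
  unfolding linear_conv_bounded_linear[symmetric] coord_def
  by (rule linearI) (simp_all add: real_vector.representation_add real_vector.representation_scale eigenbasis)

lemma coord_sum: "(\<Sum>b\<in>eigenbasis. coord b X *\<^sub>R b) = X"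
  unfolding coord_def by (rule real_vector.sum_representation_eq) (auto simp: eigenbasis)

lemma coord_basis: "b \<in> eigenbasis \<Longrightarrow> c \<in> eigenbasis \<Longrightarrow> coord b c = (if b = c then 1 else 0)"
  unfolding coord_def by (simp add: real_vector.representation_basis eigenbasis)

lemma A_linear: "linear A"
  using A_diagonalisable by (simp add: diagonalisable_def)

text \<open>On an eigenvector the operator series is the scalar series of
  \<open>exp (c * ln r)\<close>.\<close>

lemma dil_eigenvector:
  assumes "A b = c *\<^sub>R b" "r > 0"
  shows "dil r b = (r powr c) *\<^sub>R b"
proof -
  have p: "((\<lambda>Y. ln r *\<^sub>R A Y) ^^ k) b = ((ln r * c) ^ k) *\<^sub>R b" for k
  proof (induction k)
    case (Suc k)
    then show ?case by (simp add: linear_scale[OF A_linear] assms(1) mult_ac)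
  qed simp
  have "(\<lambda>k. (ln r * c) ^ k /\<^sub>R fact k) sums exp (ln r * c)" by (rule exp_converges)
  from bounded_linear.sums[OF bounded_linear_scaleR_left this, of b]
  have "(\<lambda>k. (1 / fact k) *\<^sub>R ((ln r * c) ^ k) *\<^sub>R b) sums (exp (ln r * c) *\<^sub>R b)"
    by (simp add: divide_inverse)
  then have "dil r b = exp (ln r * c) *\<^sub>R b"
    unfolding algebra_dilation_def p by (rule sums_unique[symmetric])
  then show ?thesis using assms(2) by (simp add: powr_def mult.commute)
qed

lemma dil_coord: "r > 0 \<Longrightarrow> dil r X = (\<Sum>b\<in>eigenbasis. (coord b X * r powr eigenvalue b) *\<^sub>R b)"
proof -
  assume r: "r > 0"
  have "dil r X = dil r (\<Sum>b\<in>eigenbasis. coord b X *\<^sub>R b)" by (simp add: coord_sum)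
  also have "\<dots> = (\<Sum>b\<in>eigenbasis. coord b X *\<^sub>R dil r b)"
    by (simp add: linear_sum[OF dilation_linear[OF r]] linear_scale[OF dilation_linear[OF r]])
  also have "\<dots> = (\<Sum>b\<in>eigenbasis. (coord b X * r powr eigenvalue b) *\<^sub>R b)"
    using dil_eigenvector[OF eigenvalue(2) r] by (intro sum.cong) auto
  finally show ?thesis .
qed

lemma coord_dil:
  assumes "r > 0" "b \<in> eigenbasis"
  shows "coord b (dil r X) = r powr eigenvalue b * coord b X"
proof -
  have "coord b (dil r X) = (\<Sum>c\<in>eigenbasis. (coord c X * r powr eigenvalue c) * coord b c)"
    unfolding dil_coord[OF assms(1)]
    using coord_linear[of b] by (simp add: linear_sum linear_scale bounded_linear.linear)
  also have "\<dots> = (\<Sum>c\<in>eigenbasis. if c = b then coord b X * r powr eigenvalue b else 0)"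
    by (intro sum.cong refl) (use assms(2) in \<open>auto simp: coord_basis\<close>)
  also have "\<dots> = r powr eigenvalue b * coord b X" using eigenbasis(1) assms(2) by simp
  finally show ?thesis .
qed

lemma coord_eqI: "(\<And>b. b \<in> eigenbasis \<Longrightarrow> coord b X = coord b Y) \<Longrightarrow> X = Y"
  using coord_sum[of X] coord_sum[of Y] by (metis (no_types, lifting) sum.cong)

lemma dil_1 [simp]: "dil 1 X = X"
  by (rule coord_eqI) (simp add: coord_dil)

lemma dil_dil: "r > 0 \<Longrightarrow> s > 0 \<Longrightarrow> dil r (dil s X) = dil (r * s) X"
  by (rule coord_eqI) (simp add: coord_dil powr_mult)

lemma dil_inverse [simp]: "r > 0 \<Longrightarrow> dil (1 / r) (dil r X) = X" "r > 0 \<Longrightarrow> dil r (dil (1 / r) X) = X"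
  by (simp_all add: dil_dil)

lemma dil_bounded_linear: "r > 0 \<Longrightarrow> bounded_linear (dil r)"
  using dilation_linear by (simp add: linear_conv_bounded_linear)

lemma dil_0 [simp]: "r > 0 \<Longrightarrow> dil r 0 = 0"
  using dilation_linear linear_0 by blast

lemma dil_minus: "r > 0 \<Longrightarrow> dil r (- X) = - dil r X"
  using dilation_linear linear_neg by blast

text \<open>For \<open>r \<le> 1\<close> every factor \<open>r powr eigenvalue b\<close> is at most
  the one with the smallest exponent; the constant comes from the bounds of the coordinate
  functionals.\<close>

lemma dil_bound:
  obtains C m where "C > 0" "m > 0" "\<And>r X. 0 < r \<Longrightarrow> r \<le> 1 \<Longrightarrow> norm (dil r X) \<le> C * r powr m * norm X"
proof -
  \<comment> \<open>The inserted \<open>1\<close> makes the set visibly nonempty; it can only lower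
    the minimum.\<close>
  define m where "m = Min (insert 1 (eigenvalue ` eigenbasis))"
  have m: "m > 0" unfolding m_def using eigenbasis(1) eigenvalue(1) by (subst Min_gr_iff) auto
  have "\<exists>K. \<forall>X. norm (coord b X) \<le> norm X * K" for b
    using bounded_linear.bounded[OF coord_linear] by blast
  then obtain K where K: "\<And>b X. \<bar>coord b X\<bar> \<le> norm X * K b" by (metis real_norm_def)
  define C where "C = (\<Sum>b\<in>eigenbasis. \<bar>K b\<bar> * norm b) + 1"
  have "C > 0" unfolding C_def by (intro add_nonneg_pos sum_nonneg) auto
  moreover have "norm (dil r X) \<le> C * r powr m * norm X" if r: "0 < r" "r \<le> 1" for r X
  proof -
    have "norm (dil r X) \<le> (\<Sum>b\<in>eigenbasis. norm ((coord b X * r powr eigenvalue b) *\<^sub>R b))"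
      unfolding dil_coord[OF r(1)] by (rule norm_sum)
    also have "\<dots> \<le> (\<Sum>b\<in>eigenbasis. \<bar>K b\<bar> * norm b * r powr m * norm X)"
    proof (rule sum_mono)
      fix b assume b: "b \<in> eigenbasis"
      have "m \<le> eigenvalue b" unfolding m_def using eigenbasis(1) b by (intro Min_le) auto
      then have "r powr eigenvalue b \<le> r powr m" using r by (simp add: powr_mono')
      moreover have "\<bar>coord b X\<bar> \<le> norm X * \<bar>K b\<bar>"
        using K[of b X] mult_left_mono[OF abs_ge_self[of "K b"] norm_ge_zero[of X]] by linarith
      ultimately have "\<bar>coord b X\<bar> * r powr eigenvalue b * norm b \<le> (norm X * \<bar>K b\<bar>) * r powr m * norm b"
        by (intro mult_mono mult_right_mono) auto
      then show "norm ((coord b X * r powr eigenvalue b) *\<^sub>R b) \<le> \<bar>K b\<bar> * norm b * r powr m * norm X"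
        by (simp add: abs_mult mult_ac)
    qed
    also have "\<dots> = (\<Sum>b\<in>eigenbasis. \<bar>K b\<bar> * norm b) * (r powr m * norm X)"
      by (simp add: sum_distrib_right mult.assoc)
    also have "\<dots> \<le> C * (r powr m * norm X)"
      unfolding C_def by (intro mult_right_mono) auto
    finally show ?thesis by (simp add: mult.assoc)
  qed
  ultimately show ?thesis using that[of C m] m by blast
qed

lemma dil_tendsto_0: "((\<lambda>r. dil r X) \<longlongrightarrow> 0) (at_right 0)"
proof -
  have "((\<lambda>r. \<Sum>b\<in>eigenbasis. (coord b X * r powr eigenvalue b) *\<^sub>R b) \<longlongrightarrow> (\<Sum>b\<in>eigenbasis. (coord b X * 0 powr eigenvalue b) *\<^sub>R b)) (at_right 0)"
    by (intro tendsto_intros tendsto_powr') (auto simp: eigenvalue(1) eventually_at_filter less_imp_le)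
  moreover have "\<forall>\<^sub>F r in at_right 0. (\<Sum>b\<in>eigenbasis. (coord b X * r powr eigenvalue b) *\<^sub>R b) = dil r X"
    by (auto simp: eventually_at_filter dil_coord)
  ultimately show ?thesis by (simp add: Lim_transform_eventually)
qed

lemma eventually_dil_small:
  assumes "\<eta> > 0"
  shows "\<forall>\<^sub>F r in at_right 0. norm (dil r X) < \<eta>"
proof -
  have "((\<lambda>r. norm (dil r X)) \<longlongrightarrow> 0) (at_right 0)"
    using tendsto_norm[OF dil_tendsto_0[of X]] by simp
  then show ?thesis using assms by (rule order_tendstoD)
qed

lemma dil_small_exists:
  assumes "\<eta> > 0" "finite F"
  obtains r where "0 < r" "r \<le> 1" "\<And>X. X \<in> F \<Longrightarrow> norm (dil r X) < \<eta>"
proof -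
  have "\<forall>\<^sub>F r in at_right (0::real). r < 1"
    by (rule eventually_at_rightI[of 0 1]) auto
  moreover have "\<forall>\<^sub>F r in at_right (0::real). 0 < r" by (simp add: eventually_at_filter)
  moreover have "\<forall>\<^sub>F r in at_right 0. \<forall>X\<in>F. norm (dil r X) < \<eta>"
    using assms(2) eventually_dil_small[OF assms(1)] by (simp add: eventually_ball_finite_distrib)
  ultimately have "\<forall>\<^sub>F r in at_right 0. 0 < r \<and> r \<le> 1 \<and> (\<forall>X\<in>F. norm (dil r X) < \<eta>)"
    by eventually_elim auto
  then have "\<exists>r. 0 < r \<and> r \<le> 1 \<and> (\<forall>X\<in>F. norm (dil r X) < \<eta>)"
    by (rule eventually_happens'[rotated]) simp
  then show ?thesis using that by blast
qed

end

section \<open>The exponential map of a homogeneous group is bijective\<close>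

locale homogeneous_exp_chart = homogeneous_group \<A> E bracket A + exp_chart \<A> E bracket e lg
  for \<A> :: "('g::{topological_group_add, t2_space, second_countable_topology},
              'a::euclidean_space) chart set"
    and E :: "'a \<Rightarrow> 'g"
    and bracket :: "'a \<Rightarrow> 'a \<Rightarrow> 'a"
    and A :: "'a \<Rightarrow> 'a"
    and e :: real and lg :: "'g \<Rightarrow> 'a"
begin

section \<open>The product near the origin, in logarithmic coordinates\<close>

definition lmul :: "'a \<Rightarrow> 'a \<Rightarrow> 'a" where
  "lmul X Y = lg (E X + E Y)"

lemma smooth_lmul:
  "open (UNIV \<inter> (\<lambda>z. E (fst z) + E (snd z)) -` W)"
  "smooth_on (UNIV \<inter> (\<lambda>z. E (fst z) + E (snd z)) -` W) (\<lambda>z. lmul (fst z) (snd z))"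
proof -
  have sm: "smooth_map UNIV (\<lambda>z. E (fst z) + E (snd z))"
    by (intro smooth_map_add smooth_map_E_linear open_UNIV bounded_linear_fst bounded_linear_snd)
  show "open (UNIV \<inter> (\<lambda>z. E (fst z) + E (snd z)) -` W)"
    "smooth_on (UNIV \<inter> (\<lambda>z. E (fst z) + E (snd z)) -` W) (\<lambda>z. lmul (fst z) (snd z))"
    using smooth_lg[OF open_UNIV sm] by (simp_all add: lmul_def)
qed

lemma lmul_0: "norm X < e \<Longrightarrow> lmul X 0 = X"
  by (simp add: lmul_def E_0 lg_E)

text \<open>The last property keeps the whole contracted orbit of a product in the ball where
  \<open>lg\<close> inverts \<open>E\<close>; by \<open>dil_bound\<close> it suffices that the
  product itself has norm below \<open>e / C\<close>.\<close>

lemma lmul_radius_exists: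
  obtains \<eta> where "0 < \<eta>" "\<eta> \<le> e" "\<And>X Y. norm X < \<eta> \<Longrightarrow> norm Y < \<eta> \<Longrightarrow> E X + E Y \<in> W"
    "\<And>X Y r. norm X < \<eta> \<Longrightarrow> norm Y < \<eta> \<Longrightarrow> 0 < r \<Longrightarrow> r \<le> 1 \<Longrightarrow> norm (dil r (lmul X Y)) < e"
proof -
  obtain C m where C: "C > 0" "m > 0" "\<And>r X. 0 < r \<Longrightarrow> r \<le> 1 \<Longrightarrow> norm (dil r X) \<le> C * r powr m * norm X"
    using dil_bound by blast
  let ?T = "UNIV \<inter> (\<lambda>z. E (fst z) + E (snd z)) -` W"
  let ?T' = "?T \<inter> (\<lambda>z. lmul (fst z) (snd z)) -` ball 0 (e / C)"
  have "open ?T'"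
    by (intro continuous_open_preimage smooth_on_continuous_on smooth_lmul) auto
  moreover have "(0, 0) \<in> ?T'"
    using zero_in_W e_pos C(1) lmul_0[of 0] by (simp add: E_0)
  ultimately obtain d where d: "d > 0" "ball (0, 0) d \<subseteq> ?T'" by (meson openE)
  define \<eta> where "\<eta> = min (d / 2) e"
  have in_T': "(X, Y) \<in> ?T'" if "norm X < \<eta>" "norm Y < \<eta>" for X Y
  proof -
    have "norm (X, Y) \<le> norm X + norm Y" by (rule norm_Pair_le)
    then have "(X, Y) \<in> ball (0, 0) d" using that by (simp add: \<eta>_def dist_norm norm_Pair)
    then show ?thesis using d(2) by blast
  qed
  have "norm (dil r (lmul X Y)) < e" if "norm X < \<eta>" "norm Y < \<eta>" "0 < r" "r \<le> 1" for X Y r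
  proof -
    have l: "norm (lmul X Y) < e / C" using in_T'[OF that(1,2)] by simp
    have "norm (dil r (lmul X Y)) \<le> C * r powr m * norm (lmul X Y)" by (rule C(3)[OF that(3,4)])
    also have "\<dots> \<le> C * 1 * norm (lmul X Y)"
      using that C by (intro mult_mono mult_left_mono) (auto simp: powr_le1)
    also have "\<dots> < e" using l C(1) by (simp add: field_simps)
    finally show ?thesis .
  qed
  then show ?thesis
    using that[of \<eta>] d e_pos in_T' by (auto simp: \<eta>_def)
qed

text \<open>The conditions hold up to radius \<open>2 * \<eta>\<close>, because a curve
  \<open>t \<mapsto> lmul X (t Y)\<close> has to exist on an open interval that contains
  \<open>0\<close> and \<open>1\<close>; here it is the interval from \<open>- 2\<close> to
  \<open>2\<close>.\<close>

definition \<eta> :: real where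
  "\<eta> = (SOME \<eta>. 0 < \<eta> \<and> 2 * \<eta> \<le> e \<and> (\<forall>X Y. norm X < 2 * \<eta> \<longrightarrow> norm Y < 2 * \<eta> \<longrightarrow> E X + E Y \<in> W) \<and>
    (\<forall>X Y r. norm X < 2 * \<eta> \<longrightarrow> norm Y < 2 * \<eta> \<longrightarrow> 0 < r \<longrightarrow> r \<le> 1 \<longrightarrow> norm (dil r (lmul X Y)) < e))"

lemma \<eta>: "0 < \<eta>" "2 * \<eta> \<le> e" "\<And>X Y. norm X < 2 * \<eta> \<Longrightarrow> norm Y < 2 * \<eta> \<Longrightarrow> E X + E Y \<in> W"
    "\<And>X Y r. norm X < 2 * \<eta> \<Longrightarrow> norm Y < 2 * \<eta> \<Longrightarrow> 0 < r \<Longrightarrow> r \<le> 1 \<Longrightarrow> norm (dil r (lmul X Y)) < e"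
proof -
  obtain \<zeta> where \<zeta>: "0 < \<zeta>" "\<zeta> \<le> e" "\<And>X Y. norm X < \<zeta> \<Longrightarrow> norm Y < \<zeta> \<Longrightarrow> E X + E Y \<in> W"
    "\<And>X Y r. norm X < \<zeta> \<Longrightarrow> norm Y < \<zeta> \<Longrightarrow> 0 < r \<Longrightarrow> r \<le> 1 \<Longrightarrow> norm (dil r (lmul X Y)) < e"
    using lmul_radius_exists by blast
  have "\<exists>\<eta>. 0 < \<eta> \<and> 2 * \<eta> \<le> e \<and> (\<forall>X Y. norm X < 2 * \<eta> \<longrightarrow> norm Y < 2 * \<eta> \<longrightarrow> E X + E Y \<in> W) \<and>
    (\<forall>X Y r. norm X < 2 * \<eta> \<longrightarrow> norm Y < 2 * \<eta> \<longrightarrow> 0 < r \<longrightarrow> r \<le> 1 \<longrightarrow> norm (dil r (lmul X Y)) < e)"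
    by (rule exI[of _ "\<zeta> / 2"]) (use \<zeta> in auto)
  from someI_ex[OF this, folded \<eta>_def]
  show "0 < \<eta>" "2 * \<eta> \<le> e" "\<And>X Y. norm X < 2 * \<eta> \<Longrightarrow> norm Y < 2 * \<eta> \<Longrightarrow> E X + E Y \<in> W"
    "\<And>X Y r. norm X < 2 * \<eta> \<Longrightarrow> norm Y < 2 * \<eta> \<Longrightarrow> 0 < r \<Longrightarrow> r \<le> 1 \<Longrightarrow> norm (dil r (lmul X Y)) < e"
    by auto
qed

text \<open>\<open>Z\<close> lifts the curve \<open>E X + E (t Y)\<close> and starts at
  \<open>X\<close>, so \<open>automorphism_translate_curve\<close> with
  \<open>\<delta> = dil r\<close> gives the claim at \<open>t = 1\<close>. Here the compatibility of
  dilations with the bracket enters.\<close>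

lemma E_dil_lmul:
  assumes X: "norm X < \<eta>" and Y: "norm Y < \<eta>" and r: "r > 0"
  shows "E (dil r (lmul X Y)) = E (dil r X) + E (dil r Y)"
proof -
  define Z where "Z = (\<lambda>t. lmul X (t *\<^sub>R Y))"
  let ?I = "{-2<..<2::real}"
  have inW: "E X + E (t *\<^sub>R Y) \<in> W" if t: "t \<in> ?I" for t
  proof (rule \<eta>(3))
    have "\<bar>t\<bar> * norm Y \<le> 2 * norm Y" using t by (intro mult_right_mono) auto
    then show "norm (t *\<^sub>R Y) < 2 * \<eta>" using Y by simp
  qed (use X \<eta>(1) in simp)
  have sm: "smooth_map ?I (\<lambda>t. E X + E (t *\<^sub>R Y))"
    by (intro smooth_map_add smooth_map_const smooth_map_E_linear bounded_linear_scaleR_left) auto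
  have Zd: "(Z has_vector_derivative vector_derivative Z (at t)) (at t)" if t: "t \<in> ?I" for t
    using has_derivative_lg[OF _ sm t inW[OF t]]
    by (auto simp: Z_def lmul_def vector_derivative_works[symmetric] differentiable_def)
  have "E (dil r (Z 1)) = E (dil r (Z 0)) + E (1 *\<^sub>R dil r Y)"
  proof (rule automorphism_translate_curve[where I = ?I and x = "E X" and Z = Z and \<delta> = "dil r" and Y = Y and Z' = "\<lambda>t. vector_derivative Z (at t)"])
    show "E (Z t) = E X + E (t *\<^sub>R Y)" if "t \<in> ?I" for t
      using E_lg[OF inW[OF that]] by (simp add: Z_def lmul_def)
  qed (use dilation_linear[OF r] dilation_bracket[OF r] Zd in auto)
  then show ?thesis using X \<eta> lmul_0[of X] by (simp add: Z_def)
qed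

text \<open>For \<open>r \<le> 1\<close> the point \<open>dil r (lmul X Y)\<close> stays in the ball
  where \<open>lg\<close> inverts \<open>E\<close>, so \<open>lg\<close> may be applied to
  \<open>E_dil_lmul\<close>.\<close>

lemma dil_lmul:
  assumes X: "norm X < \<eta>" and Y: "norm Y < \<eta>" and r: "0 < r" "r \<le> 1"
  shows "dil r (lmul X Y) = lmul (dil r X) (dil r Y)"
  using lg_E[OF \<eta>(4)[OF _ _ r], of X Y] E_dil_lmul[OF X Y r(1)] X Y \<eta>(1) by (simp add: lmul_def)

section \<open>The product on the whole Lie algebra\<close>

definition small :: "real \<Rightarrow> 'a \<Rightarrow> 'a \<Rightarrow> bool" where
  "small r X Y \<longleftrightarrow> 0 < r \<and> r \<le> 1 \<and> norm (dil r X) < \<eta> \<and> norm (dil r Y) < \<eta>"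

text \<open>Contract, multiply near the origin, expand. By \<open>mul_small_aux\<close>, which is
  \<open>dil_lmul\<close> for the ratio of two scales, every admissible \<open>r\<close> gives the
  same result.\<close>

definition mul :: "'a \<Rightarrow> 'a \<Rightarrow> 'a" where
  "mul X Y = (let r = SOME r. small r X Y in dil (1 / r) (lmul (dil r X) (dil r Y)))"

lemma mul_small_aux:
  assumes "small r X Y" "small s X Y" "s \<le> r"
  shows "dil (1 / s) (lmul (dil s X) (dil s Y)) = dil (1 / r) (lmul (dil r X) (dil r Y))"
proof -
  have rs: "0 < r" "0 < s" "0 < s / r" "s / r \<le> 1" using assms by (auto simp: small_def field_simps)
  have "lmul (dil s X) (dil s Y) = dil (s / r) (lmul (dil r X) (dil r Y))"
    using assms(1) rs by (subst dil_lmul) (auto simp: small_def dil_dil)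
  then show ?thesis using rs by (simp add: dil_dil)
qed

lemma mul_small:
  assumes "small r X Y"
  shows "mul X Y = dil (1 / r) (lmul (dil r X) (dil r Y))" "dil r (mul X Y) = lmul (dil r X) (dil r Y)"
proof -
  have "small (SOME r. small r X Y) X Y" using assms by (rule someI)
  then show "mul X Y = dil (1 / r) (lmul (dil r X) (dil r Y))"
    unfolding mul_def Let_def using mul_small_aux assms by (metis linorder_le_cases)
  then show "dil r (mul X Y) = lmul (dil r X) (dil r Y)"
    using assms by (simp add: small_def)
qed

lemma small_exists:
  assumes "finite F"
  obtains r where "0 < r" "r \<le> 1" "\<And>X. X \<in> F \<Longrightarrow> norm (dil r X) < \<eta>"
  using dil_small_exists[OF \<eta>(1) assms] by blast

text \<open>The expansion by \<open>1 / r\<close> passes through \<open>E\<close> by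
  \<open>E_dil_lmul\<close>, which for this purpose is available for factors above
  \<open>1\<close>.\<close>

lemma E_mul: "E (mul X Y) = E X + E Y"
proof -
  obtain r where r: "0 < r" "r \<le> 1" "\<And>Z. Z \<in> {X, Y} \<Longrightarrow> norm (dil r Z) < \<eta>" by (rule small_exists[of "{X, Y}"]) auto
  then have "E (mul X Y) = E (dil (1 / r) (dil r X)) + E (dil (1 / r) (dil r Y))"
    by (subst mul_small(1)[of r]) (auto simp: small_def E_dil_lmul)
  then show ?thesis using r by simp
qed

text \<open>At a common small scale \<open>t\<close> this is \<open>dil_lmul\<close>, directly for
  \<open>r \<le> 1\<close> and otherwise with \<open>1 / r\<close> in place of
  \<open>r\<close>.\<close>

lemma dil_mul: assumes r: "r > 0" shows "dil r (mul X Y) = mul (dil r X) (dil r Y)"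
proof -
  obtain t where t: "0 < t" "t \<le> 1" "\<And>Z. Z \<in> {X, Y, dil r X, dil r Y} \<Longrightarrow> norm (dil t Z) < \<eta>"
    by (rule small_exists[of "{X, Y, dil r X, dil r Y}"]) auto
  show ?thesis
  proof (cases "r \<le> 1")
    case True
    have "small t X Y" "small t (dil r X) (dil r Y)" using t by (auto simp: small_def)
    then have "dil t (dil r (mul X Y)) = dil t (mul (dil r X) (dil r Y))"
      using r True t(1) dil_lmul[of "dil t X" "dil t Y" r]
      by (simp add: mul_small(2) small_def dil_dil) (metis dil_dil mul_small(2) mult.commute \<open>small t X Y\<close>)
    then show ?thesis using t(1) dil_inverse(1) by metis
  next
    case False
    then have q: "0 < 1 / r" "1 / r \<le> 1" by auto
    have "small t X Y" "small t (dil r X) (dil r Y)" using t by (auto simp: small_def)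
    then have "dil (1 / r) (dil t (mul (dil r X) (dil r Y))) = lmul (dil (1 / r) (dil t (dil r X))) (dil (1 / r) (dil t (dil r Y)))"
      using dil_lmul[of "dil t (dil r X)" "dil t (dil r Y)" "1 / r"] q by (simp add: mul_small(2) small_def)
    also have "\<dots> = dil t (mul X Y)"
      using r t(1) \<open>small t X Y\<close> by (simp add: dil_dil mul_small(2))
    finally have "dil t (mul (dil r X) (dil r Y)) = dil t (dil r (mul X Y))"
      using r t(1) by (metis dil_dil dil_inverse(2) mult.commute)
    then show ?thesis using t(1) dil_inverse(1) by metis
  qed
qed

lemma mul_0_right: "mul X 0 = X"
proof -
  obtain r where r: "0 < r" "r \<le> 1" "\<And>Z. Z \<in> {X} \<Longrightarrow> norm (dil r Z) < \<eta>" by (rule small_exists[of "{X}"]) auto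
  then have "small r X 0" using \<eta>(1) by (simp add: small_def)
  then show ?thesis using r \<eta> by (simp add: mul_small(1) lmul_0)
qed

text \<open>At a scale that is small for \<open>X\<close>, \<open>Y\<close> and their product, both
  multiplications are \<open>lmul\<close>, and the cancellation takes place in the group.\<close>

lemma mul_minus_cancel_left: "mul (- X) (mul X Y) = Y"
proof -
  obtain r where r: "0 < r" "r \<le> 1" "\<And>Z. Z \<in> {X, Y, mul X Y} \<Longrightarrow> norm (dil r Z) < \<eta>"
    by (rule small_exists[of "{X, Y, mul X Y}"]) auto
  then have s: "small r X Y" "small r (- X) (mul X Y)" by (auto simp: small_def dil_minus)
  have "E (lmul (dil r X) (dil r Y)) = E (dil r X) + E (dil r Y)"
    unfolding lmul_def using r(3)[of X] r(3)[of Y] \<eta>(1) by (intro E_lg \<eta>(3)) auto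
  then have "lmul (dil r (- X)) (dil r (mul X Y)) = lg (E (dil r Y))"
    using r(1) by (simp add: mul_small(2)[OF s(1)] lmul_def[of "- dil r X"] dil_minus E_uminus add.assoc[symmetric])
  also have "\<dots> = dil r Y" using r(3)[of Y] \<eta>(1,2) by (intro lg_E) auto
  finally show ?thesis using r(1) by (simp add: mul_small(1)[OF s(2)])
qed

lemma mul_minus_cancel_right: "mul X (mul (- X) Y) = Y"
  using mul_minus_cancel_left[of "- X"] by simp

text \<open>A scale that is small at \<open>z\<close> is small near \<open>z\<close>, so locally the
  product is \<open>lmul\<close> between two linear maps.\<close>

lemma smooth_mul: "smooth_on UNIV (\<lambda>z. mul (fst z) (snd z))"
proof (rule smooth_on_local)
  fix z :: "'a \<times> 'a"
  obtain r where r: "0 < r" "r \<le> 1" "\<And>Z. Z \<in> {fst z, snd z} \<Longrightarrow> norm (dil r Z) < \<eta>"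
    by (rule small_exists[of "{fst z, snd z}"]) auto
  define T where "T = {w::'a\<times>'a. norm (dil r (fst w)) < \<eta>} \<inter> {w. norm (dil r (snd w)) < \<eta>}"
  note l1 = bounded_linear_compose[OF dil_bounded_linear[OF r(1)] bounded_linear_fst]
    and l2 = bounded_linear_compose[OF dil_bounded_linear[OF r(1)] bounded_linear_snd]
  have T: "open T"
    unfolding T_def
    by (intro open_Int open_Collect_less continuous_on_norm continuous_on_const
       linear_continuous_on l1 l2)
  have "smooth_on T (\<lambda>w. lmul (fst (dil r (fst w), dil r (snd w))) (snd (dil r (fst w), dil r (snd w))))"
    by (rule smooth_on_compose[OF T smooth_on_Pair[OF T smooth_on_linear[OF T l1] smooth_on_linear[OF T l2]] smooth_lmul(2)])
      (use \<eta>(1,3) in \<open>auto simp: T_def\<close>)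
  from smooth_on_bounded_linear[OF T dil_bounded_linear this, of "1 / r"]
  have "smooth_on T (\<lambda>w. dil (1 / r) (lmul (dil r (fst w)) (dil r (snd w))))" using r by simp
  then have "smooth_on T (\<lambda>w. mul (fst w) (snd w))"
    by (subst smooth_on_cong[OF T]) (use r in \<open>auto simp: T_def small_def intro!: mul_small(1)\<close>)
  then show "\<exists>T. open T \<and> z \<in> T \<and> smooth_on T (\<lambda>z. mul (fst z) (snd z))"
    using T r by (auto simp: T_def)
qed

lemma continuous_on_mul:
  assumes "continuous_on S f" "continuous_on S g"
  shows "continuous_on S (\<lambda>p. mul (f p) (g p))"
  using continuous_on_compose2[OF smooth_on_continuous_on[OF smooth_mul] continuous_on_Pair[OF assms]] by simp

text \<open>By \<open>E_mul\<close> the range is a subgroup, and it contains the open set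
  \<open>W\<close>; hence it and its complement are open, and the group is connected.\<close>

lemma surj_E: "surj E"
proof -
  have "open (range E)"
  proof (subst open_subopen, safe)
    fix X
    have "open ((\<lambda>x. - E X + x) -` W)"
      using open_preimage_continuous_on[OF open_UNIV _ open_W, of "\<lambda>x. - E X + x"] by (simp add: continuous_intros)
    moreover have "(\<lambda>x. - E X + x) -` W \<subseteq> range E"
    proof
      fix x assume "x \<in> (\<lambda>x. - E X + x) -` W"
      then obtain Y where "- E X + x = E Y" by auto
      then have "x = E (mul X Y)" by (metis E_mul add_minus_cancel minus_add_cancel)
      then show "x \<in> range E" by simp
    qed
    ultimately show "\<exists>T. open T \<and> E X \<in> T \<and> T \<subseteq> range E"
      using zero_in_W by (intro exI[of _ "(\<lambda>x. - E X + x) -` W"]) auto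
  qed
  moreover have "open (- range E)"
  proof (subst open_subopen, safe)
    fix x assume x: "x \<notin> range E"
    have "open ((\<lambda>y. - x + y) -` W)"
      using open_preimage_continuous_on[OF open_UNIV _ open_W, of "\<lambda>y. - x + y"] by (simp add: continuous_intros)
    moreover have "(\<lambda>y. - x + y) -` W \<subseteq> - range E"
    proof safe
      fix Y X assume "- x + E Y = E X"
      then have "x = E Y + - E X" by (metis add.assoc add.right_neutral add_minus_cancel minus_add_cancel right_minus)
      then have "x = E (mul Y (- X))" by (simp add: E_mul E_uminus)
      then show False using x by simp
    qed
    ultimately show "\<exists>T. open T \<and> x \<in> T \<and> T \<subseteq> - range E"
      using zero_in_W by (intro exI[of _ "(\<lambda>y. - x + y) -` W"]) auto
  qed
  ultimately show ?thesis
    using connectedD[OF connected_group, of "range E" "- range E"] by auto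
qed

text \<open>The quotient \<open>w\<close> of two lifts takes values in the kernel of
  \<open>E\<close>, which meets the ball of radius \<open>e\<close> in \<open>0\<close>
  only.\<close>

lemma lift_unique:
  fixes a b :: "'p::topological_space \<Rightarrow> 'a"
  assumes S: "connected S" and ab: "continuous_on S a" "continuous_on S b" and E: "\<And>t. t \<in> S \<Longrightarrow> E (a t) = E (b t)"
    and s: "s \<in> S" "a s = b s" and t: "t \<in> S"
  shows "a t = b t"
proof -
  define w where "w = (\<lambda>t. mul (- a t) (b t))"
  have w0: "w t = 0 \<longleftrightarrow> a t = b t" if "t \<in> S" for t
    using mul_minus_cancel_right[of "a t" "b t"] mul_0_right[of "a t"] mul_minus_cancel_left[of "a t" 0]
    by (auto simp: w_def)
  have Ew: "E (w t) = 0" if "t \<in> S" for t using E[OF that] by (simp add: w_def E_mul E_uminus)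
  have "connected ((\<lambda>t. norm (w t)) ` S)"
    unfolding w_def by (intro connected_continuous_image S continuous_on_norm continuous_on_mul continuous_on_minus ab)
  moreover have "norm (w s) = 0" using s w0 by simp
  \<comment> \<open>The norm of \<open>w\<close> starts at \<open>0\<close> and would have to pass
    the value \<open>e / 2\<close> before growing.\<close>
  moreover have "e / 2 \<notin> (\<lambda>t. norm (w t)) ` S"
  proof
    assume "e / 2 \<in> (\<lambda>t. norm (w t)) ` S"
    then obtain t where t: "t \<in> S" "norm (w t) = e / 2" by auto
    then have "w t = 0" using lg_E[of "w t"] Ew[OF t(1)] lg_0 e_pos by simp
    then show False using t e_pos by simp
  qed
  ultimately have "norm (w t) < e / 2"
    using connectedD_interval[of "(\<lambda>t. norm (w t)) ` S" 0 "norm (w t)" "e / 2"] s(1) t e_pos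
    by (metis image_eqI linorder_not_less less_imp_le half_gt_zero)
  then have "w t = 0" using lg_E[of "w t"] Ew[OF t] lg_0 e_pos by simp
  then show ?thesis using w0[OF t] by simp
qed

text \<open>The lift is a product of small steps along the rays from the origin.\<close>

lemma lift_exists:
  fixes h :: "'p::real_normed_vector \<Rightarrow> 'g"
  assumes K: "compact K" and star: "\<And>p t. p \<in> K \<Longrightarrow> 0 \<le> t \<Longrightarrow> t \<le> 1 \<Longrightarrow> t *\<^sub>R p \<in> K" and h: "continuous_on K h"
  obtains k where "continuous_on K k" "\<And>p. p \<in> K \<Longrightarrow> E (k p) = h p"
proof -
  let ?K = "K \<times> {0..1::real} \<times> {0..1::real}"
  have K3: "compact ?K" by (intro compact_Times K compact_Icc)
  define g where "g = (\<lambda>z::'p\<times>real\<times>real. - h (fst (snd z) *\<^sub>R fst z) + h (snd (snd z) *\<^sub>R fst z))"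
  have g: "continuous_on ?K g"
    unfolding g_def by (intro continuous_intros continuous_on_compose2[OF h]) (auto intro: star)
  \<comment> \<open>The triples \<open>(p, s, t)\<close> for which the increment of \<open>h\<close>
    from \<open>s p\<close> to \<open>t p\<close> leaves \<open>W\<close>. This set is compact and
    contains no triple with \<open>s = t\<close>, so \<open>|s - t|\<close> is bounded below on it:
    uniform continuity without a metric on the group.\<close>
  define Z where "Z = ?K \<inter> g -` (- W)"
  have "closedin (top_of_set ?K) Z"
    unfolding Z_def by (rule continuous_closedin_preimage[OF g]) (use open_W in auto)
  then have Z: "compact Z" by (rule closedin_compact[OF K3])
  have "\<exists>m>0. \<forall>z\<in>Z. m \<le> \<bar>fst (snd z) - snd (snd z)\<bar>"
  proof (cases "Z = {}")
    case False
    have "continuous_on Z (\<lambda>z. \<bar>fst (snd z) - snd (snd z)\<bar>)" by (intro continuous_intros)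
    then obtain z where z: "z \<in> Z" "\<forall>y\<in>Z. \<bar>fst (snd z) - snd (snd z)\<bar> \<le> \<bar>fst (snd y) - snd (snd y)\<bar>"
      using continuous_attains_inf[OF Z False] by blast
    have "fst (snd z) \<noteq> snd (snd z)" using z(1) zero_in_W by (auto simp: Z_def g_def)
    then show ?thesis using z by (intro exI[of _ "\<bar>fst (snd z) - snd (snd z)\<bar>"]) auto
  qed (auto intro: exI[of _ 1])
  then obtain m where m: "m > 0" "\<And>z. z \<in> Z \<Longrightarrow> m \<le> \<bar>fst (snd z) - snd (snd z)\<bar>" by blast
  obtain n where n: "n > 0" "1 / real n < m"
    using real_arch_inverse[of m] m(1) by (auto simp: inverse_eq_divide)
  define st where "st = (\<lambda>i p. - h ((real i / n) *\<^sub>R p) + h ((real (Suc i) / n) *\<^sub>R p))"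
  have inK: "(real i / n) *\<^sub>R p \<in> K" if "p \<in> K" "i \<le> n" for i p
    using that n by (intro star) auto
  have stW: "st i p \<in> W" if p: "p \<in> K" and i: "i < n" for i p
  proof (rule ccontr)
    assume "st i p \<notin> W"
    then have "(p, real i / n, real (Suc i) / n) \<in> Z"
      using p i n by (auto simp: Z_def g_def st_def)
    from m(2)[OF this] have "m \<le> 1 / n" using n by (simp add: field_simps)
    then show False using n by simp
  qed
  have lgc: "continuous_on W lg" using lg_homeo by (simp add: homeomorphism_def)
  obtain X0 where X0: "E X0 = h 0" using surj_E by (metis surj_def)
  have "\<exists>k. continuous_on K k \<and> (\<forall>p\<in>K. E (k p) = h ((real i / n) *\<^sub>R p))" if "i \<le> n" for i
    using that
  proof (induction i)
    case 0
    show ?case by (rule exI[of _ "\<lambda>_. X0"]) (simp add: X0)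
  next
    case (Suc i)
    then obtain k where k: "continuous_on K k" "\<forall>p\<in>K. E (k p) = h ((real i / n) *\<^sub>R p)" by auto
    have "continuous_on K (\<lambda>p. mul (k p) (lg (st i p)))"
    proof (intro continuous_on_mul k continuous_on_compose2[OF lgc])
      show "continuous_on K (st i)"
        unfolding st_def using inK[of _ i] inK[of _ "Suc i"] Suc.prems
        by (intro continuous_intros continuous_on_compose2[OF h]) auto
    qed (use stW Suc.prems in auto)
    moreover have "E (mul (k p) (lg (st i p))) = h ((real (Suc i) / n) *\<^sub>R p)" if "p \<in> K" for p
      using k(2) that stW[OF that, of i] Suc.prems by (simp add: E_mul E_lg) (simp add: st_def)
    ultimately show ?case by blast
  qed
  from this[of n] n show ?thesis using that by auto
qed

text \<open>Monodromy: the segment from \<open>X1\<close> to \<open>X2\<close> maps to a loop, and a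
  null homotopy of that loop is lifted. The lift is constant along the constant edge and agrees
  along the two sides, so the lifted loop is closed.\<close>

lemma inj_E: "inj E"
proof (rule injI)
  fix X1 X2 assume eq: "E X1 = E X2"
  define c where "c = (\<lambda>t::real. (1 - t) *\<^sub>R X1 + t *\<^sub>R X2)"
  have cc: "continuous_on S c" for S unfolding c_def by (intro continuous_intros)
  have "path (E \<circ> c)" unfolding path_def by (intro continuous_on_compose cc continuous_on_E)
  moreover have "pathfinish (E \<circ> c) = pathstart (E \<circ> c)" using eq by (simp add: pathfinish_def pathstart_def c_def)
  ultimately have "homotopic_loops UNIV (E \<circ> c) (\<lambda>_. E X1)"
    using simply_connected_group unfolding simply_connected_def
    by (auto simp: path_def pathfinish_def pathstart_def)
  then obtain h where h: "continuous_on ({0..1::real} \<times> {0..1::real}) h"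
    "\<forall>x\<in>{0..1}. h (0, x) = (E \<circ> c) x" "\<forall>x\<in>{0..1}. h (1, x) = E X1"
    "\<forall>t\<in>{0..1}. pathfinish (h \<circ> Pair t) = pathstart (h \<circ> Pair t)"
    unfolding homotopic_loops by blast
  let ?K = "{0..1::real} \<times> {0..1::real}"
  have star: "t *\<^sub>R p \<in> ?K" if "p \<in> ?K" "0 \<le> t" "t \<le> 1" for p t
    using that by (auto simp: mult_le_one)
  obtain k where k: "continuous_on ?K k" "\<And>p. p \<in> ?K \<Longrightarrow> E (k p) = h p"
    using lift_exists[OF compact_Times[OF compact_Icc compact_Icc] star h(1)] by blast
  have kc: "continuous_on {0..1} (\<lambda>t. k (f t))" if "continuous_on {0..1::real} f" "f ` {0..1} \<subseteq> ?K" for f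
    using continuous_on_compose2[OF k(1) that] .
  have c1: "continuous_on {0..1} (\<lambda>t. k (1, t))" "continuous_on {0..1} (\<lambda>t. k (0, t))"
    "continuous_on {0..1} (\<lambda>t. k (t, 0))" "continuous_on {0..1} (\<lambda>t. k (t, 1))"
    by (rule kc; force intro!: continuous_intros)+
  have con: "connected {0..1::real}" by simp
  have "k (1, 1) = k (1, 0)"
    by (rule lift_unique[where a = "\<lambda>t. k (1, t)" and b = "\<lambda>t. k (1, 0)" and s = 0, OF con c1(1) continuous_on_const])
      (use k(2) h(3) in auto)
  moreover have h01: "h (t, 1) = h (t, 0)" if "t \<in> {0..1}" for t
    using h(4) that by (auto simp: pathfinish_def pathstart_def)
  ultimately have kk: "k (0, 1) = k (0, 0)"
    by (intro lift_unique[where a = "\<lambda>t. k (t, 1)" and b = "\<lambda>t. k (t, 0)" and s = 1 and t = 0, OF con c1(4,3)])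
      (auto simp: k(2) h01)
  \<comment> \<open>The segment and the edge of the lifted homotopy lie over the same loop but may
    start at different points; their quotient lies in the kernel of \<open>E\<close>, hence is
    constant.\<close>
  define d where "d = (\<lambda>t. mul (- k (0, t)) (c t))"
  have d0: "E (d t) = 0" if "t \<in> {0..1}" for t
    using k(2)[of "(0, t)"] h(2) that by (simp add: d_def E_mul E_uminus)
  have "continuous_on {0..1} d"
    unfolding d_def by (intro continuous_on_mul continuous_on_minus c1 cc)
  then have "d 1 = d 0"
    by (rule lift_unique[where a = d and b = "\<lambda>t. d 0" and s = 0, OF con _ continuous_on_const]) (auto simp: d0)
  then have "mul (- k (0, 0)) X2 = mul (- k (0, 0)) X1" by (simp add: d_def kk c_def)
  then show "X1 = X2" using mul_minus_cancel_right by metis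
qed

text \<open>Near \<open>p\<close> the inverse of \<open>E\<close> is the local logarithm translated
  by a fixed \<open>X\<close>: \<open>inv E (c q) = mul X (lg (- c p + c q))\<close>.\<close>

lemma inv_E_smooth:
  fixes c :: "'p::euclidean_space \<Rightarrow> 'g"
  assumes S: "open S" and c: "smooth_map S c"
  shows "smooth_on S (\<lambda>p. inv E (c p))"
proof (rule smooth_on_local)
  fix p assume p: "p \<in> S"
  define X where "X = inv E (c p)"
  have X: "E X = c p" unfolding X_def using surj_E by (rule surj_f_inv_f)
  let ?T = "S \<inter> (\<lambda>q. - c p + c q) -` W"
  note T = smooth_lg[OF S smooth_map_translate[OF S c, of "- c p"]]
  have sm: "smooth_on ?T (\<lambda>q. mul (fst (X, lg (- c p + c q))) (snd (X, lg (- c p + c q))))"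
    by (rule smooth_on_compose[OF T(1) smooth_on_Pair[OF T(1) smooth_on_const[OF T(1)] T(2)] smooth_mul]) auto
  have "inv E (c q) = mul X (lg (- c p + c q))" if q: "q \<in> ?T" for q
  proof -
    have "E (mul X (lg (- c p + c q))) = c p + (- c p + c q)"
      using q by (simp only: E_mul X E_lg Int_iff vimage_eq)
    then have "E (mul X (lg (- c p + c q))) = c q" by simp
    then show ?thesis by (metis inj_E inv_f_f)
  qed
  then have "smooth_on ?T (\<lambda>q. inv E (c q))"
    using sm by (subst smooth_on_cong[OF T(1)]) auto
  then show "\<exists>T. open T \<and> p \<in> T \<and> smooth_on T (\<lambda>p. inv E (c p))"
    using T(1) p zero_in_W by (intro exI[of _ ?T]) auto
qed

lemma inv_E_mul: "inv E (E X + E Y) = mul X Y"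
  using inj_E by (simp add: E_mul[symmetric])

end

context homogeneous_group
begin

lemma homogeneous_exp_chart_exists: obtains e lg where "homogeneous_exp_chart \<A> E bracket A e lg"
proof -
  obtain e lg where "e > 0" "open (E ` ball 0 e)" "homeomorphism (ball 0 e) (E ` ball 0 e) E lg"
    "smooth_from_on (E ` ball 0 e) lg"
    by (rule exp_chart_exists)
  then have "homogeneous_exp_chart \<A> E bracket A e lg"
    by (intro homogeneous_exp_chart.intro exp_chart.intro exp_chart_axioms.intro
        homogeneous_group_axioms lie_group_with_algebra_axioms)
  then show ?thesis by (rule that)
qed

text \<open>The product \<open>mul\<close> again, in a form that does not mention the chosen
  logarithm.\<close>

definition gmul :: "'a \<Rightarrow> 'a \<Rightarrow> 'a" where
  "gmul X Y = inv E (E X + E Y)"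

lemma bij_E: "bij E"
proof -
  obtain e lg where "homogeneous_exp_chart \<A> E bracket A e lg" by (rule homogeneous_exp_chart_exists)
  then interpret homogeneous_exp_chart \<A> E bracket A e lg .
  show ?thesis using inj_E surj_E by (simp add: bij_def)
qed

lemma smooth_inv_E:
  fixes c :: "'p::euclidean_space \<Rightarrow> 'g"
  assumes "open S" "smooth_map S c"
  shows "smooth_on S (\<lambda>p. inv E (c p))"
proof -
  obtain e lg where "homogeneous_exp_chart \<A> E bracket A e lg" by (rule homogeneous_exp_chart_exists)
  then interpret homogeneous_exp_chart \<A> E bracket A e lg .
  show ?thesis by (rule inv_E_smooth[OF assms])
qed

lemma dil_gmul: "r > 0 \<Longrightarrow> dil r (gmul X Y) = gmul (dil r X) (dil r Y)"
proof -
  obtain e lg where "homogeneous_exp_chart \<A> E bracket A e lg" by (rule homogeneous_exp_chart_exists)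
  then interpret homogeneous_exp_chart \<A> E bracket A e lg .
  show "r > 0 \<Longrightarrow> dil r (gmul X Y) = gmul (dil r X) (dil r Y)"
    by (simp add: gmul_def inv_E_mul dil_mul)
qed

lemma smooth_gmul: "smooth_on UNIV (\<lambda>z. gmul (fst z) (snd z))"
proof -
  obtain e lg where "homogeneous_exp_chart \<A> E bracket A e lg" by (rule homogeneous_exp_chart_exists)
  then interpret homogeneous_exp_chart \<A> E bracket A e lg .
  show ?thesis using smooth_mul by (simp add: gmul_def inv_E_mul)
qed

end

section \<open>Change of variables with constant Jacobian\<close>

text \<open>The change of variables formula of the library is stated for \<open>real ^ 'n\<close>; this index type
  of cardinality \<open>DIM('a)\<close> transfers it to an arbitrary Euclidean space.\<close>

typedef (overloaded) ('a::euclidean_space) dim_index = "{..<DIM('a)}"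
  by (rule exI[of _ 0]) simp

instance dim_index :: (euclidean_space) finite
proof
  have "inj (Rep_dim_index :: 'a dim_index \<Rightarrow> nat)" by (simp add: Rep_dim_index_inject inj_def)
  moreover have "finite (range (Rep_dim_index :: 'a dim_index \<Rightarrow> nat))"
    by (rule finite_subset[of _ "{..<DIM('a)}"]) (use Rep_dim_index in auto)
  ultimately show "finite (UNIV :: 'a dim_index set)" by (rule finite_imageD[rotated])
qed

text \<open>The change of variables theorem for \<open>real ^ 'n\<close> asks for a well-ordered
  index type; the order is that of \<open>nat\<close>.\<close>

instantiation dim_index :: (euclidean_space) wellorder
begin

definition less_eq_dim_index :: "'a dim_index \<Rightarrow> 'a dim_index \<Rightarrow> bool" where
  "less_eq_dim_index i j \<longleftrightarrow> Rep_dim_index i \<le> Rep_dim_index j"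

definition less_dim_index :: "'a dim_index \<Rightarrow> 'a dim_index \<Rightarrow> bool" where
  "less_dim_index i j \<longleftrightarrow> Rep_dim_index i < Rep_dim_index j"

instance
proof
  fix P :: "'a dim_index \<Rightarrow> bool" and a
  assume *: "\<And>x. (\<And>y. y < x \<Longrightarrow> P y) \<Longrightarrow> P x"
  show "P a"
    by (induction a rule: measure_induct_rule[of Rep_dim_index]) (use * in \<open>auto simp: less_dim_index_def\<close>)
qed (auto simp: less_eq_dim_index_def less_dim_index_def Rep_dim_index_inject)

end

lemma card_dim_index: "CARD('a::euclidean_space dim_index) = DIM('a)"
proof -
  interpret type_definition "Rep_dim_index :: 'a dim_index \<Rightarrow> nat" Abs_dim_index "{..<DIM('a)}"
    by (rule type_definition_dim_index)
  show ?thesis using card by simp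
qed

definition dim_basis :: "'a::euclidean_space dim_index \<Rightarrow> 'a" where
  "dim_basis = (SOME b. bij_betw b UNIV Basis)"

lemma bij_dim_basis: "bij_betw (dim_basis :: 'a::euclidean_space dim_index \<Rightarrow> 'a) UNIV Basis"
proof -
  have "\<exists>b. bij_betw b (UNIV :: 'a dim_index set) (Basis :: 'a set)"
    by (rule finite_same_card_bij) (simp_all add: card_dim_index)
  then show ?thesis unfolding dim_basis_def by (rule someI_ex)
qed

lemma sum_dim_basis: "(\<Sum>i\<in>UNIV. f (dim_basis i)) = sum f Basis"
  using sum.reindex_bij_betw[OF bij_dim_basis] .

lemma prod_dim_basis: "(\<Prod>i\<in>UNIV. f (dim_basis i)) = prod f Basis"
  using prod.reindex_bij_betw[OF bij_dim_basis] .

lemma dim_basis_in: "dim_basis i \<in> Basis"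
  using bij_dim_basis by (auto simp: bij_betw_def)

lemma dim_basis_inner: "dim_basis i \<bullet> dim_basis j = (if i = j then 1 else 0)"
  using bij_dim_basis inner_Basis[OF dim_basis_in dim_basis_in, of i j] by (auto simp: bij_betw_def inj_on_def)

definition to_vec :: "'a::euclidean_space \<Rightarrow> real ^ 'a dim_index" where
  "to_vec X = (\<chi> i. X \<bullet> dim_basis i)"

definition of_vec :: "real ^ 'a dim_index \<Rightarrow> 'a::euclidean_space" where
  "of_vec v = (\<Sum>i\<in>UNIV. v $ i *\<^sub>R dim_basis i)"

lemma of_vec_to_vec [simp]: "of_vec (to_vec X) = X"
  using sum_dim_basis[of "\<lambda>b. (X \<bullet> b) *\<^sub>R b"] by (simp add: of_vec_def to_vec_def euclidean_representation)

lemma to_vec_of_vec [simp]: "to_vec (of_vec v) = v"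
  by (simp add: vec_eq_iff to_vec_def of_vec_def inner_sum_left dim_basis_inner if_distrib cong: if_cong)

lemma to_vec_image: "to_vec ` S = of_vec -` S"
proof (intro set_eqI iffI)
  fix v assume "v \<in> of_vec -` S"
  then show "v \<in> to_vec ` S" using image_eqI[of v to_vec "of_vec v" S] by simp
qed auto

lemma of_vec_axis: "of_vec (axis j 1) = dim_basis j"
  by (simp add: of_vec_def axis_def if_distrib[of "\<lambda>x. x *\<^sub>R _"] cong: if_cong)

lemma to_vec_linear: "bounded_linear to_vec"
  unfolding linear_conv_bounded_linear[symmetric]
  by (rule linearI) (simp_all add: to_vec_def vec_eq_iff inner_add_left)

lemma of_vec_linear: "bounded_linear of_vec"
  unfolding linear_conv_bounded_linear[symmetric]
  by (rule linearI) (simp_all add: of_vec_def scaleR_add_left sum.distrib scaleR_sum_right)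

lemma of_vec_inner: "of_vec v \<bullet> dim_basis i = v $ i"
  using to_vec_of_vec[of v] by (metis to_vec_def vec_lambda_beta)

lemma ball_Basis_dim_basis: "(\<forall>b\<in>Basis. P b) \<longleftrightarrow> (\<forall>i. P (dim_basis i))"
  using bij_dim_basis by (auto simp: bij_betw_def) (metis imageE)

lemma to_vec_box: "to_vec -` box l u = box (of_vec l) (of_vec u)"
  by (auto simp: mem_box_cart mem_box ball_Basis_dim_basis of_vec_inner to_vec_def)

lemma measurable_to_vec [measurable]: "to_vec \<in> borel_measurable borel"
  by (intro borel_measurable_continuous_onI linear_continuous_on to_vec_linear)

lemma measurable_of_vec [measurable]: "of_vec \<in> borel_measurable borel"
  by (intro borel_measurable_continuous_onI linear_continuous_on of_vec_linear)

text \<open>Boxes correspond to boxes with the same side lengths, and these determine Lebesgue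
  measure.\<close>

lemma lborel_to_vec: "lborel = distr lborel borel (to_vec :: 'a::euclidean_space \<Rightarrow> _)"
proof (rule lborel_eqI)
  fix l u :: "real ^ 'a dim_index"
  assume lu: "\<And>b. b \<in> Basis \<Longrightarrow> l \<bullet> b \<le> u \<bullet> b"
  have le: "l $ i \<le> u $ i" for i using lu[of "axis i 1"] by (simp add: inner_axis axis_in_Basis_iff)
  have Bv: "(Basis :: (real ^ 'a dim_index) set) = range (\<lambda>i. axis i 1)"
    by (auto simp: Basis_vec_def)
  have inj: "inj (\<lambda>i::'a dim_index. axis i (1::real))" by (auto simp: inj_def axis_eq_axis)
  have lu': "\<forall>b\<in>Basis. (of_vec l :: 'a) \<bullet> b \<le> of_vec u \<bullet> b" by (simp add: ball_Basis_dim_basis of_vec_inner le)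
  have "emeasure (distr lborel borel to_vec) (box l u) = emeasure lborel (box (of_vec l :: 'a) (of_vec u))"
    by (subst emeasure_distr) (auto simp: to_vec_box)
  also have "\<dots> = (\<Prod>b\<in>Basis. (of_vec u - of_vec l :: 'a) \<bullet> b)"
    using lu' by (subst emeasure_lborel_box) auto
  also have "(\<Prod>b\<in>Basis. (of_vec u - of_vec l :: 'a) \<bullet> b) = (\<Prod>i\<in>UNIV. (u - l) $ i)"
    unfolding prod_dim_basis[symmetric] by (simp add: inner_diff_left of_vec_inner)
  also have "\<dots> = (\<Prod>b\<in>Basis. (u - l) \<bullet> b)"
    unfolding Bv by (subst prod.reindex[OF inj]) (simp add: inner_axis)
  finally show "emeasure (distr lborel borel (to_vec :: 'a \<Rightarrow> _)) (box l u) = (\<Prod>b\<in>Basis. (u - l) \<bullet> b)" .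
qed simp

lemma emeasure_to_vec:
  fixes V :: "(real ^ 'a::euclidean_space dim_index) set"
  assumes "V \<in> sets borel"
  shows "emeasure lborel (to_vec -` V :: 'a set) = emeasure lborel V"
proof -
  have "emeasure (distr lborel borel (to_vec :: 'a \<Rightarrow> _)) V = emeasure lborel (to_vec -` V \<inter> space (lborel :: 'a measure))"
    by (rule emeasure_distr) (use assms in auto)
  then show ?thesis unfolding lborel_to_vec[symmetric] by simp
qed

definition ematrix :: "('a::euclidean_space \<Rightarrow> 'a) \<Rightarrow> real ^ 'a dim_index ^ 'a dim_index" where
  "ematrix T = (\<chi> i j. T (dim_basis j) \<bullet> dim_basis i)"

lemma ematrix_compose:
  assumes "bounded_linear T"
  shows "ematrix (\<lambda>X. T (S X)) = ematrix T ** ematrix S"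
proof -
  have "T (S (dim_basis j)) \<bullet> dim_basis i
      = (\<Sum>k\<in>UNIV. (T (dim_basis k) \<bullet> dim_basis i) * (S (dim_basis j) \<bullet> dim_basis k))" for i j
    by (subst bounded_linear_euclidean_expand[OF assms, of "S (dim_basis j)"])
      (simp add: inner_sum_left sum_dim_basis[symmetric, of "\<lambda>b. (S (dim_basis j) \<bullet> b) *\<^sub>R T b"] mult.commute)
  then show ?thesis by (simp add: vec_eq_iff ematrix_def matrix_matrix_mult_def)
qed

lemma ematrix_ident: "ematrix (\<lambda>X. X) = mat 1"
  by (simp add: ematrix_def mat_def vec_eq_iff dim_basis_inner)

lemma trace_ematrix: "trace (ematrix T) = operator_trace T"
  by (simp add: trace_def ematrix_def operator_trace_def sum_dim_basis[of "\<lambda>b. T b \<bullet> b"])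

lemma continuous_on_det:
  fixes M :: "'p::topological_space \<Rightarrow> real ^ 'n ^ 'n"
  assumes "\<And>i j. continuous_on S (\<lambda>p. M p $ i $ j)"
  shows "continuous_on S (\<lambda>p. det (M p))"
  unfolding det_def by (intro continuous_intros assms)

text \<open>For a box \<open>B\<close> the preimage of \<open>B\<close> under \<open>g\<close> is
  the image under \<open>f\<close>, whose measure is \<open>c\<close> times that of \<open>B\<close>
  by the change of variables formula.\<close>

lemma distr_constant_jacobian:
  fixes f g :: "'a::euclidean_space \<Rightarrow> 'a"
  assumes f': "\<And>x. (f has_derivative f' x) (at x)" and g: "continuous_on UNIV g"
    and fg: "\<And>x. f (g x) = x" and gf: "\<And>x. g (f x) = x"
    and det: "\<And>x. \<bar>det (ematrix (f' x))\<bar> = c" and c: "c > 0"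
  shows "distr lborel borel g = density lborel (\<lambda>_. ennreal c)"
proof -
  have gm [measurable]: "g \<in> borel_measurable borel" using g by (rule borel_measurable_continuous_onI)
  define F where "F = (\<lambda>v. to_vec (f (of_vec v)))"
  define F' where "F' = (\<lambda>v w. to_vec (f' (of_vec v) (of_vec w)))"
  have F': "(F has_derivative F' v) (at v)" for v
    unfolding F_def F'_def
    by (rule bounded_linear.has_derivative[OF to_vec_linear])
      (rule has_derivative_compose[OF bounded_linear.has_derivative[OF of_vec_linear has_derivative_ident] f'])
  have "matrix (F' v) = ematrix (f' (of_vec v))" for v
    by (simp add: matrix_def ematrix_def F'_def of_vec_axis to_vec_def)
  then have detF: "\<bar>det (matrix (F' v))\<bar> = c" for v using det by simp
  have inj: "inj_on F S" for S
    unfolding F_def inj_on_def by (metis gf of_vec_to_vec to_vec_of_vec)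
  have "emeasure (distr lborel borel g) (box l u) = ennreal c * emeasure lborel (box l u)" for l u
  proof -
    let ?B = "box l u"
    have S: "to_vec ` ?B = of_vec -` ?B" by (rule to_vec_image)
    have SB [measurable]: "of_vec -` ?B \<in> sets borel" using measurable_sets[OF measurable_of_vec, of ?B] by simp
    have mS: "emeasure lborel (to_vec ` ?B) = emeasure lborel ?B"
      unfolding S emeasure_to_vec[OF SB, symmetric] by (simp add: vimage_def)
    have Slm: "to_vec ` ?B \<in> lmeasurable"
      using mS emeasure_lborel_box_finite[of l u] SB unfolding S
      by (auto simp: fmeasurable_def less_top)
    have int: "((\<lambda>v. \<bar>det (matrix (F' v))\<bar>) has_integral c * measure lebesgue (to_vec ` ?B)) (to_vec ` ?B)"
    proof -
      have "((\<lambda>_. 1::real) has_integral measure lebesgue (to_vec ` ?B)) (to_vec ` ?B)"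
        using Slm by (simp add: has_integral_iff lmeasurable_iff_integrable_on lmeasure_integral)
      from has_integral_mult_right[OF this, of c] show ?thesis by (simp add: detF)
    qed
    have FS: "F ` (to_vec ` ?B) \<in> lmeasurable \<and> measure lebesgue (F ` (to_vec ` ?B)) = c * measure lebesgue (to_vec ` ?B)"
      using has_measure_differentiable_image[OF fmeasurableD[OF Slm] has_derivative_at_withinI[OF F'] inj, of "c * measure lebesgue (to_vec ` ?B)"] int
      by blast
    have im: "F ` (to_vec ` ?B) = to_vec ` (g -` ?B)"
    proof -
      have "f ` ?B = g -` ?B" using fg gf by (force intro: image_eqI[where f = f and x = "g _"])
      moreover have "F ` (to_vec ` ?B) = to_vec ` (f ` ?B)" by (simp add: F_def image_image)
      ultimately show ?thesis by simp
    qed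
    have im2: "to_vec ` (g -` ?B) = of_vec -` (g -` ?B)" by (rule to_vec_image)
    have gB: "g -` ?B \<in> sets borel" using measurable_sets[OF gm, of ?B] by simp
    have gB2: "of_vec -` (g -` ?B) \<in> sets borel" using measurable_sets[OF measurable_of_vec gB] by simp
    have "emeasure (distr lborel borel g) ?B = emeasure lborel (g -` ?B)" by (subst emeasure_distr) auto
    also have "\<dots> = emeasure lborel (to_vec -` (of_vec -` (g -` ?B)) \<inter> space lborel)" by (simp add: vimage_def)
    also have "\<dots> = emeasure lborel (of_vec -` (g -` ?B))"
      using emeasure_to_vec[OF gB2] by simp
    also have "\<dots> = emeasure lebesgue (F ` (to_vec ` ?B))" unfolding im im2 using gB2 by simp
    also have "\<dots> = ennreal (c * measure lebesgue (to_vec ` ?B))"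
      using FS by (subst emeasure_eq_measure2) auto
    also have "\<dots> = ennreal c * emeasure lebesgue (to_vec ` ?B)"
      using c Slm by (subst emeasure_eq_measure2[OF Slm]) (simp add: ennreal_mult)
    also have "\<dots> = ennreal c * emeasure lborel ?B"
      using mS SB unfolding S by simp
    finally show ?thesis .
  qed note box = this
  \<comment> \<open>Rescaled by \<open>1 / c\<close>, because boxes characterise Lebesgue measure
    itself and not its multiples.\<close>
  define M where "M = density (distr lborel borel g) (\<lambda>_. ennreal (1 / c))"
  have "lborel = M"
  proof (rule lborel_eqI)
    fix l u :: 'a assume lu: "\<And>b. b \<in> Basis \<Longrightarrow> l \<bullet> b \<le> u \<bullet> b"
    have "emeasure M (box l u) = ennreal (1 / c) * emeasure (distr lborel borel g) (box l u)"
      unfolding M_def by (subst emeasure_density_const) auto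
    also have "\<dots> = ennreal (1 / c * c) * emeasure lborel (box l u)"
      using c unfolding box by (subst ennreal_mult) (simp_all add: mult.assoc)
    also have "\<dots> = (\<Prod>b\<in>Basis. (u - l) \<bullet> b)"
      using c lu by (simp add: emeasure_lborel_box)
    finally show "emeasure M (box l u) = (\<Prod>b\<in>Basis. (u - l) \<bullet> b)" .
  qed (simp add: M_def)
  then have "density lborel (\<lambda>_. ennreal c) = density M (\<lambda>_. ennreal c)" by simp
  also have "\<dots> = density (distr lborel borel g) (\<lambda>_. ennreal (1 / c) * ennreal c)"
    unfolding M_def by (rule density_density_eq) auto
  also have "(\<lambda>_. ennreal (1 / c) * ennreal c) = (\<lambda>_. 1)"
    using c by (simp add: ennreal_mult[symmetric])
  finally show ?thesis by (simp add: density_1)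
qed

section \<open>Haar measure in exponential coordinates\<close>

context homogeneous_group
begin

lemma E_inv_E: "E (inv E x) = x"
  using bij_E by (simp add: bij_is_surj surj_f_inv_f)

lemma inv_E_E: "inv E (E X) = X"
  using bij_E by (simp add: bij_is_inj)

lemma continuous_on_inv_E: "continuous_on S (inv E)"
proof -
  have "open (inv E -` U)" if U: "open U" for U
  proof (subst open_subopen, safe)
    fix x assume x: "inv E x \<in> U"
    obtain V \<phi> where V: "(V, \<phi>) \<in> \<A>" "x \<in> V" by (rule chart_exists)
    have "continuous_on (\<phi> ` V) (\<lambda>p. inv E (inv_into V \<phi> p))"
      by (intro smooth_on_continuous_on smooth_inv_E chart(2)[OF V(1)] smooth_map_inv_chart V)
    then have "continuous_on V (\<lambda>x. inv E (inv_into V \<phi> (\<phi> x)))"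
      by (rule continuous_on_compose2) (use chart(3)[OF V(1)] in \<open>auto simp: homeomorphism_def\<close>)
    then have "continuous_on V (inv E)"
      by (rule continuous_on_eq) (simp add: chart_inv_into[OF V(1)])
    then show "\<exists>T. open T \<and> x \<in> T \<and> T \<subseteq> inv E -` U"
      using open_preimage_continuous_on[OF chart(1)[OF V(1)] _ U] V x
      by (intro exI[of _ "V \<inter> inv E -` U"]) auto
  qed
  then have "continuous_on UNIV (inv E)" by (simp add: continuous_on_open_vimage)
  then show ?thesis by (rule continuous_on_subset) simp
qed

lemma E_gmul: "E (gmul X Y) = E X + E Y"
  by (simp add: gmul_def E_inv_E)

lemma gmul_0_left: "gmul 0 Y = Y" and gmul_0_right: "gmul X 0 = X"
  by (simp_all add: gmul_def E_0 inv_E_E)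

lemma gmul_cancel:
  "gmul (- X) (gmul X Y) = Y" "gmul X (gmul (- X) Y) = Y" "gmul (gmul X Y) (- Y) = X" "gmul (gmul X (- Y)) Y = X"
  by (simp_all add: gmul_def E_inv_E inv_E_E E_uminus add.assoc[symmetric])

lemma gmul_minus: "- gmul X Y = gmul (- Y) (- X)"
proof -
  have "E (- gmul X Y) = E (gmul (- Y) (- X))" by (simp only: E_gmul E_uminus minus_add)
  then show ?thesis by (metis inv_E_E)
qed

lemma gmul_assoc: "gmul (gmul X Y) Z = gmul X (gmul Y Z)"
  by (simp add: gmul_def E_inv_E add.assoc)

lemma continuous_on_gmul:
  assumes "continuous_on S f" "continuous_on S g"
  shows "continuous_on S (\<lambda>p. gmul (f p) (g p))"
  using continuous_on_compose2[OF smooth_on_continuous_on[OF smooth_gmul] continuous_on_Pair[OF assms]] by simp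

text \<open>The trace is taken in \<open>Basis\<close>, while \<open>A\<close> is diagonal in an
  eigenbasis that need not be orthogonal. The change of basis \<open>P\<close> conjugates both
  \<open>A\<close> and \<open>dil r\<close> to diagonal matrices, and determinant and trace are
  invariant under conjugation.\<close>

lemma det_dil: assumes r: "r > 0" shows "det (ematrix (dil r)) = r powr operator_trace A"
proof -
  have "card eigenbasis = DIM('a)"
    using basis_card_eq_dim[of eigenbasis UNIV] eigenbasis by simp
  then have "\<exists>\<gamma>. bij_betw \<gamma> (UNIV :: 'a dim_index set) eigenbasis"
    by (intro finite_same_card_bij) (simp_all add: card_dim_index eigenbasis)
  then obtain \<gamma> where \<gamma>: "bij_betw \<gamma> (UNIV :: 'a dim_index set) eigenbasis" by blast
  have \<gamma>in: "\<gamma> i \<in> eigenbasis" for i using \<gamma> by (auto simp: bij_betw_def)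
  have \<gamma>eq: "\<gamma> i = \<gamma> j \<longleftrightarrow> i = j" for i j using \<gamma> by (auto simp: bij_betw_def inj_on_def)
  define P where "P = (\<lambda>X::'a. \<Sum>i\<in>UNIV. (X \<bullet> dim_basis i) *\<^sub>R \<gamma> i)"
  define R where "R = (\<lambda>X. \<Sum>i\<in>UNIV. coord (\<gamma> i) X *\<^sub>R dim_basis i)"
  define Dg where "Dg = (\<lambda>(d::'a dim_index \<Rightarrow> real) (X::'a). \<Sum>i\<in>UNIV. (d i * (X \<bullet> dim_basis i)) *\<^sub>R dim_basis i)"
  have P: "bounded_linear P"
    unfolding P_def linear_conv_bounded_linear[symmetric]
    by (rule linearI) (simp_all add: inner_add_left scaleR_add_left sum.distrib scaleR_sum_right)
  have R: "bounded_linear R"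
    unfolding R_def linear_conv_bounded_linear[symmetric]
    by (rule linearI) (simp_all add: linear_add[OF bounded_linear.linear[OF coord_linear]]
        linear_scale[OF bounded_linear.linear[OF coord_linear]] scaleR_add_left sum.distrib scaleR_sum_right)
  have Pb: "P (dim_basis j) = \<gamma> j" for j
    by (simp add: P_def dim_basis_inner if_distrib[of "\<lambda>x. x *\<^sub>R _"] cong: if_cong)
  have RP: "R (P (dim_basis j)) = dim_basis j" for j
    by (simp add: Pb R_def coord_basis \<gamma>in \<gamma>eq if_distrib[of "\<lambda>x. x *\<^sub>R _"] cong: if_cong)
  have Dgb: "Dg d (dim_basis j) = d j *\<^sub>R dim_basis j" for d j
    by (simp add: Dg_def dim_basis_inner if_distrib[of "\<lambda>x. _ * x"] if_distrib[of "\<lambda>x. x *\<^sub>R _"] cong: if_cong)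
  have RPm: "ematrix R ** ematrix P = mat 1"
    unfolding ematrix_compose[OF R, symmetric] ematrix_ident[symmetric] by (simp add: ematrix_def RP)
  then have PRm: "ematrix P ** ematrix R = mat 1" by (simp add: matrix_left_right_inverse)
  have intertwine: "ematrix T ** ematrix P = ematrix P ** ematrix (Dg d)"
    if T: "bounded_linear T" "\<And>i. T (\<gamma> i) = d i *\<^sub>R \<gamma> i" for T d
    unfolding ematrix_compose[OF T(1), symmetric] ematrix_compose[OF P, symmetric]
    by (simp add: ematrix_def Pb T(2) Dgb linear_scale[OF bounded_linear.linear[OF P]])
  have Dgm: "ematrix (Dg d) $ i $ j = (if i = j then d i else 0)" for d i j
    by (simp add: ematrix_def Dgb dim_basis_inner)
  have d0: "det (ematrix P) \<noteq> 0"
    using RPm by (metis det_I det_mul mult_zero_right zero_neq_one)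
  have "det (ematrix (dil r)) * det (ematrix P) = det (ematrix P) * det (ematrix (Dg (\<lambda>i. r powr eigenvalue (\<gamma> i))))"
    using intertwine[OF dil_bounded_linear[OF r], of "\<lambda>i. r powr eigenvalue (\<gamma> i)"] dil_eigenvector[OF eigenvalue(2)[OF \<gamma>in] r]
    by (simp add: det_mul[symmetric])
  then have "det (ematrix (dil r)) = (\<Prod>i\<in>UNIV. r powr eigenvalue (\<gamma> i))"
    using d0 by (simp add: det_diagonal Dgm)
  also have "\<dots> = r powr (\<Sum>i\<in>UNIV. eigenvalue (\<gamma> i))"
    using r by (simp add: powr_sum)
  also have "(\<Sum>i\<in>UNIV. eigenvalue (\<gamma> i)) = trace (ematrix (Dg (\<lambda>i. eigenvalue (\<gamma> i))))"
    by (simp add: trace_def Dgm)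
  also have "\<dots> = trace (ematrix R ** (ematrix P ** ematrix (Dg (\<lambda>i. eigenvalue (\<gamma> i)))))"
    by (simp add: matrix_mul_assoc RPm)
  also have "\<dots> = trace (ematrix R ** (ematrix A ** ematrix P))"
    using intertwine[of A "\<lambda>i. eigenvalue (\<gamma> i)"] A_linear eigenvalue(2)[OF \<gamma>in] by (simp add: linear_conv_bounded_linear)
  also have "\<dots> = trace (ematrix A ** ematrix P ** ematrix R)" by (rule trace_mul_sym)
  also have "\<dots> = operator_trace A"
    by (simp add: matrix_mul_assoc[symmetric] PRm trace_ematrix)
  finally show ?thesis .
qed

lemma distr_dil:
  assumes r: "r > 0"
  shows "distr lborel borel (dil (1 / r)) = density lborel (\<lambda>_. ennreal (r powr operator_trace A))"
proof (rule distr_constant_jacobian[where f = "dil r" and f' = "\<lambda>_. dil r"])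
  show "(dil r has_derivative dil r) (at x)" for x
    using bounded_linear.has_derivative[OF dil_bounded_linear[OF r] has_derivative_ident] .
  show "continuous_on UNIV (dil (1 / r))" using r by (intro linear_continuous_on dil_bounded_linear) simp
qed (use r det_dil[OF r] in auto)

text \<open>In exponential coordinates translations have Jacobian determinant \<open>1\<close>: the determinant is
  invariant under the dilations, which contract to the identity.\<close>

lemma jacobian_1:
  fixes m :: "'a \<Rightarrow> 'a \<Rightarrow> 'a"
  assumes m: "smooth_on UNIV (\<lambda>z. m (fst z) (snd z))" and m0: "\<And>Y. m 0 Y = Y"
    and hom: "\<And>r X Y. r > 0 \<Longrightarrow> dil r (m X Y) = m (dil r X) (dil r Y)"
  obtains D where "\<And>X Y. (m X has_derivative D X Y) (at Y)" "\<And>X Y. det (ematrix (D X Y)) = 1"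
proof -
  define D where "D = (\<lambda>X Y v. frechet_derivative (\<lambda>z. m (fst z) (snd z)) (at (X, Y)) (0, v))"
  have D: "(m X has_derivative D X Y) (at Y)" for X Y
  proof -
    have "((\<lambda>z. m (fst z) (snd z)) has_derivative frechet_derivative (\<lambda>z. m (fst z) (snd z)) (at (X, Y))) (at (X, Y))"
      by (rule smooth_on_has_derivative[OF m]) simp
    moreover have "((\<lambda>Y. (X, Y)) has_derivative (\<lambda>v. (0, v))) (at Y)"
      by (auto intro!: derivative_eq_intros)
    ultimately show ?thesis
      using has_derivative_compose_at[of "\<lambda>Y. (X, Y)" "\<lambda>v. (0, v)" Y "(X, Y)"] by (force simp: D_def)
  qed
  \<comment> \<open>Differentiating \<open>hom\<close> in \<open>Y\<close> shows that
    \<open>D X Y\<close> and its dilated counterpart are intertwined by \<open>dil r\<close>, whose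
    nonzero determinant cancels.\<close>
  have inv: "det (ematrix (D (dil r X) (dil r Y))) = det (ematrix (D X Y))" if r: "r > 0" for r X Y
  proof -
    have dl: "(dil r has_derivative dil r) (at Z)" for Z
      using bounded_linear.has_derivative[OF dil_bounded_linear[OF r] has_derivative_ident] .
    have "((\<lambda>Y. m (dil r X) (dil r Y)) has_derivative (\<lambda>v. D (dil r X) (dil r Y) (dil r v))) (at Y)"
      by (rule has_derivative_compose[OF dl D])
    moreover have "((\<lambda>Y. dil r (m X Y)) has_derivative (\<lambda>v. dil r (D X Y v))) (at Y)"
      by (rule has_derivative_compose[OF D dl])
    ultimately have "(\<lambda>v. D (dil r X) (dil r Y) (dil r v)) = (\<lambda>v. dil r (D X Y v))"
      using hom[OF r] by (simp add: has_derivative_unique)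
    then have "ematrix (D (dil r X) (dil r Y)) ** ematrix (dil r) = ematrix (dil r) ** ematrix (D X Y)"
      unfolding ematrix_compose[OF has_derivative_bounded_linear[OF D], symmetric]
        ematrix_compose[OF dil_bounded_linear[OF r], symmetric] by simp
    then have "det (ematrix (D (dil r X) (dil r Y))) * det (ematrix (dil r)) = det (ematrix (dil r)) * det (ematrix (D X Y))"
      by (metis det_mul)
    moreover have "det (ematrix (dil r)) \<noteq> 0" using r by (simp add: det_dil)
    ultimately show ?thesis by simp
  qed
  have cont: "continuous_on UNIV (\<lambda>z. det (ematrix (D (fst z) (snd z))))"
  proof (rule continuous_on_det)
    fix i j
    show "continuous_on UNIV (\<lambda>z. ematrix (D (fst z) (snd z)) $ i $ j)"
      using smooth_on_continuous_on[OF smooth_on_frechet_derivative[OF m, of "(0, dim_basis j)"]]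
      by (auto simp: ematrix_def D_def intro!: continuous_intros)
  qed
  have "det (ematrix (D X Y)) = 1" for X Y
  proof -
    have "isCont (\<lambda>z. det (ematrix (D (fst z) (snd z)))) (0, 0)"
      using cont by (simp add: continuous_on_eq_continuous_at)
    from isCont_tendsto_compose[OF this tendsto_Pair[OF dil_tendsto_0[of X] dil_tendsto_0[of Y]]]
    have "((\<lambda>r. det (ematrix (D (dil r X) (dil r Y)))) \<longlongrightarrow> det (ematrix (D 0 0))) (at_right 0)" by simp
    moreover have "\<forall>\<^sub>F r in at_right 0. det (ematrix (D (dil r X) (dil r Y))) = det (ematrix (D X Y))"
      by (auto simp: eventually_at_filter inv)
    ultimately have "((\<lambda>r::real. det (ematrix (D X Y))) \<longlongrightarrow> det (ematrix (D 0 0))) (at_right 0)"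
      by (rule Lim_transform_eventually)
    then have "det (ematrix (D X Y)) = det (ematrix (D 0 0))"
      using tendsto_unique[OF _ tendsto_const] by (metis trivial_limit_at_right_real)
    moreover have "D 0 0 = (\<lambda>v. v)"
      using D[of 0 0] m0 has_derivative_unique[OF _ has_derivative_ident] by (metis (no_types, lifting) ext)
    ultimately show ?thesis by (simp add: ematrix_ident)
  qed
  then show ?thesis using that D by blast
qed

lemma lborel_left_invariant: "distr lborel borel (gmul X) = lborel"
proof -
  obtain D where D: "\<And>X Y. (gmul X has_derivative D X Y) (at Y)" "\<And>X Y. det (ematrix (D X Y)) = 1"
    using jacobian_1[OF smooth_gmul gmul_0_left dil_gmul] by blast
  \<comment> \<open>\<open>distr_constant_jacobian\<close> yields the distribution under the inverse
    of the map that is differentiated, so translation by \<open>X\<close> appears as the inverse of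
    translation by \<open>- X\<close>.\<close>
  have "distr lborel borel (gmul (- (- X))) = density lborel (\<lambda>_. ennreal 1)"
    by (rule distr_constant_jacobian[OF D(1)[of "- X"]])
      (auto simp: D(2) gmul_cancel gmul_cancel(2)[of "- X", simplified] intro!: continuous_on_gmul continuous_intros)
  then show ?thesis by (simp add: density_1)
qed

text \<open>The product with its arguments swapped also satisfies the hypotheses of
  \<open>jacobian_1\<close>.\<close>

lemma lborel_right_invariant: "distr lborel borel (\<lambda>X. gmul X Y) = lborel"
proof -
  have sm: "smooth_on UNIV (\<lambda>z. gmul (snd (z::'a\<times>'a)) (fst z))"
    using smooth_on_compose[OF open_UNIV smooth_on_linear[OF open_UNIV
        bounded_linear_Pair[OF bounded_linear_snd bounded_linear_fst]] smooth_gmul] by simp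
  obtain D where D: "\<And>Y X. ((\<lambda>X. gmul X Y) has_derivative D Y X) (at X)" "\<And>X Y. det (ematrix (D X Y)) = 1"
    using jacobian_1[of "\<lambda>Y X. gmul X Y", OF sm gmul_0_right dil_gmul] by blast
  have "distr lborel borel (\<lambda>X. gmul X (- (- Y))) = density lborel (\<lambda>_. ennreal 1)"
    by (rule distr_constant_jacobian[OF D(1)[of "- Y"]])
      (auto simp: D(2) gmul_cancel gmul_cancel(4)[of _ "- Y", simplified] gmul_cancel(3)[of _ "- Y", simplified]
        intro!: continuous_on_gmul continuous_intros)
  then show ?thesis by (simp add: density_1)
qed

text \<open>The classical uniqueness argument: the double integral of
  \<open>f x * g (gmul (- x) y)\<close> is evaluated in both orders. It uses left invariance of the
  image \<open>M\<close> of the Haar measure and both invariances of Lebesgue measure, and yields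
  that \<open>M\<close> is proportional to the latter.\<close>

lemma haar_measure_coordinates:
  assumes \<mu>: "haar_measure \<mu>"
  obtains c where "c > 0" "distr \<mu> borel (inv E) = density lborel (\<lambda>_. ennreal c)"
proof -
  have s\<mu> [measurable_cong]: "sets \<mu> = sets borel"
    and inv\<mu>: "\<And>a. distr \<mu> borel (\<lambda>x. a + x) = \<mu>"
    and fin\<mu>: "\<And>K. compact K \<Longrightarrow> emeasure \<mu> K < \<infinity>" and nz: "emeasure \<mu> UNIV \<noteq> 0"
    using \<mu> by (auto simp: haar_measure_def)
  have sp: "space \<mu> = UNIV" using sets_eq_imp_space_eq[OF s\<mu>] by simp
  have iE [measurable]: "inv E \<in> borel_measurable borel"
    by (rule borel_measurable_continuous_onI[OF continuous_on_inv_E])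
  have gm [measurable]: "(\<lambda>z. gmul (fst z) (snd z)) \<in> borel_measurable (borel \<Otimes>\<^sub>M borel)"
    unfolding borel_prod by (intro borel_measurable_continuous_onI continuous_on_gmul continuous_intros)
  define M where "M = distr \<mu> borel (inv E)"
  have sM [measurable_cong]: "sets M = sets borel" by (simp add: M_def)
  have spM: "space M = UNIV" by (simp add: M_def)
  have iE\<mu> [measurable]: "inv E \<in> measurable \<mu> borel" by measurable
  have finM: "emeasure M K < \<infinity>" if K: "compact K" for K
  proof -
    have "emeasure M K = emeasure \<mu> (inv E -` K)"
      unfolding M_def using K sp by (subst emeasure_distr) (auto intro: borel_compact)
    also have "inv E -` K = E ` K" using E_inv_E inv_E_E by (auto simp: image_iff) metis
    finally show ?thesis using fin\<mu>[OF compact_continuous_image[OF continuous_on_E K]] by simp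
  qed
  interpret M: sigma_finite_measure M
  proof
    show "\<exists>B. countable B \<and> B \<subseteq> sets M \<and> \<Union>B = space M \<and> (\<forall>b\<in>B. emeasure M b \<noteq> \<infinity>)"
    proof (intro exI conjI ballI)
      show "countable (range (\<lambda>n::nat. cball (0::'a) (real n)))" by simp
      show "range (\<lambda>n::nat. cball (0::'a) (real n)) \<subseteq> sets M" by auto
      show "\<Union>(range (\<lambda>n::nat. cball (0::'a) (real n))) = space M"
        using real_arch_simple by (auto simp: spM)
      show "emeasure M b \<noteq> \<infinity>" if "b \<in> range (\<lambda>n::nat. cball (0::'a) (real n))" for b
        using that finM by (auto simp: less_top)
    qed
  qed
  have invM: "distr M borel (gmul X) = M" for X
  proof -
    have gX [measurable]: "gmul X \<in> borel_measurable borel"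
      by (intro borel_measurable_continuous_onI continuous_on_gmul continuous_intros)
    have pX [measurable]: "(\<lambda>x::'g. E X + x) \<in> measurable borel borel"
      by (intro borel_measurable_continuous_onI continuous_intros)
    have pX\<mu>: "(\<lambda>x::'g. E X + x) \<in> measurable \<mu> borel" by measurable
    have "distr M borel (gmul X) = distr \<mu> borel (gmul X \<circ> inv E)"
      unfolding M_def by (rule distr_distr) auto
    also have "gmul X \<circ> inv E = inv E \<circ> (\<lambda>x. E X + x)" by (auto simp: gmul_def E_inv_E)
    also have "distr \<mu> borel (inv E \<circ> (\<lambda>x. E X + x)) = distr (distr \<mu> borel (\<lambda>x. E X + x)) borel (inv E)"
      by (rule distr_distr[symmetric]) (use pX\<mu> in auto)
    also have "\<dots> = M" by (simp add: inv\<mu> M_def)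
    finally show ?thesis .
  qed
  interpret P: pair_sigma_finite M lborel ..
  \<comment> \<open>The reference set has finite, positive Lebesgue measure and is symmetric, so
    that \<open>g (- x) = g x\<close>.\<close>
  define Bl where "Bl = cball (0::'a) 1"
  have Bl [measurable]: "Bl \<in> sets borel" by (simp add: Bl_def)
  have key: "emeasure M S * emeasure lborel Bl = emeasure M Bl * emeasure lborel S" if S [measurable]: "S \<in> sets borel" for S
  proof -
    define f :: "'a \<Rightarrow> ennreal" where "f = indicator S"
    define g :: "'a \<Rightarrow> ennreal" where "g = indicator Bl"
    have [measurable]: "f \<in> borel_measurable borel" "g \<in> borel_measurable borel" by (auto simp: f_def g_def)
    have gmX: "gmul X \<in> borel_measurable borel" "(\<lambda>Y. gmul Y X) \<in> borel_measurable borel" for X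
      by (intro borel_measurable_continuous_onI continuous_on_gmul continuous_intros)+
    have tr1: "(\<integral>\<^sup>+ y. h (gmul X y) \<partial>lborel) = (\<integral>\<^sup>+ y. h y \<partial>lborel)" if "h \<in> borel_measurable borel" for h :: "'a \<Rightarrow> ennreal" and X
      using nn_integral_distr[of "gmul X" lborel borel h] gmX that lborel_left_invariant by simp
    have tr2: "(\<integral>\<^sup>+ y. h (gmul y X) \<partial>lborel) = (\<integral>\<^sup>+ y. h y \<partial>lborel)" if "h \<in> borel_measurable borel" for h :: "'a \<Rightarrow> ennreal" and X
      using nn_integral_distr[of "\<lambda>y. gmul y X" lborel borel h] gmX that lborel_right_invariant by simp
    have tr3: "(\<integral>\<^sup>+ y. h (gmul X y) \<partial>M) = (\<integral>\<^sup>+ y. h y \<partial>M)" if "h \<in> borel_measurable borel" for h :: "'a \<Rightarrow> ennreal" and X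
      using nn_integral_distr[of "gmul X" M borel h] gmX that invM by simp
    have [measurable]: "(\<lambda>X::'a. - X) \<in> borel_measurable borel" by simp
    have mm: "(\<lambda>x. gmul (u x) (v x)) \<in> borel_measurable N"
      if "u \<in> borel_measurable N" "v \<in> borel_measurable N" for u v :: "'z \<Rightarrow> 'a" and N
      using measurable_compose[OF measurable_Pair[OF that] gm] by simp
    have pr: "fst \<in> borel_measurable (M \<Otimes>\<^sub>M lborel)" "snd \<in> borel_measurable (M \<Otimes>\<^sub>M lborel)"
      by measurable
    then have prm: "(\<lambda>z. - fst z) \<in> borel_measurable (M \<Otimes>\<^sub>M lborel)" by measurable
    have m1: "(\<lambda>(x, y). f x * g (gmul (- x) y)) \<in> borel_measurable (M \<Otimes>\<^sub>M lborel)"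
      unfolding split_beta'
      by (intro borel_measurable_times_ennreal measurable_compose[OF pr(1) \<open>f \<in> _\<close>]
          measurable_compose[OF mm[OF prm pr(2)] \<open>g \<in> _\<close>])
    have m2: "(\<lambda>(x, y). f (gmul y x) * g (- x)) \<in> borel_measurable (M \<Otimes>\<^sub>M lborel)"
      unfolding split_beta'
      by (intro borel_measurable_times_ennreal measurable_compose[OF prm \<open>g \<in> _\<close>]
          measurable_compose[OF mm[OF pr(2) pr(1)] \<open>f \<in> _\<close>])
    have "emeasure M S * emeasure lborel Bl = (\<integral>\<^sup>+ x. f x * (\<integral>\<^sup>+ y. g y \<partial>lborel) \<partial>M)"
      by (simp add: f_def g_def nn_integral_multc)
    also have "\<dots> = (\<integral>\<^sup>+ x. (\<integral>\<^sup>+ y. f x * g (gmul (- x) y) \<partial>lborel) \<partial>M)"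
      using tr1[of g] gmX by (intro nn_integral_cong) (simp add: nn_integral_cmult measurable_compose[OF gmX(1)])
    also have "\<dots> = (\<integral>\<^sup>+ y. (\<integral>\<^sup>+ x. f x * g (gmul (- x) y) \<partial>M) \<partial>lborel)"
      by (rule P.Fubini'[OF m1, symmetric])
    \<comment> \<open>Replacing \<open>x\<close> by \<open>gmul y x\<close> turns the argument of
      \<open>g\<close> into \<open>- x\<close>, since the two factors \<open>y\<close>
      cancel.\<close>
    also have "\<dots> = (\<integral>\<^sup>+ y. (\<integral>\<^sup>+ x. f (gmul y x) * g (- x) \<partial>M) \<partial>lborel)"
    proof (rule nn_integral_cong)
      fix y :: 'a
      have "(\<lambda>x. f x * g (gmul (- x) y)) \<in> borel_measurable borel"
        by (intro borel_measurable_times_ennreal \<open>f \<in> _\<close> measurable_compose[OF mm \<open>g \<in> _\<close>]) measurable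
      from tr3[OF this, of y]
      show "(\<integral>\<^sup>+ x. f x * g (gmul (- x) y) \<partial>M) = (\<integral>\<^sup>+ x. f (gmul y x) * g (- x) \<partial>M)"
        by (simp add: gmul_minus gmul_assoc gmul_cancel gmul_0_right
            gmul_cancel(1)[of y 0, simplified gmul_0_right])
    qed
    also have "\<dots> = (\<integral>\<^sup>+ x. (\<integral>\<^sup>+ y. f (gmul y x) * g (- x) \<partial>lborel) \<partial>M)"
      by (rule P.Fubini'[OF m2])
    also have "\<dots> = (\<integral>\<^sup>+ x. emeasure lborel S * g (- x) \<partial>M)"
      using tr2[of f] gmX by (intro nn_integral_cong)
        (simp add: nn_integral_multc measurable_compose[OF gmX(2)], simp add: f_def)
    also have "\<dots> = (\<integral>\<^sup>+ x. emeasure lborel S * indicator Bl x \<partial>M)"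
      by (intro nn_integral_cong) (auto simp: g_def indicator_def Bl_def)
    also have "\<dots> = emeasure M Bl * emeasure lborel S" by (subst nn_integral_cmult) (auto simp: mult.commute sM)
    finally show ?thesis .
  qed
  have Bfin: "emeasure M Bl < \<infinity>" using finM by (simp add: Bl_def)
  have Lfin: "emeasure lborel Bl < \<infinity>" using emeasure_compact_finite[OF compact_cball] by (simp add: Bl_def)
  define a where "a = enn2real (emeasure M Bl)"
  define b where "b = enn2real (emeasure lborel Bl)"
  have a: "emeasure M Bl = ennreal a" "a \<ge> 0" using Bfin by (auto simp: a_def)
  have b: "emeasure lborel Bl = ennreal b" using Lfin by (auto simp: b_def)
  have b0: "b > 0" using content_cball_pos[of 1 "0::'a"] by (simp add: b_def Bl_def measure_def)
  have eq: "emeasure M S = ennreal (a / b) * emeasure lborel S" if "S \<in> sets borel" for S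
  proof -
    have "emeasure M S = emeasure M S * ennreal b * ennreal (1 / b)"
      using b0 by (simp add: mult.assoc ennreal_mult[symmetric])
    also have "\<dots> = ennreal a * emeasure lborel S * ennreal (1 / b)" using key[OF that] a b by simp
    also have "\<dots> = (ennreal a * ennreal (1 / b)) * emeasure lborel S" by (simp only: mult_ac)
    also have "ennreal a * ennreal (1 / b) = ennreal (a / b)"
      using a b0 by (simp add: ennreal_mult[symmetric])
    finally show ?thesis .
  qed
  have "a \<noteq> 0"
  proof
    assume "a = 0"
    then have "emeasure M UNIV = 0" using eq[of UNIV] by simp
    moreover have "emeasure M UNIV = emeasure \<mu> UNIV"
      unfolding M_def using sp by (subst emeasure_distr) auto
    ultimately show False using nz by simp
  qed
  then have "a / b > 0" using a b0 by simp
  moreover have "M = density lborel (\<lambda>_. ennreal (a / b))"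
    by (rule measure_eqI) (auto simp: emeasure_density_const eq sM)
  ultimately show ?thesis using that[of "a / b"] by (simp add: M_def)
qed

end

section \<open>The Hardy identity\<close>

locale quasi_normed_group = homogeneous_group \<A> E bracket A
  for \<A> :: "('g::{topological_group_add, t2_space, second_countable_topology},
              'a::euclidean_space) chart set"
    and E :: "'a \<Rightarrow> 'g"
    and bracket :: "'a \<Rightarrow> 'a \<Rightarrow> 'a"
    and A :: "'a \<Rightarrow> 'a" +
  fixes N :: "'g \<Rightarrow> real"
  assumes quasi_norm: "homogeneous_quasi_norm E A N"
begin

section \<open>The quasi-norm and the generator of dilations in coordinates\<close>

definition qn :: "'a \<Rightarrow> real" where
  "qn X = N (E X)"

lemma continuous_on_qn: "continuous_on S qn"
proof -
  have "continuous_on UNIV N" using quasi_norm by (simp add: homogeneous_quasi_norm_def)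
  then show ?thesis unfolding qn_def by (rule continuous_on_compose2[OF _ continuous_on_E]) simp
qed

lemma qn_nonneg: "qn X \<ge> 0"
  using quasi_norm by (simp add: homogeneous_quasi_norm_def qn_def)

lemma qn_dil: "r > 0 \<Longrightarrow> qn (dil r X) = r * qn X"
proof -
  assume r: "r > 0"
  have "N (group_dilation E A r (E X)) = r * N (E X)"
    using quasi_norm r by (simp add: homogeneous_quasi_norm_def)
  then show ?thesis by (simp add: group_dilation_def inv_E_E qn_def)
qed

lemma qn_eq_0_iff: "qn X = 0 \<longleftrightarrow> X = 0"
proof -
  have "qn X = 0 \<longleftrightarrow> E X = 0" using quasi_norm by (simp add: homogeneous_quasi_norm_def qn_def)
  also have "\<dots> \<longleftrightarrow> X = 0" using E_0 inv_E_E by metis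
  finally show ?thesis .
qed

lemma qn_pos: "X \<noteq> 0 \<Longrightarrow> qn X > 0"
  using qn_nonneg[of X] qn_eq_0_iff[of X] by linarith

text \<open>The derivative along the vector field \<open>X \<mapsto> A X\<close> that generates the
  dilations: \<open>|x|\<close> times the radial derivative, but continuous also at the origin for
  smooth \<open>F\<close>.\<close>

definition euler :: "('a \<Rightarrow> 'b::real_normed_vector) \<Rightarrow> 'a \<Rightarrow> 'b" where
  "euler F X = frechet_derivative F (at X) (A X)"

lemma dil_has_vector_derivative:
  assumes "s > 0"
  shows "((\<lambda>s. dil s X) has_vector_derivative (1 / s) *\<^sub>R A (dil s X)) (at s)"
proof -
  have "((\<lambda>s. \<Sum>b\<in>eigenbasis. (coord b X * s powr eigenvalue b) *\<^sub>R b) has_vector_derivative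
      (\<Sum>b\<in>eigenbasis. (coord b X * (eigenvalue b * s powr (eigenvalue b - 1))) *\<^sub>R b)) (at s)"
    using assms by (intro has_vector_derivative_sum)
      (auto simp: has_vector_derivative_def powr_diff field_simps intro!: derivative_eq_intros)
  then have "((\<lambda>s. dil s X) has_vector_derivative
      (\<Sum>b\<in>eigenbasis. (coord b X * (eigenvalue b * s powr (eigenvalue b - 1))) *\<^sub>R b)) (at s)"
    by (rule has_vector_derivative_transform_within_open[of _ _ _ "{0<..}"]) (use assms in \<open>auto simp: dil_coord\<close>)
  moreover have "(1 / s) *\<^sub>R A (dil s X) = (\<Sum>b\<in>eigenbasis. (coord b X * (eigenvalue b * s powr (eigenvalue b - 1))) *\<^sub>R b)"
  proof -
    have "(1 / s) *\<^sub>R A (dil s X) = (\<Sum>b\<in>eigenbasis. (1 / s) *\<^sub>R (coord b X * s powr eigenvalue b) *\<^sub>R A b)"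
      unfolding dil_coord[OF assms] by (simp add: linear_sum[OF A_linear] linear_scale[OF A_linear] scaleR_sum_right)
    also have "\<dots> = (\<Sum>b\<in>eigenbasis. (coord b X * (eigenvalue b * s powr (eigenvalue b - 1))) *\<^sub>R b)"
      by (intro sum.cong refl) (use assms in \<open>auto simp: eigenvalue(2) powr_diff\<close>)
    finally show ?thesis .
  qed
  ultimately show ?thesis by simp
qed

text \<open>In the logarithmic time \<open>t\<close> the dilations form a one-parameter group
  generated by \<open>A\<close>, so no factor depending on \<open>t\<close> appears.\<close>

lemma orbit_has_vector_derivative:
  assumes F: "smooth_on UNIV F"
  shows "((\<lambda>t. F (dil (exp t) X)) has_vector_derivative euler F (dil (exp t) X)) (at t)"
proof -
  have e: "(exp has_vector_derivative exp t) (at t)"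
    by (simp add: has_real_derivative_iff_has_vector_derivative[symmetric] DERIV_exp)
  have "((\<lambda>t. dil (exp t) X) has_vector_derivative A (dil (exp t) X)) (at t)"
    using vector_diff_chain_at[OF e dil_has_vector_derivative[of "exp t" X]] by (simp add: o_def)
  then have d: "((\<lambda>t. dil (exp t) X) has_derivative (\<lambda>h. h *\<^sub>R A (dil (exp t) X))) (at t)"
    by (simp add: has_vector_derivative_def)
  have FD: "(F has_derivative frechet_derivative F (at (dil (exp t) X))) (at (dil (exp t) X))"
    by (rule smooth_on_has_derivative[OF F]) simp
  show ?thesis
    using has_derivative_compose[OF d FD] linear_scale[OF has_derivative_linear[OF FD]]
    by (simp add: has_vector_derivative_def euler_def)
qed

lemma continuous_on_euler:
  assumes F: "smooth_on UNIV F"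
  shows "continuous_on S (euler F)"
proof -
  have "euler F X = (\<Sum>b\<in>Basis. (A X \<bullet> b) *\<^sub>R frechet_derivative F (at X) b)" for X
    unfolding euler_def
    by (rule bounded_linear_euclidean_expand[OF has_derivative_bounded_linear[OF smooth_on_has_derivative[OF F UNIV_I]]])
  then have "euler F = (\<lambda>X. \<Sum>b\<in>Basis. (A X \<bullet> b) *\<^sub>R frechet_derivative F (at X) b)" by blast
  moreover have "continuous_on UNIV (\<lambda>X. \<Sum>b\<in>Basis. (A X \<bullet> b) *\<^sub>R frechet_derivative F (at X) b)"
    using A_linear by (intro continuous_intros linear_continuous_on smooth_on_continuous_on[OF smooth_on_frechet_derivative[OF F]])
      (simp add: linear_conv_bounded_linear)
  ultimately show ?thesis by (auto intro: continuous_on_subset)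
qed

lemma euler_outside:
  assumes K: "closed K" and F: "\<And>X. X \<notin> K \<Longrightarrow> F X = 0" and X: "X \<notin> K"
  shows "euler F X = 0"
proof -
  have "((\<lambda>_. 0) has_derivative (\<lambda>_. 0)) (at X)" by simp
  then have "(F has_derivative (\<lambda>_. 0)) (at X)"
    by (rule has_derivative_transform_within_open[of _ _ _ _ "- K"]) (use K F X in auto)
  then show ?thesis using frechet_derivative_at by (metis euler_def)
qed

text \<open>The radial curve through \<open>X\<close> is \<open>dil (r / qn X) X\<close>, whose
  parameter passes \<open>1\<close> with speed \<open>1 / qn X\<close> at
  \<open>r = qn X\<close>.\<close>

lemma radial_derivative_coordinates:
  assumes F: "smooth_on UNIV (\<lambda>X. f (E X))" and X: "X \<noteq> 0"
  shows "radial_derivative E A N f (E X) = (1 / qn X) *\<^sub>R euler (\<lambda>X. f (E X)) X"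
proof -
  let ?F = "\<lambda>X. f (E X)"
  have q: "qn X > 0" using X by (rule qn_pos)
  have d: "((\<lambda>r. r / qn X) has_vector_derivative 1 / qn X) (at (qn X))"
    using q by (auto simp: has_real_derivative_iff_has_vector_derivative[symmetric] intro!: derivative_eq_intros)
  have d2: "((\<lambda>s. dil s X) has_vector_derivative A X) (at (qn X / qn X))"
    using dil_has_vector_derivative[of 1 X] q by simp
  have h1: "((\<lambda>r. dil (r / qn X) X) has_derivative (\<lambda>h. h *\<^sub>R (1 / qn X) *\<^sub>R A X)) (at (qn X))"
    using vector_diff_chain_at[OF d d2] by (simp add: o_def has_vector_derivative_def)
  have FD: "(?F has_derivative frechet_derivative ?F (at X)) (at X)"
    by (rule smooth_on_has_derivative[OF F]) simp
  have "((\<lambda>r. ?F (dil (r / qn X) X)) has_derivative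
      (\<lambda>h. frechet_derivative ?F (at X) (h *\<^sub>R (1 / qn X) *\<^sub>R A X))) (at (qn X))"
    by (rule has_derivative_compose_at[OF h1 _ FD]) (use q in simp)
  then have "((\<lambda>r. ?F (dil (r / qn X) X)) has_vector_derivative (1 / qn X) *\<^sub>R euler ?F X) (at (qn X))"
    using linear_scale[OF has_derivative_linear[OF FD]] by (simp add: has_vector_derivative_def euler_def)
  then have "((\<lambda>r. ?F (dil r (dil (1 / qn X) X))) has_vector_derivative (1 / qn X) *\<^sub>R euler ?F X) (at (qn X))"
    by (rule has_vector_derivative_transform_within_open[of _ _ _ "{0<..}"]) (use q in \<open>auto simp: dil_dil\<close>)
  then show ?thesis
    by (simp add: radial_derivative_def Let_def group_dilation_def inv_E_E qn_def[symmetric] vector_derivative_at)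
qed

lemma integrable_compact_support:
  fixes g :: "'a \<Rightarrow> real"
  assumes K: "compact K" and g: "continuous_on UNIV g" and g0: "\<And>X. X \<notin> K \<Longrightarrow> g X = 0"
  shows "integrable lborel g"
proof -
  have "integrable lborel (\<lambda>X. indicator K X *\<^sub>R g X)"
    by (rule borel_integrable_compact[OF K continuous_on_subset[OF g]]) simp
  moreover have "(\<lambda>X. indicator K X *\<^sub>R g X) = g"
  proof
    fix X show "indicator K X *\<^sub>R g X = g X" by (cases "X \<in> K") (auto simp: g0)
  qed
  ultimately show ?thesis by simp
qed

lemma integral_dil:
  fixes h :: "'a \<Rightarrow> real"
  assumes "h \<in> borel_measurable borel"
  shows "(\<integral>X. h (dil (exp t) X) \<partial>lborel) = exp (- operator_trace A * t) * (\<integral>X. h X \<partial>lborel)"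
proof -
  have m: "dil (exp t) \<in> borel_measurable borel"
    by (intro borel_measurable_continuous_onI linear_continuous_on dil_bounded_linear) simp
  have "distr lborel borel (dil (exp t)) = density lborel (\<lambda>_. ennreal (exp (- t) powr operator_trace A))"
    using distr_dil[of "exp (- t)"] by (simp add: exp_minus inverse_eq_divide)
  then have "(\<integral>X. h (dil (exp t) X) \<partial>lborel) = (\<integral>X. h X \<partial>density lborel (\<lambda>_. ennreal (exp (- t) powr operator_trace A)))"
    using integral_distr[of "dil (exp t)" lborel borel h] m assms by simp
  also have "\<dots> = exp (- t) powr operator_trace A * (\<integral>X. h X \<partial>lborel)"
    using assms by (subst integral_density) auto
  finally show ?thesis by (simp add: powr_def mult.commute)
qed

lemma continuous_on_dil: "continuous_on S (\<lambda>z. dil (exp (fst z)) (snd z))"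
proof -
  have "(\<lambda>z. dil (exp (fst z)) (snd z)) = (\<lambda>z. \<Sum>b\<in>eigenbasis. (coord b (snd z) * exp (fst z) powr eigenvalue b) *\<^sub>R b)"
    by (simp add: dil_coord fun_eq_iff)
  moreover have "continuous_on S (\<lambda>z. \<Sum>b\<in>eigenbasis. (coord b (snd z) * exp (fst z) powr eigenvalue b) *\<^sub>R b)"
    by (intro continuous_intros bounded_linear.continuous_on[OF coord_linear]) auto
  ultimately show ?thesis by (simp only:)
qed

text \<open>Differentiate \<open>\<integral> p (D\<^bsub>exp t\<^esub> X) dX = exp (- Q t) \<integral> p dX\<close> at \<open>t = 0\<close>.\<close>

lemma integral_orbit_derivative:
  fixes p p1 :: "'a \<Rightarrow> real"
  assumes K: "compact K" and p0: "\<And>X. X \<notin> K \<Longrightarrow> p X = 0"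
    and p: "continuous_on UNIV p" and p1: "continuous_on UNIV p1"
    and d: "\<And>t X. ((\<lambda>t. p (dil (exp t) X)) has_vector_derivative p1 (dil (exp t) X)) (at t)"
  shows "(\<integral>X. p1 X \<partial>lborel) = - operator_trace A * (\<integral>X. p X \<partial>lborel)"
proof -
  let ?U = "{-1<..<1::real}"
  \<comment> \<open>\<open>K'\<close> contains every point whose orbit meets \<open>K\<close> at
    some time of absolute value at most \<open>1\<close>, so one box supports the integrands for all
    \<open>t\<close> in \<open>?U\<close>.\<close>
  define K' where "K' = (\<lambda>z. dil (exp (fst z)) (snd z)) ` ({-1..1} \<times> K)"
  have "compact K'"
    unfolding K'_def by (intro compact_continuous_image continuous_on_dil compact_Times K compact_Icc)
  then obtain a b where ab: "K' \<subseteq> cbox a b"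
    using bounded_subset_cbox_symmetric[OF compact_imp_bounded] by metis
  have out: "dil (exp t) X \<notin> K" if "X \<notin> cbox a b" "t \<in> ?U" for t X
  proof
    assume "dil (exp t) X \<in> K"
    then have "dil (exp (- t)) (dil (exp t) X) \<in> K'"
      unfolding K'_def using that(2) by (intro image_eqI[of _ _ "(- t, dil (exp t) X)"]) auto
    then show False using ab that(1) by (auto simp: dil_dil exp_minus)
  qed
  have p10: "p1 X = 0" if X: "X \<notin> K" for X
  proof -
    have "continuous_on UNIV (\<lambda>t. dil (exp (fst (t, X))) (snd (t, X)))"
      by (rule continuous_on_compose2[OF continuous_on_dil]) (auto intro!: continuous_intros)
    then have op: "open ((\<lambda>t. dil (exp t) X) -` (- K))"
      using compact_imp_closed[OF K] by (auto intro: open_vimage)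
    have X0: "0 \<in> (\<lambda>t. dil (exp t) X) -` (- K)" using X by simp
    have d0: "((\<lambda>t. p (dil (exp t) X)) has_vector_derivative p1 X) (at 0)" using d[of X 0] by simp
    have "((\<lambda>_. 0) has_vector_derivative p1 X) (at 0)"
      by (rule has_vector_derivative_transform_within_open[OF d0 op X0]) (simp add: p0)
    then show ?thesis using has_vector_derivative_const vector_derivative_unique_at by blast
  qed
  have conv: "integral (cbox a b) (\<lambda>X. g (dil (exp t) X)) = exp (- operator_trace A * t) * (\<integral>X. g X \<partial>lborel)"
    if t: "t \<in> ?U" and g: "continuous_on UNIV g" and g0: "\<And>X. X \<notin> K \<Longrightarrow> g X = 0" for g :: "'a \<Rightarrow> real" and t
  proof -
    let ?h = "\<lambda>X. g (dil (exp t) X)"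
    have c: "continuous_on UNIV ?h"
      by (rule continuous_on_compose2[OF g linear_continuous_on[OF dil_bounded_linear]]) auto
    have h0: "?h X = 0" if "X \<notin> cbox a b" for X using out[OF that t] g0 by simp
    have i: "integrable lborel ?h" by (rule integrable_compact_support[OF compact_cbox c h0])
    have eq: "(\<lambda>X. if X \<in> cbox a b then ?h X else 0) = ?h" using h0 by auto
    have "(?h has_integral (\<integral>X. ?h X \<partial>lborel)) (cbox a b)"
      using has_integral_restrict_UNIV[of "cbox a b" ?h] has_integral_integral_lborel[OF i] unfolding eq by simp
    moreover have "g \<in> borel_measurable borel" using g by (rule borel_measurable_continuous_onI)
    ultimately show ?thesis using integral_dil[of g t] by (simp add: integral_unique)
  qed
  have "((\<lambda>t. integral (cbox a b) (\<lambda>X. p (dil (exp t) X))) has_vector_derivative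
      integral (cbox a b) (\<lambda>X. p1 (dil (exp 0) X))) (at 0 within ?U)"
  proof (rule leibniz_rule_vector_derivative)
    show "((\<lambda>t. p (dil (exp t) X)) has_vector_derivative p1 (dil (exp t) X)) (at t within ?U)" for t X
      using d by (rule has_vector_derivative_at_within)
    show "(\<lambda>X. p (dil (exp t) X)) integrable_on cbox a b" for t
      by (intro integrable_continuous continuous_on_compose2[OF p linear_continuous_on[OF dil_bounded_linear]]) auto
    show "continuous_on (?U \<times> cbox a b) (\<lambda>(t, X). p1 (dil (exp t) X))"
      unfolding split_beta' by (intro continuous_on_compose2[OF p1] continuous_on_dil) auto
  qed auto
  then have "((\<lambda>t. integral (cbox a b) (\<lambda>X. p (dil (exp t) X))) has_vector_derivative (\<integral>X. p1 X \<partial>lborel)) (at 0)"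
    using conv[OF _ p1 p10, of 0] by (simp add: at_within_open[of 0 ?U])
  then have "((\<lambda>t. exp (- operator_trace A * t) * (\<integral>X. p X \<partial>lborel)) has_vector_derivative (\<integral>X. p1 X \<partial>lborel)) (at 0)"
    by (rule has_vector_derivative_transform_within_open[of _ _ _ ?U]) (use conv[OF _ p p0] in auto)
  moreover have "((\<lambda>t. exp (- operator_trace A * t) * (\<integral>X. p X \<partial>lborel)) has_vector_derivative
      - operator_trace A * (\<integral>X. p X \<partial>lborel)) (at 0)"
    by (auto simp: has_real_derivative_iff_has_vector_derivative[symmetric] intro!: derivative_eq_intros)
  ultimately show ?thesis by (rule vector_derivative_unique_at)
qed

text \<open>The weight may be singular at the origin, but \<open>g\<close> vanishes near it; the
  open sets \<open>- {0}\<close> and \<open>- K\<close> cover the space.\<close>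

lemma continuous_on_weighted:
  fixes g :: "'a \<Rightarrow> real"
  assumes K: "compact K" "0 \<notin> K" and g: "continuous_on UNIV g" and g0: "\<And>X. X \<notin> K \<Longrightarrow> g X = 0"
  shows "continuous_on UNIV (\<lambda>X. g X * qn X powr a)"
proof -
  have "continuous_on (- {0}) (\<lambda>X. g X * qn X powr a)"
    by (intro continuous_intros continuous_on_qn continuous_on_subset[OF g]) (auto simp: qn_eq_0_iff)
  moreover have "continuous_on (- K) (\<lambda>X. g X * qn X powr a)"
    by (rule continuous_on_eq[OF continuous_on_const[of _ 0]]) (simp add: g0)
  ultimately have "continuous_on (- {0} \<union> - K) (\<lambda>X. g X * qn X powr a)"
    using compact_imp_closed[OF K(1)] by (intro continuous_on_open_Un) auto
  moreover have "- {0} \<union> - K = UNIV" using K(2) by auto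
  ultimately show ?thesis by simp
qed

text \<open>The weight is homogeneous of degree \<open>- 2 * \<alpha> - 2\<close>, so the orbit
  derivative of the weighted square of \<open>F\<close> is known explicitly. Integrating it by
  \<open>integral_orbit_derivative\<close> evaluates the cross term
  \<open>F X \<bullet> euler F X\<close> as \<open>- \<kappa>\<close> times the weighted square
  norm, and the identity follows on expanding the last square.\<close>

lemma hardy_identity:
  fixes F :: "'a \<Rightarrow> complex" and \<alpha> :: real
  defines "\<kappa> \<equiv> (operator_trace A - 2 * \<alpha> - 2) / 2"
  assumes F: "smooth_on UNIV F" and K: "compact K" "0 \<notin> K" and F0: "\<And>X. X \<notin> K \<Longrightarrow> F X = 0"
  shows "(\<integral>X. (cmod (euler F X))\<^sup>2 * qn X powr (- 2 * \<alpha> - 2) \<partial>lborel)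
    = \<kappa>\<^sup>2 * (\<integral>X. (cmod (F X))\<^sup>2 * qn X powr (- 2 * \<alpha> - 2) \<partial>lborel)
      + (\<integral>X. (cmod (euler F X + \<kappa> *\<^sub>R F X))\<^sup>2 * qn X powr (- 2 * \<alpha> - 2) \<partial>lborel)"
proof -
  let ?w = "\<lambda>X. qn X powr (- 2 * \<alpha> - 2)"
  have cF: "continuous_on UNIV F" and cE: "continuous_on UNIV (euler F)"
    using smooth_on_continuous_on[OF F] continuous_on_euler[OF F] by auto
  have e0: "euler F X = 0" if "X \<notin> K" for X
    using euler_outside[OF compact_imp_closed[OF K(1)] F0 that] by simp
  have c: "continuous_on UNIV (\<lambda>X. (F X \<bullet> F X) * ?w X)" "continuous_on UNIV (\<lambda>X. (F X \<bullet> euler F X) * ?w X)"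
    "continuous_on UNIV (\<lambda>X. (euler F X \<bullet> euler F X) * ?w X)"
    by (rule continuous_on_weighted[OF K]; (intro continuous_intros cF cE)?; simp add: F0 e0)+
  have i: "integrable lborel (\<lambda>X. (F X \<bullet> F X) * ?w X)" "integrable lborel (\<lambda>X. (F X \<bullet> euler F X) * ?w X)"
    "integrable lborel (\<lambda>X. (euler F X \<bullet> euler F X) * ?w X)"
    by (rule integrable_compact_support[OF K(1)]; (intro c)?; simp add: F0 e0)+
  have "(\<integral>X. 2 * ((F X \<bullet> euler F X) * ?w X) - (2 * \<alpha> + 2) * ((F X \<bullet> F X) * ?w X) \<partial>lborel)
      = - operator_trace A * (\<integral>X. (F X \<bullet> F X) * ?w X \<partial>lborel)"
  proof (rule integral_orbit_derivative[OF K(1)])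
    fix t X
    note o = orbit_has_vector_derivative[OF F, of X t, unfolded has_vector_derivative_def]
    have 1: "((\<lambda>t. F (dil (exp t) X) \<bullet> F (dil (exp t) X)) has_real_derivative
        2 * (F (dil (exp t) X) \<bullet> euler F (dil (exp t) X))) (at t)"
      by (rule has_derivative_imp_has_field_derivative[OF has_derivative_inner[OF o o]])
        (simp add: inner_commute algebra_simps)
    have 2: "((\<lambda>t. exp ((- 2 * \<alpha> - 2) * t) * ?w X) has_real_derivative (- 2 * \<alpha> - 2) * (exp ((- 2 * \<alpha> - 2) * t) * ?w X)) (at t)"
      by (auto intro!: derivative_eq_intros)
    have w: "exp ((- 2 * \<alpha> - 2) * t) * ?w X = ?w (dil (exp t) X)" for t
      using qn_nonneg[of X] by (simp add: qn_dil powr_mult) (simp add: powr_def)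
    show "((\<lambda>t. (F (dil (exp t) X) \<bullet> F (dil (exp t) X)) * ?w (dil (exp t) X)) has_vector_derivative
       2 * ((F (dil (exp t) X) \<bullet> euler F (dil (exp t) X)) * ?w (dil (exp t) X))
        - (2 * \<alpha> + 2) * ((F (dil (exp t) X) \<bullet> F (dil (exp t) X)) * ?w (dil (exp t) X))) (at t)"
      unfolding has_real_derivative_iff_has_vector_derivative[symmetric]
      by (rule DERIV_cong[OF DERIV_mult[OF 1 2[unfolded w]]]) (simp add: algebra_simps)
  next
    show "continuous_on UNIV (\<lambda>X. 2 * ((F X \<bullet> euler F X) * ?w X) - (2 * \<alpha> + 2) * ((F X \<bullet> F X) * ?w X))"
      by (intro continuous_on_diff continuous_on_mult_left c)
    show "continuous_on UNIV (\<lambda>X. (F X \<bullet> F X) * ?w X)" by (rule c)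
  qed (simp add: F0)
  then have C: "(\<integral>X. (F X \<bullet> euler F X) * ?w X \<partial>lborel) = - \<kappa> * (\<integral>X. (F X \<bullet> F X) * ?w X \<partial>lborel)"
    using i by (simp add: \<kappa>_def field_simps)
  have "(\<integral>X. (cmod (euler F X + \<kappa> *\<^sub>R F X))\<^sup>2 * ?w X \<partial>lborel)
    = (\<integral>X. (euler F X \<bullet> euler F X) * ?w X + 2 * \<kappa> * ((F X \<bullet> euler F X) * ?w X) + \<kappa>\<^sup>2 * ((F X \<bullet> F X) * ?w X) \<partial>lborel)"
    unfolding power2_norm_eq_inner
    by (intro Bochner_Integration.integral_cong refl)
      (simp add: inner_add_left inner_add_right inner_commute algebra_simps power2_eq_square)
  also have "\<dots> = (\<integral>X. (euler F X \<bullet> euler F X) * ?w X \<partial>lborel) + 2 * \<kappa> * (\<integral>X. (F X \<bullet> euler F X) * ?w X \<partial>lborel)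
      + \<kappa>\<^sup>2 * (\<integral>X. (F X \<bullet> F X) * ?w X \<partial>lborel)"
    using i by simp
  finally show ?thesis
    unfolding power2_norm_eq_inner C by (simp add: power2_eq_square)
qed

text \<open>The hypothesis makes \<open>exp (\<kappa> * s) *\<^sub>R F (dil (exp s) X)\<close>
  constant in \<open>s\<close>, while the orbit of \<open>X\<close> leaves \<open>K\<close>.\<close>

lemma homogeneous_compact_support_eq_0:
  fixes F :: "'a \<Rightarrow> complex"
  assumes F: "smooth_on UNIV F" and K: "compact K" "0 \<notin> K" and F0: "\<And>X. X \<notin> K \<Longrightarrow> F X = 0"
    and h: "\<And>X. X \<noteq> 0 \<Longrightarrow> euler F X + \<kappa> *\<^sub>R F X = 0"
  shows "F X = 0"
proof (cases "X = 0")
  case False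
  have "bounded (qn ` K)" by (intro compact_imp_bounded compact_continuous_image continuous_on_qn K)
  then obtain M where M: "\<And>Y. Y \<in> K \<Longrightarrow> \<bar>qn Y\<bar> \<le> M" unfolding bounded_iff by auto
  \<comment> \<open>The time at which the orbit reaches quasi-norm \<open>|M| + 1\<close>, above
    every value on \<open>K\<close>.\<close>
  define t where "t = ln ((\<bar>M\<bar> + 1) / qn X)"
  have q: "qn X > 0" using False by (rule qn_pos)
  have "qn (dil (exp t) X) = \<bar>M\<bar> + 1"
    using q by (simp add: qn_dil t_def)
  then have out: "dil (exp t) X \<notin> K" using M[of "dil (exp t) X"] by fastforce
  have nz: "dil (exp s) X \<noteq> 0" for s
    using False dil_inverse(1)[of "exp s" X] by (metis dil_0 exp_gt_zero zero_less_divide_1_iff)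
  have "((\<lambda>s. exp (\<kappa> * s) *\<^sub>R F (dil (exp s) X)) has_vector_derivative 0) (at s)" for s
  proof -
    have "((\<lambda>s. exp (\<kappa> * s)) has_real_derivative \<kappa> * exp (\<kappa> * s)) (at s)"
      by (auto intro!: derivative_eq_intros)
    from has_vector_derivative_scaleR[OF this orbit_has_vector_derivative[OF F]]
    have "((\<lambda>s. exp (\<kappa> * s) *\<^sub>R F (dil (exp s) X)) has_vector_derivative
        exp (\<kappa> * s) *\<^sub>R euler F (dil (exp s) X) + (\<kappa> * exp (\<kappa> * s)) *\<^sub>R F (dil (exp s) X)) (at s)" .
    moreover have "exp (\<kappa> * s) *\<^sub>R euler F (dil (exp s) X) + (\<kappa> * exp (\<kappa> * s)) *\<^sub>R F (dil (exp s) X)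
        = exp (\<kappa> * s) *\<^sub>R (euler F (dil (exp s) X) + \<kappa> *\<^sub>R F (dil (exp s) X))"
      by (simp add: scaleR_add_right mult.commute)
    ultimately show ?thesis using h[OF nz] by simp
  qed
  then have "exp (\<kappa> * t) *\<^sub>R F (dil (exp t) X) = exp (\<kappa> * 0) *\<^sub>R F (dil (exp 0) X)"
    by (intro has_derivative_zero_unique_connected[OF open_UNIV connected_UNIV, of "\<lambda>s. exp (\<kappa> * s) *\<^sub>R F (dil (exp s) X)"])
      (simp_all add: has_vector_derivative_def)
  then show ?thesis using F0[OF out] by simp
qed (use F0 K in auto)

section \<open>Test functions and norms in exponential coordinates\<close>

lemma test_function_coordinates:
  assumes "f \<in> test_functions \<A>"
  obtains K where "smooth_on UNIV (\<lambda>X. f (E X))" "compact K" "0 \<notin> K" "\<And>X. X \<notin> K \<Longrightarrow> f (E X) = 0"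
proof -
  have f: "smooth_from \<A> f" "compact (closure {x. f x \<noteq> 0})" "0 \<notin> closure {x. f x \<noteq> 0}"
    using assms by (auto simp: test_functions_def)
  let ?K = "inv E ` closure {x. f x \<noteq> 0}"
  have "smooth_on UNIV (\<lambda>X. f (E X))" by (rule smooth_from_compose[OF f(1) open_UNIV smooth_map_E])
  moreover have "compact ?K" by (intro compact_continuous_image continuous_on_inv_E f)
  moreover have "0 \<notin> ?K"
  proof
    assume "0 \<in> ?K"
    then obtain x where x: "0 = inv E x" "x \<in> closure {x. f x \<noteq> 0}" by (rule imageE)
    then have "x = 0" using E_inv_E[of x] E_0 by simp
    then show False using x f(3) by simp
  qed
  moreover have "f (E X) = 0" if "X \<notin> ?K" for X
  proof (rule ccontr)
    assume "f (E X) \<noteq> 0"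
    then have "E X \<in> closure {x. f x \<noteq> 0}" using closure_subset[of "{x. f x \<noteq> 0}"] by auto
    then have "inv E (E X) \<in> ?K" by (rule imageI)
    then show False using that by (simp add: inv_E_E)
  qed
  ultimately show ?thesis by (rule that)
qed

lemma test_functionI:
  assumes F: "smooth_on UNIV F" and K: "compact K" "0 \<notin> K" and F0: "\<And>X. X \<notin> K \<Longrightarrow> F X = 0"
  shows "(\<lambda>x. F (inv E x)) \<in> test_functions \<A>"
proof -
  have "smooth_on S (\<lambda>p. F (inv E (c p)))" if "open S" "smooth_map S c" for S and c :: "'a \<Rightarrow> 'g"
    by (rule smooth_on_compose[OF that(1) smooth_inv_E[OF that] F]) simp
  then have "smooth_from \<A> (\<lambda>x. F (inv E x))" by (rule smooth_fromI)
  moreover have cE: "compact (E ` K)" by (intro compact_continuous_image continuous_on_E K)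
  then have "closed (E ` K)" by (rule compact_imp_closed)
  moreover have "{x. F (inv E x) \<noteq> 0} \<subseteq> E ` K"
  proof
    fix x assume "x \<in> {x. F (inv E x) \<noteq> 0}"
    then have "inv E x \<in> K" using F0 by auto
    then show "x \<in> E ` K" using E_inv_E[of x] by (metis imageI)
  qed
  ultimately have cl: "closure {x. F (inv E x) \<noteq> 0} \<subseteq> E ` K" by (simp add: closure_minimal)
  then have "compact (closure {x. F (inv E x) \<noteq> 0})"
    using compact_Int_closed[OF cE closed_closure[of "{x. F (inv E x) \<noteq> 0}"]] by (simp add: Int_absorb1)
  moreover have "0 \<notin> E ` K"
  proof
    assume "0 \<in> E ` K"
    then obtain X where X: "0 = E X" "X \<in> K" by (rule imageE)
    then have "X = 0" using inv_E_E[of X] inv_E_E[of 0] E_0 by simp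
    then show False using X K(2) by simp
  qed
  ultimately show ?thesis using \<open>smooth_from \<A> _\<close> cl by (auto simp: test_functions_def)
qed

lemma haar_integral_coordinates:
  fixes g :: "'g \<Rightarrow> real"
  assumes \<mu>: "sets \<mu> = sets borel" "distr \<mu> borel (inv E) = density lborel (\<lambda>_. ennreal c)" and c: "c > 0"
    and g: "g \<in> borel_measurable borel"
  shows "integrable \<mu> g \<longleftrightarrow> integrable lborel (\<lambda>X. g (E X))"
    and "(\<integral>x. g x \<partial>\<mu>) = c * (\<integral>X. g (E X) \<partial>lborel)"
proof -
  have [measurable]: "E \<in> borel_measurable borel" "inv E \<in> borel_measurable borel"
    by (intro borel_measurable_continuous_onI continuous_on_E continuous_on_inv_E)+
  have [measurable_cong]: "sets \<mu> = sets borel" by fact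
  have i: "inv E \<in> measurable \<mu> borel" by measurable
  have gE: "(\<lambda>X. g (E X)) \<in> borel_measurable borel" using g by measurable
  have "integrable \<mu> g \<longleftrightarrow> integrable (distr \<mu> borel (inv E)) (\<lambda>X. g (E X))"
    using integrable_distr_eq[OF i gE] by (simp add: E_inv_E)
  also have "\<dots> \<longleftrightarrow> integrable lborel (\<lambda>X. g (E X))"
    unfolding \<mu>(2) using gE c by (subst integrable_density) auto
  finally show "integrable \<mu> g \<longleftrightarrow> integrable lborel (\<lambda>X. g (E X))" .
  have "(\<integral>x. g x \<partial>\<mu>) = (\<integral>X. g (E X) \<partial>distr \<mu> borel (inv E))"
    using integral_distr[OF i gE] by (simp add: E_inv_E)
  also have "\<dots> = c * (\<integral>X. g (E X) \<partial>lborel)"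
    unfolding \<mu>(2) using gE c by (subst integral_density) auto
  finally show "(\<integral>x. g x \<partial>\<mu>) = c * (\<integral>X. g (E X) \<partial>lborel)" .
qed

lemma hardy_norms:
  fixes f :: "'g \<Rightarrow> complex"
  assumes \<mu>: "sets \<mu> = sets borel" "distr \<mu> borel (inv E) = density lborel (\<lambda>_. ennreal c)" and c: "c > 0"
    and F: "smooth_on UNIV (\<lambda>X. f (E X))" and K: "compact K" "0 \<notin> K" and F0: "\<And>X. X \<notin> K \<Longrightarrow> f (E X) = 0"
  shows "square_integrable \<mu> (\<lambda>x. f x / of_real (N x powr (\<alpha> + 1)))"
    and "square_integrable \<mu> (\<lambda>x. 1 / of_real (N x powr \<alpha>) * radial_derivative E A N f x)"
    and "L2_norm \<mu> (\<lambda>x. f x / of_real (N x powr (\<alpha> + 1)))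
      = sqrt (c * (\<integral>X. (cmod (f (E X)))\<^sup>2 * qn X powr (- 2 * \<alpha> - 2) \<partial>lborel))"
    and "L2_norm \<mu> (\<lambda>x. 1 / of_real (N x powr \<alpha>) * radial_derivative E A N f x)
      = sqrt (c * (\<integral>X. (cmod (euler (\<lambda>X. f (E X)) X))\<^sup>2 * qn X powr (- 2 * \<alpha> - 2) \<partial>lborel))"
proof -
  let ?F = "\<lambda>X. f (E X)"
  let ?v = "\<lambda>x. f x / of_real (N x powr (\<alpha> + 1))"
  let ?w = "\<lambda>x. 1 / of_real (N x powr \<alpha>) * radial_derivative E A N f x"
  have sq: "(a powr (b + 1))\<^sup>2 = 1 / a powr (- 2 * b - 2)" if "a > 0" for a b :: real
  proof -
    have "(a powr (b + 1))\<^sup>2 = a powr (2 * b + 2)" by (simp add: power2_eq_square powr_add[symmetric])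
    also have "\<dots> = 1 / a powr (- (2 * b + 2))" by (simp only: powr_minus_divide) simp
    also have "- (2 * b + 2) = - 2 * b - 2" by simp
    finally show ?thesis .
  qed
  have cF: "continuous_on UNIV ?F" and cE: "continuous_on UNIV (euler ?F)"
    using smooth_on_continuous_on[OF F] continuous_on_euler[OF F] by auto
  have e0: "euler ?F X = 0" if "X \<notin> K" for X
    using euler_outside[OF compact_imp_closed[OF K(1)] F0 that] by simp
  \<comment> \<open>At \<open>X = 0\<close> both sides are \<open>0\<close>, because
    \<open>0 powr \<alpha> = 0\<close> and division by zero gives \<open>0\<close>.\<close>
  have wE: "?w (E X) = 1 / of_real (qn X powr \<alpha>) * ((1 / qn X) *\<^sub>R euler ?F X)" for X
  proof (cases "X = 0")
    case True
    then have "qn X = 0" by (simp add: qn_eq_0_iff)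
    then show ?thesis by (simp add: qn_def)
  next
    case False
    show ?thesis unfolding radial_derivative_coordinates[OF F False] qn_def ..
  qed
  have v2: "(cmod (?v (E X)))\<^sup>2 = (cmod (?F X))\<^sup>2 * qn X powr (- 2 * \<alpha> - 2)" for X
  proof (cases "X = 0")
    case True
    then show ?thesis using F0[of 0] K(2) by simp
  next
    case False
    then show ?thesis using qn_pos[OF False] sq[of "qn X" \<alpha>]
      by (simp add: norm_divide power_divide qn_def[symmetric])
  qed
  have w2: "(cmod (?w (E X)))\<^sup>2 = (cmod (euler ?F X))\<^sup>2 * qn X powr (- 2 * \<alpha> - 2)" for X
  proof (cases "X = 0")
    case True
    then show ?thesis unfolding wE using e0[of 0] K(2) by simp
  next
    case False
    have "qn X powr \<alpha> * qn X = qn X powr (\<alpha> + 1)" using qn_pos[OF False] by (simp add: powr_add)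
    then have "(qn X powr \<alpha>)\<^sup>2 * (qn X)\<^sup>2 = 1 / qn X powr (- 2 * \<alpha> - 2)"
      using sq[OF qn_pos[OF False], of \<alpha>] by (metis power_mult_distrib)
    then show ?thesis unfolding wE using qn_pos[OF False]
      by (simp add: norm_divide norm_mult power_mult_distrib power_divide divide_simps mult_ac)
  qed
  have [measurable]: "inv E \<in> borel_measurable borel" "E \<in> borel_measurable borel"
    by (intro borel_measurable_continuous_onI continuous_on_inv_E continuous_on_E)+
  have [measurable]: "qn \<in> borel_measurable borel" "?F \<in> borel_measurable borel" "euler ?F \<in> borel_measurable borel"
    by (intro borel_measurable_continuous_onI continuous_on_qn cF cE)+
  have viaE: "h \<in> borel_measurable borel" if "(\<lambda>X. h (E X)) \<in> borel_measurable borel" for h :: "'g \<Rightarrow> complex"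
    using measurable_compose[OF \<open>inv E \<in> borel_measurable borel\<close> that] by (simp add: E_inv_E)
  have "(\<lambda>X. ?v (E X)) = (\<lambda>X. ?F X / of_real (qn X powr (\<alpha> + 1)))" by (simp add: qn_def)
  then have "(\<lambda>X. ?v (E X)) \<in> borel_measurable borel" by simp
  then have vm: "?v \<in> borel_measurable borel" by (rule viaE)
  have "(\<lambda>X. ?w (E X)) \<in> borel_measurable borel" unfolding wE by measurable
  then have wm: "?w \<in> borel_measurable borel" by (rule viaE)
  have vm2: "(\<lambda>x. (cmod (?v x))\<^sup>2) \<in> borel_measurable borel" using vm by measurable
  have wm2: "(\<lambda>x. (cmod (?w x))\<^sup>2) \<in> borel_measurable borel"
    by (rule measurable_compose[OF wm]) measurable
  have cc: "continuous_on UNIV (\<lambda>X. (cmod (?F X))\<^sup>2 * qn X powr (- 2 * \<alpha> - 2))"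
    "continuous_on UNIV (\<lambda>X. (cmod (euler ?F X))\<^sup>2 * qn X powr (- 2 * \<alpha> - 2))"
    by (rule continuous_on_weighted[OF K]; (intro continuous_intros cF cE)?; simp add: F0 e0)+
  have ii: "integrable lborel (\<lambda>X. (cmod (?F X))\<^sup>2 * qn X powr (- 2 * \<alpha> - 2))"
    "integrable lborel (\<lambda>X. (cmod (euler ?F X))\<^sup>2 * qn X powr (- 2 * \<alpha> - 2))"
    by (rule integrable_compact_support[OF K(1)]; (intro cc)?; simp add: F0 e0)+
  have m: "h \<in> borel_measurable \<mu>" if "h \<in> borel_measurable borel" for h :: "'g \<Rightarrow> complex"
    using that measurable_cong_sets[OF \<mu>(1) refl] by blast
  show "square_integrable \<mu> ?v"
    unfolding square_integrable_def haar_integral_coordinates(1)[OF \<mu> c vm2] v2 using m[OF vm] ii by simp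
  show "square_integrable \<mu> ?w"
    unfolding square_integrable_def haar_integral_coordinates(1)[OF \<mu> c wm2] w2 using m[OF wm] ii by simp
  show "L2_norm \<mu> ?v = sqrt (c * (\<integral>X. (cmod (?F X))\<^sup>2 * qn X powr (- 2 * \<alpha> - 2) \<partial>lborel))"
    unfolding L2_norm_def haar_integral_coordinates(2)[OF \<mu> c vm2] v2 ..
  show "L2_norm \<mu> ?w = sqrt (c * (\<integral>X. (cmod (euler ?F X))\<^sup>2 * qn X powr (- 2 * \<alpha> - 2) \<partial>lborel))"
    unfolding L2_norm_def haar_integral_coordinates(2)[OF \<mu> c wm2] w2 ..
qed

end

section \<open>Sharpness of the constant\<close>

lemma smooth_on_powr_compose:
  "open S \<Longrightarrow> smooth_on S f \<Longrightarrow> (\<And>x. x \<in> S \<Longrightarrow> f x > 0) \<Longrightarrow> smooth_on S (\<lambda>x. f x powr a)" for f :: "_ \<Rightarrow> real"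
  by (rule smooth_on_compose[OF _ _ smooth_on_powr]) auto

text \<open>With \<open>y = 1 / x\<close> the bound by \<open>2\<close> is
  \<open>y\<^sup>2 / 2 \<le> exp y\<close>.\<close>

lemma flat_exp_le: "flat_exp 0 x \<le> 1" "flat_exp 2 x \<le> 2" "flat_exp 2 x \<ge> 0"
proof -
  show "flat_exp 0 x \<le> 1" "flat_exp 2 x \<ge> 0" by (auto simp: flat_exp_def)
  show "flat_exp 2 x \<le> 2"
  proof (cases "x > 0")
    case True
    have "1 + 1 / x + (1 / x)\<^sup>2 / 2 \<le> exp (1 / x)" using True by (intro exp_lower_Taylor_quadratic) simp
    moreover have "1 / x > 0" using True by simp
    ultimately have "(1 / x)\<^sup>2 \<le> 2 * exp (1 / x)" by linarith
    then show ?thesis using True by (simp add: flat_exp_def exp_minus field_simps)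
  qed (simp add: flat_exp_def)
qed

definition cutoff :: "real \<Rightarrow> real" where
  "cutoff s = flat_exp 0 s * flat_exp 0 (1 - s)"

definition cutoff' :: "real \<Rightarrow> real" where
  "cutoff' s = flat_exp 2 s * flat_exp 0 (1 - s) - flat_exp 0 s * flat_exp 2 (1 - s)"

lemma cutoff_has_derivative: "(cutoff has_real_derivative cutoff' s) (at s)"
proof -
  have 1: "(flat_exp 0 has_real_derivative flat_exp 2 s) (at s)" for s
    using flat_exp_has_derivative[of 0 s] by (simp add: numeral_2_eq_2)
  have 2: "((\<lambda>s. flat_exp 0 (1 - s)) has_real_derivative flat_exp 2 (1 - s) * (- 1)) (at s)"
    by (rule DERIV_chain2[OF 1]) (auto intro!: derivative_eq_intros)
  show ?thesis
    unfolding cutoff_def cutoff'_def by (rule DERIV_cong[OF DERIV_mult[OF 1 2]]) simp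
qed

lemma cutoff'_bound: "(cutoff' s)\<^sup>2 \<le> 4"
proof -
  have "0 \<le> flat_exp 2 s * flat_exp 0 (1 - s)" "flat_exp 2 s * flat_exp 0 (1 - s) \<le> 2 * 1"
    "0 \<le> flat_exp 0 s * flat_exp 2 (1 - s)" "flat_exp 0 s * flat_exp 2 (1 - s) \<le> 1 * 2"
    by (intro mult_nonneg_nonneg mult_mono flat_exp_le flat_exp_nonneg; simp)+
  then have "\<bar>cutoff' s\<bar> \<le> \<bar>2\<bar>" by (simp add: cutoff'_def)
  then have "(cutoff' s)\<^sup>2 \<le> 2\<^sup>2" by (simp only: abs_le_square_iff)
  then show ?thesis by simp
qed

lemma cutoff_0: "cutoff s = 0" "cutoff' s = 0" if "s \<le> 0 \<or> 1 \<le> s"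
  using that by (auto simp: cutoff_def cutoff'_def flat_exp_def)

text \<open>Both \<open>s\<close> and \<open>1 - s\<close> are at least \<open>1 / 4\<close>, so
  each factor of the cut-off is at least \<open>exp (- 4)\<close>.\<close>

lemma cutoff_ge: assumes "1 / 4 \<le> s" "s \<le> 3 / 4" shows "exp (- 16) \<le> (cutoff s)\<^sup>2"
proof -
  have f: "exp (- 4) \<le> flat_exp 0 t" if "1 / 4 \<le> t" for t
    using that by (simp add: flat_exp_def field_simps)
  have "exp (- 4) * exp (- 4) \<le> cutoff s"
    unfolding cutoff_def using assms by (intro mult_mono f) (auto simp: flat_exp_nonneg)
  then have "(exp (- 4) * exp (- 4))\<^sup>2 \<le> (cutoff s)\<^sup>2" by (intro power_mono) auto
  then show ?thesis by (simp add: power2_eq_square exp_add[symmetric])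
qed

context quasi_normed_group
begin

lemma integral_eq_0_imp_eq_0:
  fixes g :: "'a \<Rightarrow> real"
  assumes i: "integrable lborel g" and g: "continuous_on UNIV g" "\<And>X. g X \<ge> 0" and 0: "(\<integral>X. g X \<partial>lborel) = 0"
  shows "g X = 0"
proof -
  obtain a' where "{X} \<subseteq> box (- a') a'"
    using bounded_subset_box_symmetric[of "{X}"] by auto
  then obtain a b where ab: "X \<in> box a b" by blast
  then have ne: "box a b \<noteq> {}" by auto
  have "(g has_integral 0) UNIV" using has_integral_integral_lborel[OF i] 0 by simp
  then have int: "g integrable_on UNIV" "integral UNIV g = 0" by (auto simp: has_integral_iff)
  have cb: "g integrable_on cbox a b" using g(1) by (intro integrable_continuous continuous_on_subset[OF g(1)]) auto
  have "integral (cbox a b) g \<le> integral UNIV g"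
    using int cb g(2) by (intro integral_subset_le) auto
  moreover have "integral (cbox a b) g \<ge> 0" using cb g(2) by (intro integral_nonneg) auto
  ultimately have "(g has_integral 0) (cbox a b)" using cb int by (simp add: has_integral_iff)
  then show ?thesis
    using has_integral_0_cbox_imp_0[of a b g X] g ne ab box_subset_cbox[of a b]
    by (auto intro: continuous_on_subset)
qed

text \<open>Stated in \<open>ennreal\<close> because it is applied to masses whose finiteness is
  established only afterwards.\<close>

lemma nn_integral_dil:
  fixes h :: "'a \<Rightarrow> ennreal"
  assumes "h \<in> borel_measurable borel"
  shows "(\<integral>\<^sup>+ X. h (dil (exp t) X) \<partial>lborel) = ennreal (exp (- operator_trace A * t)) * (\<integral>\<^sup>+ X. h X \<partial>lborel)"
proof -
  have m: "dil (exp t) \<in> borel_measurable borel"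
    by (intro borel_measurable_continuous_onI linear_continuous_on dil_bounded_linear) simp
  have "distr lborel borel (dil (exp t)) = density lborel (\<lambda>_. ennreal (exp (- t) powr operator_trace A))"
    using distr_dil[of "exp (- t)"] by (simp add: exp_minus inverse_eq_divide)
  then have "(\<integral>\<^sup>+ X. h (dil (exp t) X) \<partial>lborel) = (\<integral>\<^sup>+ X. h X \<partial>density lborel (\<lambda>_. ennreal (exp (- t) powr operator_trace A)))"
    using nn_integral_distr[of "dil (exp t)" lborel borel h] m assms by simp
  also have "\<dots> = ennreal (exp (- t) powr operator_trace A) * (\<integral>\<^sup>+ X. h X \<partial>lborel)"
    using assms by (simp add: nn_integral_density nn_integral_cmult)
  finally show ?thesis by (simp add: powr_def mult.commute)
qed

text \<open>The extremal profile \<open>\<rho>\<^sup>-\<^sup>\<kappa>\<close> is truncated at logarithmic scale \<open>R\<close> and localised to a cone around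
  an eigenvector \<open>b\<^sub>1\<close> of \<open>A\<close>, where \<open>T = ln x\<^sub>1 / \<nu>\<^sub>1\<close> is a smooth logarithmic radius and the
  \<open>x\<^sub>b x\<^sub>1\<^bsup>- \<nu>\<^sub>b / \<nu>\<^sub>1\<^esup>\<close> are smooth coordinates of the orbits. Both integrals are compared with the mass
  of the cells \<open>k \<le> T < k + 1\<close>, which does not depend on \<open>k\<close>.\<close>

lemma almost_extremal_exists:
  fixes \<alpha> \<kappa> :: real
  assumes \<kappa>: "2 * \<kappa> + 2 * \<alpha> + 2 = operator_trace A" and \<epsilon>: "\<epsilon> > 0"
  obtains F :: "'a \<Rightarrow> complex" and K where "smooth_on UNIV F" "compact K" "0 \<notin> K" "\<And>X. X \<notin> K \<Longrightarrow> F X = 0"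
    "(\<integral>X. (cmod (F X))\<^sup>2 * qn X powr (- 2 * \<alpha> - 2) \<partial>lborel) > 0"
    "(\<integral>X. (cmod (euler F X + \<kappa> *\<^sub>R F X))\<^sup>2 * qn X powr (- 2 * \<alpha> - 2) \<partial>lborel)
      \<le> \<epsilon> * (\<integral>X. (cmod (F X))\<^sup>2 * qn X powr (- 2 * \<alpha> - 2) \<partial>lborel)"
proof -
  let ?w = "\<lambda>X. qn X powr (- 2 * \<alpha> - 2)"
  have "eigenbasis \<noteq> {}"
  proof
    assume "eigenbasis = {}"
    then have "(UNIV :: 'a set) = {0}" using eigenbasis(3) by simp
    then show False using nonempty_Basis nonzero_Basis by blast
  qed
  then obtain b1 where b1: "b1 \<in> eigenbasis" by blast
  define \<nu> where "\<nu> = eigenvalue b1"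
  have \<nu>: "\<nu> > 0" using eigenvalue(1)[OF b1] by (simp add: \<nu>_def)
  define x1 where "x1 = coord b1"
  define \<Omega> where "\<Omega> = {X. x1 X > 0}"
  define T where "T = (\<lambda>X. ln (x1 X) / \<nu>)"
  \<comment> \<open>\<open>S < 1\<close> describes a dilation-invariant cone whose slice
    \<open>x1 = 1\<close> is bounded.\<close>
  define S where "S = (\<lambda>X. \<Sum>b\<in>eigenbasis - {b1}. (coord b X * x1 X powr (- eigenvalue b / \<nu>))\<^sup>2)"
  \<comment> \<open>Homogeneous of degree \<open>- \<kappa>\<close>, as \<open>x1\<close> has degree
    \<open>\<nu>\<close>; the second factor is constant on orbits and vanishes outside the
    cone.\<close>
  define P where "P = (\<lambda>X. x1 X powr (- \<kappa> / \<nu>) * flat_exp 0 (1 - S X))"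
  have x1l: "bounded_linear x1" unfolding x1_def by (rule coord_linear)
  have \<Omega>: "open \<Omega>"
    unfolding \<Omega>_def by (intro open_Collect_less continuous_on_const linear_continuous_on x1l)
  have x1d: "x1 (dil (exp t) X) = exp (\<nu> * t) * x1 X" for t X
    unfolding x1_def \<nu>_def using b1 by (simp add: coord_dil powr_def)
  have \<Omega>d: "dil (exp t) X \<in> \<Omega> \<longleftrightarrow> X \<in> \<Omega>" for t X
    by (simp add: \<Omega>_def x1d zero_less_mult_iff)
  have Td: "T (dil (exp t) X) = T X + t" if "X \<in> \<Omega>" for t X
    using that \<nu> by (simp add: T_def x1d \<Omega>_def ln_mult add_divide_distrib)
  have x1p: "(exp (\<nu> * t) * x1 X) powr a = exp (a * (\<nu> * t)) * x1 X powr a" if "X \<in> \<Omega>" for t X a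
    using that by (simp add: powr_mult \<Omega>_def) (simp add: powr_def)
  have Sd: "S (dil (exp t) X) = S X" if "X \<in> \<Omega>" for t X
    unfolding S_def
  proof (intro sum.cong refl)
    fix b assume "b \<in> eigenbasis - {b1}"
    then have "coord b (dil (exp t) X) = exp (eigenvalue b * t) * coord b X" by (simp add: coord_dil powr_def)
    moreover have "exp (- eigenvalue b / \<nu> * (\<nu> * t)) = exp (- (eigenvalue b * t))" using \<nu> by simp
    ultimately show "(coord b (dil (exp t) X) * x1 (dil (exp t) X) powr (- eigenvalue b / \<nu>))\<^sup>2 = (coord b X * x1 X powr (- eigenvalue b / \<nu>))\<^sup>2"
      unfolding x1d x1p[OF that] by (simp add: exp_minus field_simps)
  qed
  have Pd: "P (dil (exp t) X) = exp (- \<kappa> * t) * P X" if "X \<in> \<Omega>" for t X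
    unfolding P_def Sd[OF that] x1d x1p[OF that] using \<nu> by simp
  \<comment> \<open>The estimates below give \<open>D \<le> m' / j\<close> and
    \<open>V \<ge> 2 * j * m' * exp (- 16)\<close>, so \<open>D\<close> is at most
    \<open>exp 16 / (2 * j\<^sup>2)\<close> times \<open>V\<close>.\<close>
  obtain j :: nat where j: "j > 0" "exp 16 / 2 / \<epsilon> \<le> real j"
  proof -
    obtain n where n: "exp 16 / 2 / \<epsilon> \<le> real n" using real_arch_simple by blast
    show ?thesis by (rule that[of "Suc n"]) (use n in auto)
  qed
  \<comment> \<open>Chosen so that the cut-off is bounded below exactly on the \<open>2 * j\<close>
    cells from \<open>j\<close> to \<open>3 * j\<close>, by \<open>cutoff_ge\<close>.\<close>
  define R where "R = 4 * real j"
  have R: "R > 0" using j by (simp add: R_def)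
  define F :: "'a \<Rightarrow> complex" where "F = (\<lambda>X. if X \<in> \<Omega> then of_real (P X * cutoff (T X / R)) else 0)"
  \<comment> \<open>The slice \<open>T = 0\<close> of the closed cone; the orbit arcs of length
    \<open>R\<close> that start on it cover the support of \<open>F\<close>.\<close>
  define \<Sigma> where "\<Sigma> = {Y. x1 Y = 1} \<inter> {Y. (\<Sum>b\<in>eigenbasis - {b1}. (coord b Y)\<^sup>2) \<le> 1}"
  define K where "K = (\<lambda>z. dil (exp (fst z)) (snd z)) ` ({0..R} \<times> \<Sigma>)"
  have "compact \<Sigma>"
  proof (rule compact_eq_bounded_closed[THEN iffD2], rule conjI)
    show "closed \<Sigma>"
      unfolding \<Sigma>_def by (intro closed_Int closed_Collect_eq closed_Collect_le continuous_intros
          linear_continuous_on x1l coord_linear)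
    show "bounded \<Sigma>"
    proof (rule boundedI)
      fix Y assume Y: "Y \<in> \<Sigma>"
      have "\<bar>coord b Y\<bar> \<le> 1" if b: "b \<in> eigenbasis" for b
      proof (cases "b = b1")
        case False
        have "(coord b Y)\<^sup>2 \<le> (\<Sum>b\<in>eigenbasis - {b1}. (coord b Y)\<^sup>2)"
          using b False eigenbasis(1) by (intro member_le_sum) auto
        also have "\<dots> \<le> 1" using Y by (simp add: \<Sigma>_def)
        finally show ?thesis by (simp add: abs_square_le_1)
      qed (use Y in \<open>simp add: \<Sigma>_def x1_def\<close>)
      then have "norm (\<Sum>b\<in>eigenbasis. coord b Y *\<^sub>R b) \<le> (\<Sum>b\<in>eigenbasis. norm b)"
        by (intro order_trans[OF norm_sum] sum_mono) (simp add: mult_left_le_one_le)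
      then show "norm Y \<le> (\<Sum>b\<in>eigenbasis. norm b)" by (simp add: coord_sum)
    qed
  qed
  then have K: "compact K"
    unfolding K_def by (intro compact_continuous_image continuous_on_dil compact_Times compact_Icc)
  have K\<Omega>: "K \<subseteq> \<Omega>"
    unfolding K_def by (auto simp: \<Omega>d) (auto simp: \<Omega>_def \<Sigma>_def)
  have "0 \<notin> \<Omega>" by (simp add: \<Omega>_def linear_0[OF bounded_linear.linear[OF x1l]])
  then have K0: "0 \<notin> K" using K\<Omega> by auto
  have F0: "F X = 0" if "X \<notin> K" for X
  proof (rule ccontr)
    assume F: "F X \<noteq> 0"
    then have X: "X \<in> \<Omega>" "P X \<noteq> 0" "cutoff (T X / R) \<noteq> 0" by (auto simp: F_def split: if_splits)
    have "\<not> (T X / R \<le> 0 \<or> 1 \<le> T X / R)" using X(3) cutoff_0(1) by blast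
    then have T: "0 \<le> T X" "T X \<le> R" using R by (auto simp: field_simps)
    have "S X < 1" using X(2) by (auto simp: P_def flat_exp_eq_0_iff)
    let ?Y = "dil (exp (- T X)) X"
    have Y: "?Y \<in> \<Omega>" using X(1) by (simp add: \<Omega>d)
    have "x1 ?Y = exp (\<nu> * - T X) * x1 X" by (rule x1d)
    also have "\<dots> = 1" using X(1) \<nu> by (simp add: T_def \<Omega>_def exp_minus)
    finally have x1Y: "x1 ?Y = 1" .
    have "(\<Sum>b\<in>eigenbasis - {b1}. (coord b ?Y)\<^sup>2) = S ?Y" by (simp add: S_def x1Y)
    also have "\<dots> < 1" using Sd[OF X(1)] \<open>S X < 1\<close> by simp
    finally have "?Y \<in> \<Sigma>" using x1Y by (simp add: \<Sigma>_def)
    then have "dil (exp (T X)) ?Y \<in> K"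
      unfolding K_def using T by (intro image_eqI[of _ _ "(T X, ?Y)"]) auto
    then show False using that by (simp add: dil_dil exp_minus)
  qed

  \<comment> \<open>Smoothness and orbit derivative of the truncated profile\<close>
  have coord_smooth: "smooth_on U (coord b)" if "open U" for U b by (rule smooth_on_linear[OF that coord_linear])
  have fe: "smooth_on U (\<lambda>X. flat_exp 0 (g X))" if "open U" "smooth_on U g" for U and g :: "'a \<Rightarrow> real"
    using smooth_on_compose[OF that smooth_on_flat_exp] by simp
  have powx: "smooth_on \<Omega> (\<lambda>X. x1 X powr a)" for a
    by (intro smooth_on_powr_compose \<Omega>) (auto simp: x1_def \<Omega>_def coord_smooth[OF \<Omega>, unfolded \<Omega>_def x1_def])
  have Sm: "smooth_on \<Omega> S"
    unfolding S_def power2_eq_square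
    by (intro smooth_on_sum smooth_on_mult \<Omega> coord_smooth powx) (simp add: eigenbasis(1))
  have "smooth_on \<Omega> (\<lambda>X. ln (x1 X))"
    by (rule smooth_on_compose[OF \<Omega> _ smooth_on_ln]) (use coord_smooth[OF \<Omega>] in \<open>auto simp: x1_def \<Omega>_def\<close>)
  then have Tm: "smooth_on \<Omega> (\<lambda>X. T X / R)"
    using smooth_on_bounded_linear[OF \<Omega> bounded_linear_divide[of "\<nu> * R"]] by (simp add: T_def)
  have "smooth_on \<Omega> (\<lambda>X. P X * cutoff (T X / R))"
    unfolding P_def cutoff_def
    by (intro smooth_on_mult \<Omega> powx fe smooth_on_diff smooth_on_const Sm Tm)
  from smooth_on_bounded_linear[OF \<Omega> bounded_linear_of_real this]
  have F\<Omega>: "smooth_on \<Omega> F"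
    by (subst smooth_on_cong[OF \<Omega>, of F "\<lambda>X. of_real (P X * cutoff (T X / R))"]) (auto simp: F_def)
  have oK: "open (- K)" using compact_imp_closed[OF K] by auto
  have FK: "smooth_on (- K) F"
    by (subst smooth_on_cong[OF oK, of F "\<lambda>_. 0"]) (auto simp: F0 intro: smooth_on_const oK)
  have F: "smooth_on UNIV F"
    by (rule smooth_on_local) (metis ComplI FK F\<Omega> K\<Omega> \<Omega> oK subsetD)
  \<comment> \<open>Along an orbit \<open>P\<close> contributes
    \<open>- \<kappa> *\<^sub>R F X\<close>, which cancels; only the derivative of the cut-off is
    left, and it carries the small factor \<open>1 / R\<close>.\<close>
  have Eu: "euler F X + \<kappa> *\<^sub>R F X = of_real (P X * cutoff' (T X / R) / R)" if X: "X \<in> \<Omega>" for X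
  proof -
    have cd: "((\<lambda>t. cutoff ((T X + t) / R)) has_real_derivative cutoff' ((T X + 0) / R) * (1 / R)) (at 0)"
      by (rule DERIV_chain2[OF cutoff_has_derivative]) (use R in \<open>auto intro!: derivative_eq_intros\<close>)
    have ed: "((\<lambda>t. exp (- \<kappa> * t) * P X) has_real_derivative - \<kappa> * P X) (at 0)"
      by (auto intro!: derivative_eq_intros)
    have "((\<lambda>t. exp (- \<kappa> * t) * P X * cutoff ((T X + t) / R)) has_real_derivative
        - \<kappa> * (P X * cutoff (T X / R)) + P X * cutoff' (T X / R) / R) (at 0)"
      by (rule DERIV_cong[OF DERIV_mult[OF ed cd]]) simp
    then have "((\<lambda>t. of_real (exp (- \<kappa> * t) * P X * cutoff ((T X + t) / R)) :: complex) has_vector_derivative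
        of_real (- \<kappa> * (P X * cutoff (T X / R)) + P X * cutoff' (T X / R) / R)) (at 0)"
      by (intro bounded_linear.has_vector_derivative[OF bounded_linear_of_real])
        (simp add: has_real_derivative_iff_has_vector_derivative)
    moreover have "(\<lambda>t. of_real (exp (- \<kappa> * t) * P X * cutoff ((T X + t) / R))) = (\<lambda>t. F (dil (exp t) X))"
      using X by (simp add: F_def \<Omega>d Td Pd fun_eq_iff)
    ultimately have "euler F X = of_real (- \<kappa> * (P X * cutoff (T X / R)) + P X * cutoff' (T X / R) / R)"
      using orbit_has_vector_derivative[OF F, of X 0] vector_derivative_unique_at by fastforce
    then show ?thesis using X by (simp add: F_def scaleR_conv_of_real)
  qed
  have e0: "euler F X = 0" if "X \<notin> K" for X
    using euler_outside[OF compact_imp_closed[OF K] F0 that] by simp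
  have Eu0: "euler F X + \<kappa> *\<^sub>R F X = 0" if "X \<notin> \<Omega>" for X
  proof -
    have "X \<notin> K" using that K\<Omega> by auto
    then show ?thesis by (simp add: e0 F0)
  qed
  have cF: "continuous_on UNIV F" and cE: "continuous_on UNIV (\<lambda>X. euler F X + \<kappa> *\<^sub>R F X)"
    using smooth_on_continuous_on[OF F] continuous_on_euler[OF F] by (auto intro!: continuous_intros)
  have cc: "continuous_on UNIV (\<lambda>X. (cmod (F X))\<^sup>2 * ?w X)"
    "continuous_on UNIV (\<lambda>X. (cmod (euler F X + \<kappa> *\<^sub>R F X))\<^sup>2 * ?w X)"
    by (rule continuous_on_weighted[OF K K0]; (intro continuous_on_power continuous_on_norm cF cE)?; simp add: F0 e0)+
  have ii: "integrable lborel (\<lambda>X. (cmod (F X))\<^sup>2 * ?w X)"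
    "integrable lborel (\<lambda>X. (cmod (euler F X + \<kappa> *\<^sub>R F X))\<^sup>2 * ?w X)"
    by (rule integrable_compact_support[OF K]; (intro cc)?; simp add: F0 e0)+

  \<comment> \<open>Comparison of both integrals with the cell masses\<close>
  define V where "V = (\<integral>X. (cmod (F X))\<^sup>2 * ?w X \<partial>lborel)"
  define D where "D = (\<integral>X. (cmod (euler F X + \<kappa> *\<^sub>R F X))\<^sup>2 * ?w X \<partial>lborel)"
  have Vnn: "ennreal V = (\<integral>\<^sup>+ X. ennreal ((cmod (F X))\<^sup>2 * ?w X) \<partial>lborel)"
    unfolding V_def by (rule nn_integral_eq_integral[OF ii(1), symmetric]) simp
  have Dnn: "ennreal D = (\<integral>\<^sup>+ X. ennreal ((cmod (euler F X + \<kappa> *\<^sub>R F X))\<^sup>2 * ?w X) \<partial>lborel)"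
    unfolding D_def by (rule nn_integral_eq_integral[OF ii(2), symmetric]) simp
  have V0: "V \<ge> 0" "D \<ge> 0" unfolding V_def D_def by simp_all
  \<comment> \<open>The relation between \<open>\<kappa>\<close> and \<open>\<alpha>\<close> gives
    this density degree minus the homogeneous dimension, so that it defines a dilation-invariant
    measure.\<close>
  define \<Theta> where "\<Theta> = (\<lambda>X. if X \<in> \<Omega> then (P X)\<^sup>2 * ?w X else 0)"
  have \<Theta>d: "\<Theta> (dil (exp t) X) = exp (- operator_trace A * t) * \<Theta> X" for t X
  proof (cases "X \<in> \<Omega>")
    case True
    have "?w (dil (exp t) X) = exp ((- 2 * \<alpha> - 2) * t) * ?w X"
      using qn_nonneg[of X] by (simp add: qn_dil powr_mult) (simp add: powr_def)
    moreover have "exp (- \<kappa> * t) * exp (- \<kappa> * t) * exp ((- 2 * \<alpha> - 2) * t) = exp (- operator_trace A * t)"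
      unfolding \<kappa>[symmetric] exp_add[symmetric] by (simp add: algebra_simps)
    ultimately show ?thesis using True
      by (simp add: \<Theta>_def \<Omega>d Pd power_mult_distrib power2_eq_square mult_ac)
  qed (simp add: \<Theta>_def \<Omega>d)
  have \<Theta>0: "\<Theta> X \<ge> 0" for X by (simp add: \<Theta>_def)
  have [measurable]: "coord b \<in> borel_measurable borel" for b
    by (intro borel_measurable_continuous_onI linear_continuous_on coord_linear)
  have [measurable]: "qn \<in> borel_measurable borel" by (intro borel_measurable_continuous_onI continuous_on_qn)
  have [measurable]: "flat_exp 0 \<in> borel_measurable borel"
    by (intro borel_measurable_continuous_onI smooth_on_continuous_on[OF smooth_on_flat_exp])
  have [measurable]: "x1 \<in> borel_measurable borel" by (simp add: x1_def)
  have [measurable]: "\<Omega> \<in> sets borel" using \<Omega> by simp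
  have [measurable]: "T \<in> borel_measurable borel" unfolding T_def by measurable
  have [measurable]: "P \<in> borel_measurable borel" unfolding P_def S_def by measurable
  have \<Theta>m [measurable]: "\<Theta> \<in> borel_measurable borel" unfolding \<Theta>_def by measurable
  define cell where "cell = (\<lambda>(k::nat) X. indicator {real k ..< real k + 1} (T X) :: ennreal)"
  have [measurable]: "cell k \<in> borel_measurable borel" for k unfolding cell_def by measurable
  define m where "m = (\<integral>\<^sup>+ X. ennreal (\<Theta> X) * cell 0 X \<partial>lborel)"
  \<comment> \<open>The dilation by \<open>exp k\<close> carries cell \<open>0\<close> to cell
    \<open>k\<close> and preserves the measure with density \<open>\<Theta>\<close>.\<close>
  have mk: "(\<integral>\<^sup>+ X. ennreal (\<Theta> X) * cell k X \<partial>lborel) = m" for k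
  proof -
    let ?q = "exp (- operator_trace A * real k)"
    have eq: "ennreal (\<Theta> (dil (exp (real k)) X)) * cell k (dil (exp (real k)) X) = ennreal ?q * (ennreal (\<Theta> X) * cell 0 X)" for X
    proof (cases "X \<in> \<Omega>")
      case True
      then show ?thesis
        unfolding \<Theta>d by (simp add: cell_def Td ennreal_mult \<Theta>0 mult.assoc indicator_def)
    qed (simp add: \<Theta>_def \<Omega>d)
    have "ennreal ?q * (\<integral>\<^sup>+ X. ennreal (\<Theta> X) * cell k X \<partial>lborel) = (\<integral>\<^sup>+ X. ennreal ?q * (ennreal (\<Theta> X) * cell 0 X) \<partial>lborel)"
      using nn_integral_dil[of "\<lambda>X. ennreal (\<Theta> X) * cell k X" "real k"] unfolding eq by simp
    also have "\<dots> = ennreal ?q * m" unfolding m_def by (rule nn_integral_cmult) measurable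
    finally show ?thesis
      by (simp add: ennreal_mult_cancel_left)
  qed
  have sumcell: "(\<integral>\<^sup>+ X. ennreal r * (\<Sum>k\<in>I. ennreal (\<Theta> X) * cell k X) \<partial>lborel) = ennreal r * (of_nat (card I) * m)"
    if "finite I" for I r
    using that by (subst nn_integral_cmult) (simp_all add: nn_integral_sum mk)
  have csum: "(\<Sum>k\<in>I. ennreal (\<Theta> X) * cell k X) = (if nat \<lfloor>T X\<rfloor> \<in> I \<and> 0 \<le> T X then ennreal (\<Theta> X) else 0)"
    if "finite I" for I X
  proof -
    have "cell k X = (if k = nat \<lfloor>T X\<rfloor> \<and> 0 \<le> T X then 1 else 0)" for k
      by (auto simp: cell_def indicator_def) (linarith+)
    then have "(\<Sum>k\<in>I. ennreal (\<Theta> X) * cell k X) = (\<Sum>k\<in>I. if k = nat \<lfloor>T X\<rfloor> then (if 0 \<le> T X then ennreal (\<Theta> X) else 0) else 0)"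
      by (intro sum.cong) auto
    also have "\<dots> = (if nat \<lfloor>T X\<rfloor> \<in> I \<and> 0 \<le> T X then ennreal (\<Theta> X) else 0)"
      using that by (simp add: sum.delta)
    finally show ?thesis .
  qed
  have lower: "ennreal (exp (- 16)) * (of_nat (card {j..<3*j}) * m) \<le> ennreal V"
    unfolding sumcell[OF finite_atLeastLessThan, symmetric] Vnn
  proof (rule nn_integral_mono)
    fix X
    show "ennreal (exp (- 16)) * (\<Sum>k\<in>{j..<3*j}. ennreal (\<Theta> X) * cell k X) \<le> ennreal ((cmod (F X))\<^sup>2 * ?w X)"
    proof (cases "nat \<lfloor>T X\<rfloor> \<in> {j..<3*j} \<and> 0 \<le> T X \<and> X \<in> \<Omega>")
      case True
      then have "real j \<le> T X" "T X \<le> 3 * real j" by (auto simp: nat_le_iff le_nat_iff) linarith+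
      then have "1 / 4 \<le> T X / R" "T X / R \<le> 3 / 4" using R j(1) by (simp_all add: R_def field_simps)
      then have "exp (- 16) * \<Theta> X \<le> (cutoff (T X / R))\<^sup>2 * \<Theta> X"
        by (intro mult_right_mono cutoff_ge \<Theta>0)
      also have "\<dots> = (cmod (F X))\<^sup>2 * ?w X" using True
        by (simp add: \<Theta>_def F_def norm_mult power_mult_distrib mult_ac)
      finally show ?thesis unfolding csum[OF finite_atLeastLessThan] using True
        by (simp add: ennreal_mult[symmetric] \<Theta>0)
    next
      case False
      then have z: "(\<Sum>k\<in>{j..<3*j}. ennreal (\<Theta> X) * cell k X) = 0"
        unfolding csum[OF finite_atLeastLessThan] by (auto simp: \<Theta>_def)
      show ?thesis unfolding z by simp
    qed
  qed
  \<comment> \<open>The square of \<open>cutoff'\<close> is at most \<open>4\<close>, the factor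
    \<open>1 / R\<close> enters squared, and the strip \<open>0 < T < R\<close> is covered by
    \<open>4 * j\<close> cells.\<close>
  have upper: "ennreal D \<le> ennreal (4 / R\<^sup>2) * (of_nat (card {..<4*j}) * m)"
    unfolding sumcell[OF finite_lessThan, symmetric] Dnn
  proof (rule nn_integral_mono)
    fix X
    show "ennreal ((cmod (euler F X + \<kappa> *\<^sub>R F X))\<^sup>2 * ?w X) \<le> ennreal (4 / R\<^sup>2) * (\<Sum>k\<in>{..<4*j}. ennreal (\<Theta> X) * cell k X)"
    proof (cases "X \<in> \<Omega> \<and> 0 < T X \<and> T X < R")
      case True
      then have n: "nat \<lfloor>T X\<rfloor> \<in> {..<4*j}" by (simp add: R_def) linarith
      have "(cmod (euler F X + \<kappa> *\<^sub>R F X))\<^sup>2 * ?w X = (cutoff' (T X / R))\<^sup>2 / R\<^sup>2 * \<Theta> X"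
        using True by (simp add: Eu \<Theta>_def norm_mult norm_divide power_mult_distrib power_divide mult_ac del: of_real_mult of_real_divide)
      also have "\<dots> \<le> 4 / R\<^sup>2 * \<Theta> X"
        by (intro mult_right_mono divide_right_mono cutoff'_bound \<Theta>0) simp
      finally show ?thesis unfolding csum[OF finite_lessThan] using True n
        by (simp add: ennreal_mult[symmetric] \<Theta>0 ennreal_leI)
    next
      case False
      then have "T X / R \<le> 0 \<or> 1 \<le> T X / R" if "X \<in> \<Omega>" using that R by (auto simp: field_simps)
      then have "euler F X + \<kappa> *\<^sub>R F X = 0" using Eu Eu0 cutoff_0(2) by (cases "X \<in> \<Omega>") auto
      then show ?thesis by simp
    qed
  qed
  \<comment> \<open>Finiteness comes for free from the lower estimate, since \<open>V\<close> is a
    real number and \<open>j > 0\<close>.\<close>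
  have "m < \<infinity>"
  proof (rule ccontr)
    assume "\<not> m < \<infinity>"
    then have "m = \<infinity>" by (simp add: less_top[symmetric])
    then have "ennreal (exp (- 16)) * (of_nat (card {j..<3*j}) * m) = \<infinity>"
      using j(1) by (simp add: ennreal_mult_eq_top_iff)
    then show False using lower by (simp add: top_unique)
  qed
  then obtain m' where m': "m = ennreal m'" "m' \<ge> 0" by (cases m) auto
  have lo: "exp (- 16) * (2 * real j * m') \<le> V"
  proof -
    have "ennreal (exp (- 16) * (2 * real j * m')) = ennreal (exp (- 16)) * (of_nat (card {j..<3*j}) * m)"
      using m' by (simp add: ennreal_mult ennreal_of_nat_eq_real_of_nat mult.assoc)
    then have "ennreal (exp (- 16) * (2 * real j * m')) \<le> ennreal V" using lower by (simp only:)
    then show ?thesis using V0(1) by (simp only: ennreal_le_iff)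
  qed
  have up: "D \<le> 4 / R\<^sup>2 * (4 * real j * m')"
  proof -
    have "ennreal (4 / R\<^sup>2 * (4 * real j * m')) = ennreal (4 / R\<^sup>2) * (of_nat (card {..<4*j}) * m)"
    proof -
      have "(of_nat (card {..<4*j}) :: ennreal) = ennreal (4 * real j)"
        unfolding card_lessThan ennreal_of_nat_eq_real_of_nat by simp
      then show ?thesis
        using m' by (simp only: ennreal_mult[symmetric] mult_nonneg_nonneg of_nat_0_le_iff zero_le_numeral
            zero_le_divide_iff zero_le_power2 simp_thms)
    qed
    then have le: "ennreal D \<le> ennreal (4 / R\<^sup>2 * (4 * real j * m'))" using upper by (simp only:)
    have "0 \<le> 4 / R\<^sup>2 * (4 * real j * m')" using m'(2) by simp
    from iffD1[OF ennreal_le_iff[OF this] le] show ?thesis .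
  qed
  have DV: "D \<le> \<epsilon> * V"
  proof -
    have "4 / R\<^sup>2 * (4 * real j * m') = m' / real j" using j(1) by (simp add: R_def power2_eq_square)
    with up have "D \<le> m' / real j" by simp
    also have "\<dots> \<le> m' * (2 * real j * \<epsilon> * exp (- 16))"
    proof -
      have "exp 16 \<le> 2 * \<epsilon> * real j" using j(2) \<epsilon> by (simp add: field_simps)
      also have "\<dots> \<le> 2 * \<epsilon> * real j * real j" using j(1) \<epsilon> by (simp add: mult_left_le)
      finally have "1 / real j \<le> 2 * real j * \<epsilon> * exp (- 16)"
        using j(1) by (simp add: exp_minus field_simps)
      from mult_left_mono[OF this m'(2)] show ?thesis by simp
    qed
    also have "\<dots> = \<epsilon> * (exp (- 16) * (2 * real j * m'))" by (simp add: mult_ac)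
    also have "\<dots> \<le> \<epsilon> * V" using lo \<epsilon> by (intro mult_left_mono) auto
    finally show ?thesis .
  qed
  have "V \<noteq> 0"
  proof
    assume V: "V = 0"
    \<comment> \<open>The point halfway along the truncated orbit of the eigenvector, where
      \<open>S = 0\<close> and the cut-off is evaluated at \<open>1 / 2\<close>.\<close>
    let ?X = "dil (exp (R / 2)) b1"
    have x1b: "x1 b1 = 1" using b1 by (simp add: x1_def coord_basis)
    have b\<Omega>: "b1 \<in> \<Omega>" by (simp add: \<Omega>_def x1b)
    have "S b1 = 0" unfolding S_def using b1 by (intro sum.neutral) (auto simp: coord_basis)
    then have "P b1 > 0" by (simp add: P_def x1b flat_exp_def)
    moreover have "T b1 = 0" by (simp add: T_def x1b)
    moreover have "cutoff (1 / 2) > 0" by (simp add: cutoff_def flat_exp_def)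
    ultimately have "F ?X \<noteq> 0" using R b\<Omega> by (simp add: F_def \<Omega>d Td Pd)
    moreover have "?X \<in> \<Omega>" using b\<Omega> by (simp add: \<Omega>d)
    then have "?X \<noteq> 0" using \<open>0 \<notin> \<Omega>\<close> by auto
    then have "qn ?X > 0" by (rule qn_pos)
    moreover have "(cmod (F ?X))\<^sup>2 * ?w ?X = 0"
      by (rule integral_eq_0_imp_eq_0[OF ii(1) cc(1)]) (use V in \<open>auto simp: V_def\<close>)
    ultimately show False by simp
  qed
  then have "V > 0" using V0 by simp
  show ?thesis by (rule that[OF F K K0 F0]) (use DV \<open>V > 0\<close> in \<open>simp_all add: V_def D_def\<close>)
qed

end

theorem corollary4p2:
  fixes \<A> :: "('g::{topological_group_add, t2_space, second_countable_topology},
               'a::euclidean_space) chart set"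
    and E :: "'a \<Rightarrow> 'g"
    and bracket :: "'a \<Rightarrow> 'a \<Rightarrow> 'a"
    and A :: "'a \<Rightarrow> 'a"
    and \<mu> :: "'g measure"
    and N :: "'g \<Rightarrow> real"
    and \<alpha> Q :: real
  assumes "homogeneous_group \<A> E bracket A"
    and "Q = operator_trace A"
    and "Q \<ge> 3"
    and "haar_measure \<mu>"
    and "homogeneous_quasi_norm E A N"
    and "Q - 2 * \<alpha> - 2 \<noteq> 0"
  shows
    "(\<forall>f \<in> test_functions \<A>.
        square_integrable \<mu> (\<lambda>x. f x / of_real (N x powr (\<alpha> + 1))) \<and>
        square_integrable \<mu> (\<lambda>x. 1 / of_real (N x powr \<alpha>) * radial_derivative E A N f x) \<and>
        L2_norm \<mu> (\<lambda>x. f x / of_real (N x powr (\<alpha> + 1)))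
          \<le> 2 / \<bar>Q - 2 - 2 * \<alpha>\<bar> *
            L2_norm \<mu> (\<lambda>x. 1 / of_real (N x powr \<alpha>) * radial_derivative E A N f x)) \<and>
     (\<forall>C::real.
        (\<forall>f \<in> test_functions \<A>.
           L2_norm \<mu> (\<lambda>x. f x / of_real (N x powr (\<alpha> + 1)))
             \<le> C * L2_norm \<mu> (\<lambda>x. 1 / of_real (N x powr \<alpha>) * radial_derivative E A N f x))
        \<longrightarrow> 2 / \<bar>Q - 2 - 2 * \<alpha>\<bar> \<le> C) \<and>
     (\<forall>f \<in> test_functions \<A>.
        L2_norm \<mu> (\<lambda>x. f x / of_real (N x powr (\<alpha> + 1)))
          = 2 / \<bar>Q - 2 - 2 * \<alpha>\<bar> *
            L2_norm \<mu> (\<lambda>x. 1 / of_real (N x powr \<alpha>) * radial_derivative E A N f x)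
        \<longleftrightarrow> f = (\<lambda>x. 0))"
proof -
  interpret homogeneous_group \<A> E bracket A by fact
  interpret quasi_normed_group \<A> E bracket A N by unfold_locales fact
  have s\<mu>: "sets \<mu> = sets borel" using assms(4) by (simp add: haar_measure_def)
  obtain c where c: "c > 0" and \<mu>: "distr \<mu> borel (inv E) = density lborel (\<lambda>_. ennreal c)"
    using haar_measure_coordinates[OF assms(4)] by blast
  define \<kappa> where "\<kappa> = (operator_trace A - 2 * \<alpha> - 2) / 2"
  have \<kappa>0: "\<kappa> \<noteq> 0" and \<kappa>eq: "2 / \<bar>Q - 2 - 2 * \<alpha>\<bar> = 1 / \<bar>\<kappa>\<bar>"
    using assms(2,6) by (auto simp: \<kappa>_def field_simps abs_if)
  let ?v = "\<lambda>f x. f x / of_real (N x powr (\<alpha> + 1)) :: complex"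
  let ?w = "\<lambda>f x. 1 / of_real (N x powr \<alpha>) * radial_derivative E A N f x"
  define V where "V = (\<lambda>F. \<integral>X. (cmod (F X))\<^sup>2 * qn X powr (- 2 * \<alpha> - 2) \<partial>lborel)"
  define D where "D = (\<lambda>F. \<integral>X. (cmod (euler F X + \<kappa> *\<^sub>R F X))\<^sup>2 * qn X powr (- 2 * \<alpha> - 2) \<partial>lborel)"
  have V0: "V F \<ge> 0" and D0: "D F \<ge> 0" for F unfolding V_def D_def by simp_all
  have norms: "square_integrable \<mu> (?v f)" "square_integrable \<mu> (?w f)"
    "L2_norm \<mu> (?v f) = sqrt (c * V (\<lambda>X. f (E X)))"
    "L2_norm \<mu> (?w f) = sqrt (c * (\<kappa>\<^sup>2 * V (\<lambda>X. f (E X)) + D (\<lambda>X. f (E X))))"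
    if f: "f \<in> test_functions \<A>" for f
  proof -
    obtain K where F: "smooth_on UNIV (\<lambda>X. f (E X))" "compact K" "0 \<notin> K" "\<And>X. X \<notin> K \<Longrightarrow> f (E X) = 0"
      using test_function_coordinates[OF f] by blast
    show "square_integrable \<mu> (?v f)" "square_integrable \<mu> (?w f)"
      using hardy_norms(1,2)[OF s\<mu> \<mu> c F] by blast+
    show "L2_norm \<mu> (?v f) = sqrt (c * V (\<lambda>X. f (E X)))"
      using hardy_norms(3)[OF s\<mu> \<mu> c F] by (simp add: V_def)
    show "L2_norm \<mu> (?w f) = sqrt (c * (\<kappa>\<^sup>2 * V (\<lambda>X. f (E X)) + D (\<lambda>X. f (E X))))"
      using hardy_norms(4)[OF s\<mu> \<mu> c F, of \<alpha>] hardy_identity[OF F, of \<alpha>] by (simp add: V_def D_def \<kappa>_def)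
  qed
  \<comment> \<open>With the left norm in this form, the inequality is \<open>D F \<ge> 0\<close>
    and equality is \<open>D F = 0\<close>.\<close>
  have scaled: "sqrt (c * V F) = 1 / \<bar>\<kappa>\<bar> * sqrt (c * (\<kappa>\<^sup>2 * V F))" for F
    using \<kappa>0 by (simp add: real_sqrt_mult real_sqrt_abs)
  have ineq: "L2_norm \<mu> (?v f) \<le> 1 / \<bar>\<kappa>\<bar> * L2_norm \<mu> (?w f)" if "f \<in> test_functions \<A>" for f
    unfolding norms(3,4)[OF that] scaled using c D0 by (intro mult_left_mono real_sqrt_le_mono) auto
  have eq: "L2_norm \<mu> (?v f) = 1 / \<bar>\<kappa>\<bar> * L2_norm \<mu> (?w f) \<longleftrightarrow> f = (\<lambda>x. 0)" if f: "f \<in> test_functions \<A>" for f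
  proof
    assume "f = (\<lambda>x. 0)"
    then have "V (\<lambda>X. f (E X)) = 0" "D (\<lambda>X. f (E X)) = 0" by (simp_all add: V_def D_def euler_def)
    then show "L2_norm \<mu> (?v f) = 1 / \<bar>\<kappa>\<bar> * L2_norm \<mu> (?w f)" unfolding norms(3,4)[OF f] by simp
  next
    assume eq: "L2_norm \<mu> (?v f) = 1 / \<bar>\<kappa>\<bar> * L2_norm \<mu> (?w f)"
    obtain K where F: "smooth_on UNIV (\<lambda>X. f (E X))" "compact K" "0 \<notin> K" "\<And>X. X \<notin> K \<Longrightarrow> f (E X) = 0"
      using test_function_coordinates[OF f] by blast
    let ?F = "\<lambda>X. f (E X)"
    have "c * (\<kappa>\<^sup>2 * V ?F) = c * (\<kappa>\<^sup>2 * V ?F + D ?F)"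
      using eq \<kappa>0 unfolding norms(3,4)[OF f] scaled by simp
    then have D: "D ?F = 0" using c by (simp add: algebra_simps)
    have e0: "euler ?F X = 0" if "X \<notin> K" for X
      using euler_outside[OF compact_imp_closed[OF F(2)] F(4) that] by simp
    have cont: "continuous_on UNIV (\<lambda>X. (cmod (euler ?F X + \<kappa> *\<^sub>R ?F X))\<^sup>2 * qn X powr (- 2 * \<alpha> - 2))"
      by (rule continuous_on_weighted[OF F(2,3)])
        (use F(4) e0 in \<open>auto intro!: continuous_intros continuous_on_euler F(1) smooth_on_continuous_on[OF F(1)]\<close>)
    have "(cmod (euler ?F X + \<kappa> *\<^sub>R ?F X))\<^sup>2 * qn X powr (- 2 * \<alpha> - 2) = 0" for X
      by (rule integral_eq_0_imp_eq_0[OF integrable_compact_support[OF F(2) cont] cont])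
        (use D F(4) e0 in \<open>auto simp: D_def\<close>)
    then have h0: "euler ?F X + \<kappa> *\<^sub>R ?F X = 0" if "X \<noteq> 0" for X
      using qn_pos[OF that] by (metis mult_eq_0_iff norm_eq_zero order_less_irrefl powr_eq_0_iff zero_eq_power2)
    have "?F X = 0" for X
      by (rule homogeneous_compact_support_eq_0[OF F h0])
    then show "f = (\<lambda>x. 0)" using E_inv_E by (metis ext)
  qed
  have sharp: "1 / \<bar>\<kappa>\<bar> \<le> C"
    if C: "\<forall>f \<in> test_functions \<A>. L2_norm \<mu> (?v f) \<le> C * L2_norm \<mu> (?w f)" for C
  proof -
    \<comment> \<open>Positivity of \<open>C\<close> is recorded as well, because after squaring a
      negative \<open>C\<close> could no longer be excluded.\<close>
    have *: "1 \<le> C\<^sup>2 * (\<kappa>\<^sup>2 + \<epsilon>) \<and> C > 0" if \<epsilon>: "\<epsilon> > 0" for \<epsilon>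
    proof -
      obtain F :: "'a \<Rightarrow> complex" and K where F: "smooth_on UNIV F" "compact K" "0 \<notin> K" "\<And>X. X \<notin> K \<Longrightarrow> F X = 0"
        and VD: "V F > 0" "D F \<le> \<epsilon> * V F"
        using almost_extremal_exists[of \<kappa> \<alpha> \<epsilon>] \<epsilon> unfolding V_def D_def by (auto simp: \<kappa>_def field_simps)
      define f where "f = (\<lambda>x. F (inv E x))"
      have f: "f \<in> test_functions \<A>" unfolding f_def by (rule test_functionI[OF F])
      have fE: "(\<lambda>X. f (E X)) = F" by (simp add: f_def inv_E_E)
      have le: "sqrt (c * V F) \<le> C * sqrt (c * (\<kappa>\<^sup>2 * V F + D F))"
        using bspec[OF C f] unfolding norms(3,4)[OF f] fE .
      have pos: "sqrt (c * V F) > 0" using c VD by simp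
      have nn: "sqrt (c * (\<kappa>\<^sup>2 * V F + D F)) \<ge> 0" using c VD D0 by simp
      have C0: "C > 0" using le pos nn by (smt (verit) mult_nonpos_nonneg)
      have "c * V F = (sqrt (c * V F))\<^sup>2" using c VD by simp
      also have "\<dots> \<le> (C * sqrt (c * (\<kappa>\<^sup>2 * V F + D F)))\<^sup>2" using le pos by (intro power_mono) auto
      also have "\<dots> = C\<^sup>2 * (c * (\<kappa>\<^sup>2 * V F + D F))" using c VD D0[of F] by (simp add: power_mult_distrib)
      also have "\<dots> \<le> C\<^sup>2 * (c * (\<kappa>\<^sup>2 * V F + \<epsilon> * V F))"
        using c VD by (intro mult_left_mono add_left_mono) auto
      also have "\<dots> = (c * V F) * (C\<^sup>2 * (\<kappa>\<^sup>2 + \<epsilon>))" by (simp add: algebra_simps)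
      finally have "(c * V F) * 1 \<le> (c * V F) * (C\<^sup>2 * (\<kappa>\<^sup>2 + \<epsilon>))" by simp
      then show ?thesis using c VD C0 by (simp add: mult_le_cancel_left_pos)
    qed
    have C0: "C > 0" using *[of 1] by simp
    have "1 \<le> C\<^sup>2 * \<kappa>\<^sup>2"
    proof (rule field_le_epsilon)
      fix e :: real assume "e > 0"
      \<comment> \<open>Dividing by \<open>C\<^sup>2\<close> makes the error term equal to
        \<open>e\<close> itself.\<close>
      then have "1 \<le> C\<^sup>2 * (\<kappa>\<^sup>2 + e / C\<^sup>2)" using *[of "e / C\<^sup>2"] C0 by simp
      then show "1 \<le> C\<^sup>2 * \<kappa>\<^sup>2 + e" using C0 by (simp add: distrib_left)
    qed
    then have "1\<^sup>2 \<le> (C * \<bar>\<kappa>\<bar>)\<^sup>2" by (simp add: power_mult_distrib)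
    then have "1 \<le> C * \<bar>\<kappa>\<bar>" by (rule power2_le_imp_le) (use C0 in simp)
    then show ?thesis using \<kappa>0 by (simp add: field_simps)
  qed
  show ?thesis
    unfolding \<kappa>eq using norms(1,2) ineq sharp eq by blast
qed

end
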